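(* Let $X$ be an SMD random variable such that $K_{2n}(X)>0$ for every integer $n\ge1$. If $Y$ is a centred real random variable admitting moments of all orders such that $\mathit{mmse}(X,s)=\mathit{mmse}(Y,s)$ for all $s>0$, then $X$ and $Y$ have the same distribution.
   Context: For a real random variable $X$ with moments of all orders, its cumulants are $K_n(X)=(-i)^n(\ln\varphi_X)^{(n)}(0)$, $\varphi_X$ the characteristic function. $X$ is called SMD if $X$ and $-X$ have the same law, $X$ has moments of all orders, and any random variable $Y$ with $\mathbb{E}[Y^p]=\mathbb{E}[X^p]$ for all $p\ge1$ has the same law as $X$. For $s>0$, $\mathit{mmse}(X,s)=\mathbb{E}[(X-\mathbb{E}[X\mid Y_s])^2]$ where $Y_s=\sqrt{s}X+N$ and $N$ is a standard Gaussian independent of $X$. *)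

theory Defs
  imports "HOL-Probability.Probability"
begin

definition law :: "'a measure \<Rightarrow> ('a \<Rightarrow> real) \<Rightarrow> real measure" where
  "law M X = distr M borel X"

definition has_all_moments :: "'a measure \<Rightarrow> ('a \<Rightarrow> real) \<Rightarrow> bool" where
  "has_all_moments M X \<longleftrightarrow> (\<forall>p::nat. integrable M (\<lambda>\<omega>. \<bar>X \<omega>\<bar> ^ p))"

definition nth_vderiv :: "nat \<Rightarrow> (real \<Rightarrow> complex) \<Rightarrow> real \<Rightarrow> complex" where
  "nth_vderiv n f = ((\<lambda>g t. vector_derivative g (at t)) ^^ n) f"

definition cumulant :: "'a measure \<Rightarrow> ('a \<Rightarrow> real) \<Rightarrow> nat \<Rightarrow> complex" where
  "cumulant M X n = (- \<i>) ^ n * nth_vderiv n (\<lambda>t. Ln (char (law M X) t)) 0"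

text \<open>SMD: symmetric, all moments, determined by its moments (among all real random
  variables, i.e. all Borel probability laws on the reals).\<close>
definition SMD :: "'a measure \<Rightarrow> ('a \<Rightarrow> real) \<Rightarrow> bool" where
  "SMD M X \<longleftrightarrow>
     law M X = law M (\<lambda>\<omega>. - X \<omega>) \<and> has_all_moments M X \<and>
     (\<forall>\<nu> :: real measure. prob_space \<nu> \<and> sets \<nu> = sets borel \<and>
        (\<forall>p::nat. p \<ge> 1 \<longrightarrow> integrable \<nu> (\<lambda>y. y ^ p) \<and>
              (\<integral>y. y ^ p \<partial>\<nu>) = (\<integral>\<omega>. X \<omega> ^ p \<partial>M))
        \<longrightarrow> \<nu> = law M X)"

definition std_gaussian :: "real measure" where
  "std_gaussian = density lborel std_normal_density"

text \<open>mmse(X,s) = E[(X - E[X | Y_s])^2], Y_s = sqrt s X + N, N standard Gaussian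
  independent of X; realised on the product space law(X) x N(0,1).\<close>
definition mmse :: "'a measure \<Rightarrow> ('a \<Rightarrow> real) \<Rightarrow> real \<Rightarrow> real" where
  "mmse M X s =
     (let P = law M X \<Otimes>\<^sub>M std_gaussian;
          Ys = (\<lambda>(x, n). sqrt s * x + n);
          F = vimage_algebra (space P) Ys borel
      in \<integral>w. (fst w - real_cond_exp P F fst w)\<^sup>2 \<partial>P)"

end

theory Submission
  imports Defs "HOL-Complex_Analysis.Complex_Analysis"
begin

text \<open>
  Standardise \<open>X\<close> to unit variance and rescale the observation to \<open>Z = t X + sqrt (1 - t\<^sup>2) N\<close>,
  which carries the same information as \<open>sqrt s X + N\<close> when \<open>t\<^sup>2 = s \<sigma>\<^sup>2 / (1 + s \<sigma>\<^sup>2)\<close>.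
  By Mehler's formula the law of \<open>Z\<close> has density \<open>g = \<Sum>k. t^k h_k / k! He_k\<close> with respect to the standard
  Gaussian, where \<open>h_k = E He_k(X)\<close>, and
  \<open>mmse = \<sigma>\<^sup>2 ((1 - t\<^sup>2) - (1 - t\<^sup>2)\<^sup>2 J(t))\<close> where \<open>J\<close> has an asymptotic expansion as \<open>t \<rightarrow> 0\<close> given by the
  formal series \<open>E(H\<^sup>2 / g)\<close>, \<open>H = \<Sum>k. t^k h_(k+1) / k! He_k\<close>. So equal mmse means equal coefficients.

  Suppose the \<open>h_k\<close> of \<open>X\<close> and \<open>Y\<close> agree for \<open>k < n\<close> and differ by \<open>d_n\<close>, \<open>d_(n+1)\<close> next. With \<open>v = \<kappa>'\<close>, \<open>\<kappa>\<close> being the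
  cumulant generating function of \<open>X\<close> without its quadratic term, the coefficients of order \<open>2n - 2\<close> and \<open>2n\<close> give
  \<open>d_n (2 K_n + d_n) = 0\<close> and, for even \<open>n\<close>, \<open>d_(n+1)\<^sup>2 = n! (n + 1) d_n (v\<^sup>2)_n\<close>. Positivity of the even
  cumulants makes \<open>(v\<^sup>2)_n > 0\<close> for \<open>n \<ge> 6\<close>, so \<open>d_n \<ge> 0\<close> and the branch \<open>d_n = - 2 K_n < 0\<close> is excluded.
  For \<open>n = 4\<close> the orders 10 and 12 are needed.
\<close>

unbundle no vec_syntax
unbundle fps_syntax

section \<open>Hermite polynomials and the Gaussian functional\<close>

text \<open>Nothing here may rely on convergence: \<open>X\<close> may lack exponential moments, so
  the series for \<open>g\<close> can diverge. The risk is therefore not computed by expanding a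
  density. Truncating the formal posterior mean \<open>t z + (1 - t\<^sup>2) H / g\<close> at order
  m gives a polynomial estimator whose loss is a finite combination of moments. Its excess over the
  optimum is quadratic in the error, so an error of order t^m costs only t^(2m), and finitely many
  moments pay for it.

  On the formal side, \<open>He_k\<close> is orthogonal to every polynomial of degree below k. So a
  first discrepancy at index n is invisible before order 2n - 2, where it enters linearly through
  \<open>H\<close> and quadratically through a Hermite norm. The resulting quadratic equation also
  allows the reflected value \<open>- K_n\<close>, and it takes the sign of the next even order to
  rule this out. That sign is carried by \<open>(v\<^sup>2)_n\<close>. Since \<open>v\<close> starts
  with \<open>K_4 t^3 / 6\<close>, its square starts at t^6; this is why n = 4 escapes the general
  argument and needs cubic terms.\<close>

fun hermite :: "nat \<Rightarrow> real poly" where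
  "hermite 0 = 1"
| "hermite (Suc 0) = [:0, 1:]"
| "hermite (Suc (Suc n)) = [:0, 1:] * hermite (Suc n) - smult (real (Suc n)) (hermite n)"

lemma hermite_1 [simp]: "hermite 1 = [:0, 1:]"
  by (simp add: One_nat_def)

declare hermite.simps(3) [simp del]

text \<open>The raising operator z - d/dz and the lowering operator d/dz share one induction,
  because the derivative formula at the next index uses both identities at the current one.\<close>

lemma hermite_Suc: "hermite (Suc n) = [:0, 1:] * hermite n - pderiv (hermite n)"
  and pderiv_hermite_Suc: "pderiv (hermite (Suc n)) = smult (real (Suc n)) (hermite n)"
proof (induction n)
  case 0
  { case 1 show ?case by (simp add: pderiv_1) }
  { case 2 show ?case by (simp add: pderiv_pCons) }
next
  case (Suc n)
  { case 1 show ?case by (simp add: hermite.simps(3) Suc.IH(2)) }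
  { case 2
    have "pderiv (hermite (Suc (Suc n))) =
        hermite (Suc n) + [:0, 1:] * smult (real (Suc n)) (hermite n) - smult (real (Suc n)) (pderiv (hermite n))"
      by (simp add: hermite.simps(3) pderiv_diff pderiv_mult pderiv_smult Suc.IH(2) pderiv_pCons)
    also have "\<dots> = hermite (Suc n) + smult (real (Suc n)) (hermite (Suc n))"
      by (simp add: Suc.IH(1) smult_diff_right)
    also have "\<dots> = smult (real (Suc (Suc n))) (hermite (Suc n))"
      by (rule poly_eqI) (simp add: algebra_simps)
    finally show ?case . }
qed

lemma coeff_hermite_Suc_Suc:
  "coeff (hermite (Suc (Suc n))) i =
     (if i = 0 then 0 else coeff (hermite (Suc n)) (i - 1)) - real (Suc n) * coeff (hermite n) i"
  by (simp add: hermite.simps(3) coeff_pCons split: nat.splits)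

lemma coeff_hermite_eq_0: "i > n \<Longrightarrow> coeff (hermite n) i = 0"
  by (induction n arbitrary: i rule: hermite.induct)
     (auto simp: coeff_hermite_Suc_Suc coeff_pCons split: nat.splits)

lemma degree_hermite_le: "degree (hermite n) \<le> n"
  by (rule degree_le) (simp add: coeff_hermite_eq_0)

lemma coeff_hermite_self [simp]: "coeff (hermite n) n = 1"
  by (induction n rule: hermite.induct) (auto simp: coeff_hermite_Suc_Suc coeff_hermite_eq_0)

lemma coeff_hermite_sub1: "coeff (hermite (Suc n)) n = 0"
  by (induction n) (auto simp: coeff_hermite_Suc_Suc coeff_hermite_eq_0)

lemma coeff_hermite_sub2: "coeff (hermite (n + 2)) n = - (real (n + 2) * real (n + 1) / 2)"
proof (induction n)
  case 0
  show ?case by (simp add: coeff_hermite_Suc_Suc numeral_2_eq_2)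
next
  case (Suc n)
  then show ?case by (simp add: coeff_hermite_Suc_Suc field_simps)
qed

lemma poly_hermite_minus: "poly (hermite n) (- x) = (-1) ^ n * poly (hermite n) x"
  by (induction n rule: hermite.induct) (auto simp: hermite.simps(3) algebra_simps)

lemma hermite_explicit:
  "hermite 2 = [:-1, 0, 1:]" "hermite 3 = [:0, -3, 0, 1:]" "hermite 4 = [:3, 0, -6, 0, 1:]"
  "hermite 5 = [:0, 15, 0, -10, 0, 1:]"
  by (simp_all add: eval_nat_numeral hermite.simps(3))

section \<open>Gaussian expectations of polynomials and Hermite orthogonality\<close>

definition gauss :: "real poly \<Rightarrow> real" where
  "gauss p = (\<integral>z. poly p z \<partial>std_gaussian)"

lemma sets_std_gaussian [simp, measurable_cong]: "sets std_gaussian = sets borel"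
  and space_std_gaussian [simp]: "space std_gaussian = UNIV"
  by (auto simp: std_gaussian_def)

lemma prob_space_std_gaussian: "prob_space std_gaussian"
  unfolding std_gaussian_def by (rule prob_space_normal_density) simp

lemma integrable_std_gaussian_power: "integrable std_gaussian (\<lambda>z. z ^ n)"
  unfolding std_gaussian_def using integrable_std_normal_moment[of n]
  by (subst integrable_density) auto

lemma integrable_std_gaussian_poly: "integrable std_gaussian (poly p)"
proof -
  have "poly p = (\<lambda>x. \<Sum>i\<le>degree p. coeff p i * x ^ i)" by (rule ext) (rule poly_altdef)
  then show ?thesis using integrable_std_gaussian_power by auto
qed

lemma gauss_add: "gauss (p + q) = gauss p + gauss q"
  and gauss_diff: "gauss (p - q) = gauss p - gauss q"
  and gauss_smult: "gauss (smult c p) = c * gauss p"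
  and gauss_0 [simp]: "gauss 0 = 0"
  by (simp_all add: gauss_def integrable_std_gaussian_poly)

lemma gauss_sum: "gauss (sum f A) = (\<Sum>i\<in>A. gauss (f i))"
  by (induction A rule: infinite_finite_induct) (auto simp: gauss_add)

lemma gauss_1: "gauss 1 = 1"
  by (simp add: gauss_def prob_space.prob_space[OF prob_space_std_gaussian, simplified])

lemma gauss_monom: "gauss (monom c n) = c * (\<integral>z. std_normal_density z * z ^ n \<partial>lborel)"
  by (simp add: gauss_def std_gaussian_def poly_monom integral_density)

text \<open>Integration by parts for monomials, read off the closed forms of the even and odd
  moments.\<close>

lemma gauss_monom_Suc_Suc: "gauss (monom c (n + 2)) = real (n + 1) * gauss (monom c n)"
proof (cases "even n")
  case True
  then obtain k where n: "n = 2 * k" by blast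
  have *: "gauss (monom c (2 * j)) = c * (fact (2 * j) / (2 ^ j * fact j))" for j
    by (simp add: gauss_monom integral_std_normal_moment_even)
  have "gauss (monom c (2 * Suc k)) = real (2 * k + 1) * gauss (monom c (2 * k))"
    unfolding * by (simp add: divide_simps) (simp add: algebra_simps)?
  then show ?thesis by (simp add: n)
next
  case False
  then obtain k where n: "n = 2 * k + 1" by (auto elim: oddE)
  have *: "gauss (monom c (2 * j + 1)) = 0" for j
    by (simp only: gauss_monom integral_std_normal_moment_odd mult_zero_right)
  show ?thesis using *[of k] *[of "Suc k"] by (simp add: n)
qed

text \<open>Stein's identity. Both sides are linear in \<open>p\<close>, so it reduces to monomials,
  where it is the moment recursion.\<close>

lemma gauss_stein: "gauss ([:0, 1:] * p) = gauss (pderiv p)"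
proof -
  have *: "gauss ([:0, 1:] * monom c n) = gauss (pderiv (monom c n))" for c n
  proof (cases n)
    case 0
    have "gauss (monom c 1) = 0"
      using integral_std_normal_moment_odd[of 0] by (simp add: gauss_monom)
    then show ?thesis using 0 by (simp add: monom_Suc pderiv_monom)
  next
    case (Suc k)
    have "[:0, 1:] * monom c n = monom c (k + 2)"
      by (simp add: Suc monom_Suc)
    moreover have "pderiv (monom c n) = smult (real (k + 1)) (monom c k)"
      by (simp add: Suc pderiv_monom smult_monom)
    ultimately show ?thesis
      using gauss_monom_Suc_Suc[of c k] by (simp only: gauss_smult)
  qed
  have pderiv_sum: "pderiv (sum f A) = (\<Sum>i\<in>A. pderiv (f i))" for f :: "nat \<Rightarrow> real poly" and A
    using higher_pderiv_sum[of 1 f A] by simp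
  show ?thesis
    by (subst (1 2) poly_as_sum_of_monoms[symmetric])
       (simp only: sum_distrib_left pderiv_sum gauss_sum *)
qed

text \<open>Stein's identity makes z - d/dz the adjoint of d/dz, and z - d/dz is what produces
  \<open>hermite (Suc n)\<close>.\<close>

lemma gauss_mult_hermite_Suc: "gauss (p * hermite (Suc n)) = gauss (pderiv p * hermite n)"
proof -
  have "gauss (p * hermite (Suc n)) = gauss ([:0, 1:] * (p * hermite n)) - gauss (p * pderiv (hermite n))"
    by (simp only: hermite_Suc gauss_diff[symmetric]) (simp add: algebra_simps)
  also have "\<dots> = gauss (pderiv p * hermite n)"
    by (simp only: gauss_stein pderiv_mult gauss_add) (simp add: mult.commute)
  finally show ?thesis .
qed

lemma gauss_mult_hermite: "gauss (p * hermite n) = gauss ((pderiv ^^ n) p)"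
  by (induction n arbitrary: p) (auto simp: gauss_mult_hermite_Suc funpow_swap1)

lemma gauss_mult_hermite_eq_0:
  assumes "degree p < n"
  shows "gauss (p * hermite n) = 0"
proof -
  have "(pderiv ^^ n) p = 0"
    using assms
  proof (induction n arbitrary: p)
    case (Suc n)
    show ?case
    proof (cases "degree p = 0")
      case True
      then have "pderiv p = 0" by (simp add: pderiv_eq_0_iff)
      then show ?thesis by (simp add: funpow_swap1)
    next
      case False
      then have "degree (pderiv p) < n" using Suc.prems by (simp add: degree_pderiv)
      then show ?thesis using Suc.IH by (simp add: funpow_swap1)
    qed
  qed simp
  then show ?thesis by (simp add: gauss_mult_hermite)
qed

lemma gauss_hermite_mult_hermite:
  "gauss (hermite m * hermite n) = (if m = n then fact n else 0)"
proof -
  have "gauss (hermite n * hermite n) = fact n"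
    by (induction n) (simp_all add: gauss_1 gauss_mult_hermite_Suc pderiv_hermite_Suc gauss_smult del: of_nat_Suc)
  moreover have "gauss (hermite m * hermite n) = 0" if "m < n" for m n
    using gauss_mult_hermite_eq_0[of "hermite m" n] degree_hermite_le[of m] that by simp
  ultimately show ?thesis
    by (metis linorder_neqE_nat mult.commute)
qed

text \<open>Subtracting the right multiple of \<open>hermite n\<close> from \<open>p\<close> leaves
  a remainder of smaller degree, which is orthogonal to \<open>hermite n\<close>.\<close>

lemma gauss_mult_hermite_top:
  assumes "degree p \<le> n"
  shows "gauss (p * hermite n) = fact n * coeff p n"
proof -
  define r where "r = p - smult (coeff p n) (hermite n)"
  have "r = 0 \<or> degree r < n"
  proof -
    have "degree r \<le> n" unfolding r_def
      by (intro degree_diff_le assms order_trans[OF degree_smult_le] degree_hermite_le)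
    moreover have "coeff r n = 0" by (simp add: r_def)
    ultimately show ?thesis
      by (metis eq_zero_or_degree_less)
  qed
  then have "gauss (r * hermite n) = 0"
    using gauss_mult_hermite_eq_0 by auto
  moreover have "p = r + smult (coeff p n) (hermite n)" by (simp add: r_def)
  then have "gauss (p * hermite n) = gauss (r * hermite n) + coeff p n * gauss (hermite n * hermite n)"
    by (metis distrib_right gauss_add gauss_smult mult_smult_left)
  ultimately show ?thesis by (simp add: gauss_hermite_mult_hermite)
qed

text \<open>Prepared for graded series, whose coefficients skip the power just below the top.
  Removing a multiple of \<open>hermite (n + 2)\<close> brings the degree down to n, and the
  coefficient of z^n in that polynomial is the source of the correction term.\<close>

lemma gauss_mult_hermite_sub2:
  assumes "degree p \<le> n + 2" and "coeff p (n + 1) = 0"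
  shows "gauss (p * hermite n) = fact n * (coeff p n + real (n + 2) * real (n + 1) / 2 * coeff p (n + 2))"
proof -
  define r where "r = p - smult (coeff p (n + 2)) (hermite (n + 2))"
  have "degree r \<le> n"
  proof (rule degree_le, intro allI impI)
    fix i assume "i > n"
    show "coeff r i = 0"
    proof (cases "i > n + 2")
      case True
      then show ?thesis using assms(1) by (simp add: r_def coeff_eq_0 coeff_hermite_eq_0)
    next
      case False
      then have "i = n + 1 \<or> i = n + 2" using \<open>i > n\<close> by auto
      then show ?thesis using assms(2) coeff_hermite_sub1[of "n + 1"] coeff_hermite_self[of "n + 2"] by (auto simp: r_def)
    qed
  qed
  then have "gauss (r * hermite n) = fact n * coeff r n"
    by (rule gauss_mult_hermite_top)
  moreover have "p = r + smult (coeff p (n + 2)) (hermite (n + 2))" by (simp add: r_def)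
  then have "gauss (p * hermite n) = gauss (r * hermite n) + coeff p (n + 2) * gauss (hermite (n + 2) * hermite n)"
    by (metis distrib_right gauss_add gauss_smult mult_smult_left)
  ultimately show ?thesis using coeff_hermite_sub2[of n]
    by (simp only: gauss_hermite_mult_hermite) (simp add: r_def)
qed

section \<open>The formal expansion\<close>

lemma coeff_mult_top:
  fixes p q :: "'a::comm_ring_1 poly"
  assumes "degree p \<le> a" "degree q \<le> c"
  shows "coeff (p * q) (a + c) = coeff p a * coeff q c"
proof -
  have "coeff p b * coeff q (a + c - b) = (if b = a then coeff p a * coeff q c else 0)" if "b \<le> a + c" for b
  proof -
    consider "b < a" | "b = a" | "b > a" by linarith
    then show ?thesis
    proof cases
      case 1
      then have "a + c - b > degree q" using assms that by linarith
      then show ?thesis using 1 by (simp add: coeff_eq_0)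
    next
      case 3
      then show ?thesis using assms by (simp add: coeff_eq_0)
    qed auto
  qed
  then have "coeff (p * q) (a + c) = (\<Sum>b\<le>a + c. if b = a then coeff p a * coeff q c else 0)"
    unfolding coeff_mult by (intro sum.cong) auto
  then show ?thesis by (simp add: sum.delta)
qed

text \<open>The premise on \<open>a = Suc i\<close> says that the coefficient just below a vanishes.
  In this form it is vacuous for a = 0, where \<open>a - 1\<close> would wrongly denote 0
  again.\<close>

lemma coeff_mult_sub1:
  fixes p q :: "'a::comm_ring_1 poly"
  assumes "degree p \<le> a" "degree q \<le> c" "\<And>i. a = Suc i \<Longrightarrow> coeff p i = 0" "\<And>i. c = Suc i \<Longrightarrow> coeff q i = 0"
    and n: "Suc n = a + c"
  shows "coeff (p * q) n = 0"
proof -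
  have "coeff p b * coeff q (n - b) = 0" if "b \<le> n" for b
  proof -
    consider "b > a" | "b = a" | "Suc b = a" | "Suc b < a" by linarith
    then show ?thesis
    proof cases
      case 1 then show ?thesis using assms(1) by (simp add: coeff_eq_0)
    next
      case 2 then show ?thesis using assms(4)[of "n - b"] n that by simp
    next
      case 3 then show ?thesis using assms(3)[of b] by simp
    next
      case 4
      then have "n - b > degree q" using assms(2) n by linarith
      then show ?thesis by (simp add: coeff_eq_0)
    qed
  qed
  then show ?thesis by (simp add: coeff_mult)
qed

text \<open>As neither factor has a coefficient one below its formal degree, the two missing degrees
  must both be lost in the same factor.\<close>

lemma coeff_mult_sub2:
  fixes p q :: "'a::comm_ring_1 poly"
  assumes "degree p \<le> a" "degree q \<le> c" "\<And>i. a = Suc i \<Longrightarrow> coeff p i = 0" "\<And>i. c = Suc i \<Longrightarrow> coeff q i = 0"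
    and n: "n + 2 = a + c"
  shows "coeff (p * q) n =
    (if a \<ge> 2 then coeff p (a - 2) * coeff q c else 0) + (if c \<ge> 2 then coeff p a * coeff q (c - 2) else 0)"
proof -
  have "coeff p b * coeff q (n - b) =
     (if b = a - 2 then if a \<ge> 2 then coeff p (a - 2) * coeff q c else 0 else 0) +
     (if b = a then if c \<ge> 2 then coeff p a * coeff q (c - 2) else 0 else 0)" if "b \<le> n" for b
  proof -
    consider "b > a" | "b = a" | "Suc b = a" | "b + 2 = a" | "b + 2 < a" by linarith
    then show ?thesis
    proof cases
      case 1 then show ?thesis using assms(1) by (simp add: coeff_eq_0)
    next
      case 2
      then have "c \<ge> 2" "n - b = c - 2" using that n by auto
      then show ?thesis using 2 by auto
    next
      case 3
      then show ?thesis using assms(3)[of b] by auto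
    next
      case 4
      then have "n - b = c" "a \<ge> 2" "b = a - 2" using n by auto
      then show ?thesis by auto
    next
      case 5
      then have "n - b > degree q" using assms(2) n by linarith
      then show ?thesis using 5 by (simp add: coeff_eq_0)
    qed
  qed
  then have "coeff (p * q) n = (\<Sum>b\<le>n.
     (if b = a - 2 then if a \<ge> 2 then coeff p (a - 2) * coeff q c else 0 else 0) +
     (if b = a then if c \<ge> 2 then coeff p a * coeff q (c - 2) else 0 else 0))"
    unfolding coeff_mult by (intro sum.cong) auto
  also have "\<dots> = (if a \<ge> 2 then coeff p (a - 2) * coeff q c else 0) + (if c \<ge> 2 then coeff p a * coeff q (c - 2) else 0)"
    unfolding sum.distrib using n by (auto simp: sum.delta)
  finally show ?thesis .
qed

text \<open>The power series variable is \<open>t\<close>, the polynomial variable is \<open>z\<close>. In terms of \<open>w = t z\<close>, a graded series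
  is \<open>F0(w) + t\<^sup>2 F1(w) + \<dots>\<close>, and the two layers are \<open>F0\<close> and \<open>F1\<close>.\<close>

definition graded :: "real poly fps \<Rightarrow> bool" where
  "graded F \<longleftrightarrow> (\<forall>j. degree (F $ j) \<le> j \<and> (\<forall>i. j = Suc i \<longrightarrow> coeff (F $ j) i = 0))"

definition top_layer :: "real poly fps \<Rightarrow> real fps" where
  "top_layer F = Abs_fps (\<lambda>j. coeff (F $ j) j)"

definition second_layer :: "real poly fps \<Rightarrow> real fps" where
  "second_layer F = Abs_fps (\<lambda>j. coeff (F $ (j + 2)) j)"

lemma gradedD:
  assumes "graded F"
  shows "degree (F $ j) \<le> j" and "j = Suc i \<Longrightarrow> coeff (F $ j) i = 0"
  using assms by (auto simp: graded_def)

text \<open>Stated for a single polynomial \<open>p\<close> instead of a graded series, so that it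
  also serves the strong induction for quotients, where only the earlier coefficients are known to
  obey the grading.\<close>

lemma graded_mult_term:
  fixes F :: "real poly fps"
  assumes "\<And>j. degree (F $ j) \<le> j" "\<And>i. coeff (F $ Suc i) i = 0"
    and "i \<le> k" "degree p \<le> k - i" "\<And>l. k - i = Suc l \<Longrightarrow> coeff p l = 0"
  shows "degree (F $ i * p) \<le> k" and "k = Suc l \<Longrightarrow> coeff (F $ i * p) l = 0"
proof -
  have "degree (F $ i) + degree p \<le> k" using assms(1)[of i] assms(3,4) by linarith
  then show "degree (F $ i * p) \<le> k" using degree_mult_le[of "F $ i" p] by linarith
  show "coeff (F $ i * p) l = 0" if "k = Suc l"
    by (rule coeff_mult_sub1[where a = i and c = "k - i"]) (use assms that in auto)
qed

lemma graded_mult: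
  assumes "graded F" "graded G"
  shows "graded (F * G)"
  unfolding graded_def fps_mult_nth
proof (intro allI conjI impI)
  fix j
  note * = graded_mult_term[of F _ j, OF gradedD(1)[OF assms(1)] gradedD(2)[OF assms(1) refl]
      _ gradedD(1)[OF assms(2)] gradedD(2)[OF assms(2)]]
  show "degree (\<Sum>i = 0..j. F $ i * G $ (j - i)) \<le> j"
    by (rule degree_sum_le) (use * in auto)
  fix i assume "j = Suc i"
  then show "coeff (\<Sum>i = 0..j. F $ i * G $ (j - i)) i = 0"
    unfolding coeff_sum by (intro sum.neutral ballI *(2)) auto
qed

text \<open>With \<open>F $ 0 = 1\<close> the equation determines the coefficients of
  \<open>Q\<close> recursively, and each inherits the grading from the earlier ones.\<close>

lemma graded_quotient:
  assumes F: "graded F" "F $ 0 = 1" and G: "graded G" and eq: "F * Q = G"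
  shows "graded Q"
proof -
  have "degree (Q $ j) \<le> j \<and> (\<forall>i. j = Suc i \<longrightarrow> coeff (Q $ j) i = 0)" for j
  proof (induction j rule: less_induct)
    case (less j)
    have "G $ j = F $ 0 * Q $ j + (\<Sum>i = Suc 0..j. F $ i * Q $ (j - i))"
      unfolding eq[symmetric] fps_mult_nth by (subst sum.atLeast_Suc_atMost) auto
    then have Q: "Q $ j = G $ j - (\<Sum>i = Suc 0..j. F $ i * Q $ (j - i))"
      using F by simp
    have *: "degree (F $ i * Q $ (j - i)) \<le> j" "j = Suc l \<Longrightarrow> coeff (F $ i * Q $ (j - i)) l = 0"
      if "i \<in> {Suc 0..j}" for i l
      using graded_mult_term(1)[of F i j "Q $ (j - i)"] graded_mult_term(2)[of F i j "Q $ (j - i)" l] less[of "j - i"] that gradedD[OF F(1)] by auto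
    show ?case
    proof (intro conjI allI impI)
      show "degree (Q $ j) \<le> j"
        unfolding Q by (intro degree_diff_le degree_sum_le gradedD(1)[OF G] *) auto
      fix i assume "j = Suc i"
      then show "coeff (Q $ j) i = 0"
        unfolding Q coeff_diff coeff_sum using gradedD(2)[OF G] *(2) by (simp add: sum.neutral)
    qed
  qed
  then show ?thesis by (simp add: graded_def)
qed

lemma top_layer_mult:
  assumes "graded F" "graded G"
  shows "top_layer (F * G) = top_layer F * top_layer G"
proof (rule fps_ext)
  fix n
  have "coeff (F $ i * G $ (n - i)) n = coeff (F $ i) i * coeff (G $ (n - i)) (n - i)" if "i \<le> n" for i
    using coeff_mult_top[OF gradedD(1)[OF assms(1)] gradedD(1)[OF assms(2)], of i "n - i"] that by simp
  then show "top_layer (F * G) $ n = (top_layer F * top_layer G) $ n"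
    by (simp add: top_layer_def fps_mult_nth coeff_sum)
qed

lemma second_layer_mult:
  assumes "graded F" "graded G"
  shows "second_layer (F * G) = second_layer F * top_layer G + top_layer F * second_layer G"
proof (rule fps_ext)
  fix n
  define A where "A i = (if i \<ge> 2 then coeff (F $ i) (i - 2) * coeff (G $ (n + 2 - i)) (n + 2 - i) else 0)" for i
  define B where "B i = (if n + 2 - i \<ge> 2 then coeff (F $ i) i * coeff (G $ (n + 2 - i)) (n + 2 - i - 2) else 0)" for i
  have "coeff (F $ i * G $ (n + 2 - i)) n = A i + B i" if "i \<le> n + 2" for i
    unfolding A_def B_def
    by (rule coeff_mult_sub2) (use gradedD[OF assms(1)] gradedD[OF assms(2)] that in auto)
  then have "second_layer (F * G) $ n = (\<Sum>i=0..n+2. A i) + (\<Sum>i=0..n+2. B i)"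
    unfolding second_layer_def fps_nth_Abs_fps fps_mult_nth coeff_sum
    by (subst sum.distrib[symmetric], intro sum.cong) auto
  also have "(\<Sum>i=0..n+2. A i) = (\<Sum>i=2..n+2. A i)"
    by (rule sum.mono_neutral_right) (auto simp: A_def)
  also have "\<dots> = (\<Sum>i=0..n. A (i + 2))"
    using sum.shift_bounds_cl_nat_ivl[of A 0 2 n] by (simp only: add.left_neutral)
  also have "\<dots> = (second_layer F * top_layer G) $ n"
    by (simp add: A_def second_layer_def top_layer_def fps_mult_nth)
  also have "(\<Sum>i=0..n+2. B i) = (\<Sum>i=0..n. B i)"
    by (rule sum.mono_neutral_right) (auto simp: B_def)
  also have "\<dots> = (top_layer F * second_layer G) $ n"
    by (auto simp: B_def second_layer_def top_layer_def fps_mult_nth Suc_diff_le intro!: sum.cong)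
  finally show "second_layer (F * G) $ n = (second_layer F * top_layer G + top_layer F * second_layer G) $ n"
    by simp
qed

section \<open>Hermite series and the formal ratio H / g\<close>

definition hermite_fps :: "(nat \<Rightarrow> real) \<Rightarrow> real poly fps" where
  "hermite_fps d = Abs_fps (\<lambda>k. smult (d k) (hermite k))"

lemma hermite_fps_nth [simp]: "hermite_fps d $ k = smult (d k) (hermite k)"
  by (simp add: hermite_fps_def)

lemma graded_hermite_fps: "graded (hermite_fps d)"
  unfolding graded_def
  by (auto simp: degree_hermite_le coeff_hermite_sub1)

definition dens_fps :: "(nat \<Rightarrow> real) \<Rightarrow> real poly fps" where
  "dens_fps h = hermite_fps (\<lambda>k. h k / fact k)"

definition num_fps :: "(nat \<Rightarrow> real) \<Rightarrow> real poly fps" where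
  "num_fps h = hermite_fps (\<lambda>k. h (Suc k) / fact k)"

text \<open>Polynomials form no field, hence \<open>fps_left_inverse\<close>; its argument 1 inverts
  the constant coefficient of \<open>dens_fps h\<close>, which is 1 as soon as
  \<open>h 0 = 1\<close>.\<close>

definition quot_fps :: "(nat \<Rightarrow> real) \<Rightarrow> real poly fps" where
  "quot_fps h = num_fps h * fps_left_inverse (dens_fps h) 1"

definition info_coeff :: "(nat \<Rightarrow> real) \<Rightarrow> nat \<Rightarrow> real" where
  "info_coeff h j = gauss ((num_fps h * quot_fps h) $ j)"

definition egf :: "(nat \<Rightarrow> real) \<Rightarrow> real fps" where
  "egf h = Abs_fps (\<lambda>k. h k / fact k)"

lemma fps_deriv_egf: "fps_deriv (egf h) = egf (\<lambda>k. h (Suc k))"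
  by (rule fps_ext) (simp add: egf_def divide_simps)

lemma mult_left_inverse_cancel:
  fixes a b c :: "'a::comm_monoid_mult"
  assumes "b * a = 1"
  shows "a * (c * b) = c"
proof -
  have "a * (c * b) = c * (b * a)" by (simp add: mult_ac)
  then show ?thesis using assms by simp
qed

lemma dens_mult_quot:
  assumes "h 0 = 1"
  shows "dens_fps h * quot_fps h = num_fps h"
proof -
  have "fps_left_inverse (dens_fps h) 1 * dens_fps h = 1"
    by (rule fps_left_inverse) (simp add: dens_fps_def assms)
  then show ?thesis unfolding quot_fps_def by (rule mult_left_inverse_cancel)
qed

lemma graded_quot_fps:
  assumes "h 0 = 1"
  shows "graded (quot_fps h)"
  by (rule graded_quotient[OF _ _ _ dens_mult_quot[of h, OF assms]])
     (auto simp: dens_fps_def num_fps_def graded_hermite_fps assms)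

lemma top_layer_hermite_fps: "top_layer (hermite_fps d) = Abs_fps d"
  by (rule fps_ext) (simp add: top_layer_def)

text \<open>\<open>He_k\<close> is exp(- (d/dz)^2 / 2) applied to z^k, so going down one layer means
  applying - 1/2 times the second derivative to the top layer.\<close>

lemma second_layer_hermite_fps:
  "second_layer (hermite_fps (\<lambda>k. h k / fact k)) = fps_const (-1/2) * fps_deriv (fps_deriv (egf h))"
proof (rule fps_ext)
  fix n
  have "fact (n + 2) = real (n + 2) * real (n + 1) * fact n"
    by (simp add: algebra_simps)
  then show "second_layer (hermite_fps (\<lambda>k. h k / fact k)) $ n = (fps_const (-1/2) * fps_deriv (fps_deriv (egf h))) $ n"
    using coeff_hermite_sub2[of n] by (simp add: second_layer_def fps_deriv_egf egf_def divide_simps del: fact_Suc)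
qed

text \<open>To leading order \<open>He_k\<close> is z^k, so \<open>g\<close> and \<open>H\<close>
  turn into \<open>egf h\<close> and its derivative. The top layer of the ratio is thus the
  logarithmic derivative \<open>v\<close>.\<close>

lemma top_layer_quot_fps:
  assumes "h 0 = 1"
  shows "egf h * top_layer (quot_fps h) = fps_deriv (egf h)"
  using top_layer_mult[OF _ graded_quot_fps[of h, OF assms], of "dens_fps h"]
  unfolding dens_mult_quot[of h, OF assms]
  by (simp add: dens_fps_def num_fps_def graded_hermite_fps top_layer_hermite_fps fps_deriv_egf) (simp add: egf_def)

text \<open>Let M = \<open>egf h\<close> and let u be the second layer sought. Comparing second
  layers in g q = H gives - M'''/2 = - M'' v / 2 + M u. Rewriting with M' = M v exposes a common
  factor M, which cancels.\<close>

lemma second_layer_quot_fps: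
  fixes h defines "v \<equiv> top_layer (quot_fps h)"
  assumes "h 0 = 1"
  shows "second_layer (quot_fps h) = fps_const (-1/2) * (fps_deriv (fps_deriv v) + fps_deriv (v * v))"
proof -
  let ?M = "egf h" and ?u = "second_layer (quot_fps h)" and ?c = "fps_const (-1/2 :: real)"
  have M': "fps_deriv ?M = ?M * v" using top_layer_quot_fps[of h, OF assms(2)] by (simp add: v_def)
  have M'': "fps_deriv (fps_deriv ?M) = ?M * (v * v + fps_deriv v)"
    by (simp add: M' algebra_simps)
  have M''': "fps_deriv (fps_deriv (fps_deriv ?M)) =
      ?M * (v * (v * v + fps_deriv v) + fps_deriv (v * v) + fps_deriv (fps_deriv v))"
    by (subst M'') (simp add: M' algebra_simps)
  have "num_fps h = hermite_fps (\<lambda>k. (h (Suc k)) / fact k)" by (simp add: num_fps_def)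
  then have "second_layer (num_fps h) = ?c * fps_deriv (fps_deriv (fps_deriv ?M))"
    using second_layer_hermite_fps[of "\<lambda>k. h (Suc k)"] by (simp add: fps_deriv_egf)
  moreover have "second_layer (dens_fps h) = ?c * fps_deriv (fps_deriv ?M)"
    by (simp add: dens_fps_def second_layer_hermite_fps)
  moreover have "top_layer (dens_fps h) = ?M"
    by (simp add: dens_fps_def top_layer_hermite_fps egf_def)
  ultimately have "?c * fps_deriv (fps_deriv (fps_deriv ?M)) = ?c * fps_deriv (fps_deriv ?M) * v + ?M * ?u"
    using second_layer_mult[OF _ graded_quot_fps[of h, OF assms(2)], of "dens_fps h"] dens_mult_quot[of h] assms
    by (simp add: dens_fps_def graded_hermite_fps)
  then have "?M * ?u = ?M * (?c * (fps_deriv (fps_deriv v) + fps_deriv (v * v)))"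
    unfolding M''' M'' by (simp add: M' algebra_simps)
  moreover have "?M \<noteq> 0"
    using assms(2) by (metis egf_def fps_nth_Abs_fps fps_zero_nth div_by_1 fact_0 zero_neq_one)
  ultimately show ?thesis by simp
qed

text \<open>The coefficient of \<open>F\<close> at n - k has degree at most n - k and is orthogonal
  to \<open>He_k\<close> once n < 2 k. As \<open>d\<close> starts at m, order 2m only sees k = m,
  and order 2m + 2 only k = m and k = m + 1.\<close>

lemma gauss_graded_mult_hermite_fps:
  assumes F: "graded F" and d: "\<And>k. k < m \<Longrightarrow> d k = 0"
  shows gauss_graded_mult_0: "n < 2 * m \<Longrightarrow> gauss ((F * hermite_fps d) $ n) = 0"
    and gauss_graded_mult_1: "gauss ((F * hermite_fps d) $ (2 * m)) = d m * fact m * top_layer F $ m"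
    and gauss_graded_mult_2: "gauss ((F * hermite_fps d) $ (2 * m + 2)) =
      d m * fact m * (second_layer F $ m + real (m + 2) * real (m + 1) / 2 * top_layer F $ (m + 2)) +
      d (Suc m) * fact (Suc m) * top_layer F $ Suc m"
proof -
  have exp: "gauss ((F * hermite_fps d) $ n) = (\<Sum>k=0..n. d k * gauss (F $ (n - k) * hermite k))" for n
    by (subst mult.commute[of F]) (simp add: fps_mult_nth gauss_sum gauss_smult mult.commute[of "hermite _"])
  have zero: "gauss (F $ (n - k) * hermite k) = 0" if "n < 2 * k" for n k
    by (rule gauss_mult_hermite_eq_0) (use gradedD(1)[OF F, of "n - k"] that in linarith)
  show "gauss ((F * hermite_fps d) $ n) = 0" if "n < 2 * m"
    unfolding exp
  proof (intro sum.neutral ballI)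
    fix k show "d k * gauss (F $ (n - k) * hermite k) = 0"
      using d[of k] zero[of n k] that by (cases "k < m") auto
  qed
  have "(\<Sum>k=0..2*m. d k * gauss (F $ (2*m - k) * hermite k)) = (\<Sum>k\<in>{m}. d k * gauss (F $ (2*m - k) * hermite k))"
    by (rule sum.mono_neutral_right) (use d zero[of "2*m"] in \<open>auto simp: nat_neq_iff\<close>)
  then show "gauss ((F * hermite_fps d) $ (2 * m)) = d m * fact m * top_layer F $ m"
    using gauss_mult_hermite_top[OF gradedD(1)[OF F], of m] by (simp add: exp top_layer_def)
  have "(\<Sum>k=0..2*m+2. d k * gauss (F $ (2*m+2 - k) * hermite k)) =
      (\<Sum>k\<in>{m, Suc m}. d k * gauss (F $ (2*m+2 - k) * hermite k))"
  proof (rule sum.mono_neutral_right)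
    show "\<forall>k\<in>{0..2*m+2} - {m, Suc m}. d k * gauss (F $ (2*m+2 - k) * hermite k) = 0"
    proof
      fix k assume "k \<in> {0..2*m+2} - {m, Suc m}"
      then have "k < m \<or> 2*m+2 < 2 * k" by auto
      then show "d k * gauss (F $ (2*m+2 - k) * hermite k) = 0" using d zero by auto
    qed
  qed auto
  then show "gauss ((F * hermite_fps d) $ (2 * m + 2)) =
      d m * fact m * (second_layer F $ m + real (m + 2) * real (m + 1) / 2 * top_layer F $ (m + 2)) +
      d (Suc m) * fact (Suc m) * top_layer F $ Suc m"
    using gauss_mult_hermite_top[OF gradedD(1)[OF F], of "Suc m"]
      gauss_mult_hermite_sub2[of "F $ (m + 2)" m] gradedD[OF F, of "m + 2"]
    unfolding exp by (simp add: top_layer_def second_layer_def del: fact_Suc)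
qed

lemma fps_X_power_mult_nth': "(fps_X ^ m * F) $ (m + i) = (F :: 'a::comm_ring_1 fps) $ i"
  by (simp add: fps_X_power_mult_nth)

lemma hermite_fps_diff: "hermite_fps a - hermite_fps b = hermite_fps (\<lambda>k. a k - b k)"
  by (rule fps_ext) (simp add: smult_diff_left)

lemma hermite_fps_shift:
  assumes "\<And>k. k < m \<Longrightarrow> d k = 0"
  shows "hermite_fps d = fps_X ^ m * Abs_fps (\<lambda>k. smult (d (m + k)) (hermite (m + k)))"
  by (rule fps_ext) (use assms in \<open>simp add: fps_X_power_mult_nth\<close>)

text \<open>Use g' (q' - q) = (H' - H) - (g' - g) q. The first bracket starts at t^m, the second at
  t^(m+1) and q at t^2, while g' = 1 + O(t^3). So the first three coefficients come from H' - H
  alone.\<close>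

lemma quot_fps_diff_expansion:
  fixes h h' :: "nat \<Rightarrow> real"
  assumes h: "h 0 = 1" "h 1 = 0" "h 2 = 0" and agree: "\<And>k. k \<le> m \<Longrightarrow> h' k = h k" and m: "m \<ge> 2"
  obtains E where "quot_fps h' - quot_fps h = fps_X ^ m * E"
    and "\<And>i. i \<le> 2 \<Longrightarrow> E $ i = smult ((h' (Suc (m + i)) - h (Suc (m + i))) / fact (m + i)) (hermite (m + i))"
proof -
  have h': "h' 0 = 1" "h' 1 = 0" "h' 2 = 0" using agree[of 0] agree[of 1] agree[of 2] h m by auto
  define d where "d k = h' k - h k" for k
  let ?g' = "dens_fps h'" and ?q = "quot_fps h" and ?q' = "quot_fps h'"
  define A where "A = Abs_fps (\<lambda>k. smult (d (Suc (m + k)) / fact (m + k)) (hermite (m + k)))"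
  define B where "B = Abs_fps (\<lambda>k. smult (d (Suc m + k) / fact (Suc m + k)) (hermite (Suc m + k)))"
  have dH: "num_fps h' - num_fps h = fps_X ^ m * A"
    unfolding num_fps_def hermite_fps_diff A_def
    by (subst hermite_fps_shift[where m = m]) (simp_all add: agree d_def diff_divide_distrib)
  have dg: "?g' - dens_fps h = fps_X ^ m * (fps_X * B)"
    unfolding dens_fps_def hermite_fps_diff B_def
    by (subst hermite_fps_shift[where m = "Suc m"])
       (simp_all add: agree d_def diff_divide_distrib mult_ac)
  define E where "E = (A - fps_X * B * ?q) * fps_left_inverse ?g' 1"
  have "fps_left_inverse ?g' 1 * ?g' = 1"
    by (rule fps_left_inverse) (simp add: dens_fps_def h')
  then have gE: "?g' * E = A - fps_X * B * ?q"
    unfolding E_def by (rule mult_left_inverse_cancel)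
  have "?g' * (?q' - ?q) = fps_X ^ m * (A - fps_X * B * ?q)"
    using dH dg dens_mult_quot[of h, OF h(1)] dens_mult_quot[of h', OF h'(1)]
    by (simp add: algebra_simps)
  also have "\<dots> = ?g' * (fps_X ^ m * E)" unfolding gE[symmetric] by (rule mult.left_commute)
  finally have E: "?q' - ?q = fps_X ^ m * E"
  proof -
    have "?g' $ 0 \<noteq> 0" by (simp add: dens_fps_def h')
    then have "?g' \<noteq> 0" by auto
    then show "?g' * (?q' - ?q) = ?g' * (fps_X ^ m * E) \<Longrightarrow> ?thesis" by simp
  qed
  have g0: "?g' $ 0 = 1" "?g' $ Suc 0 = 0" "?g' $ 2 = 0"
    using h' by (auto simp: dens_fps_def)
  have q0: "?q $ 0 = 0" "?q $ Suc 0 = 0"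
  proof -
    have g: "dens_fps h $ 0 = 1" "dens_fps h $ Suc 0 = 0" using h by (auto simp: dens_fps_def)
    have "(dens_fps h * ?q) $ 0 = 0" "(dens_fps h * ?q) $ Suc 0 = 0"
      unfolding dens_mult_quot[of h, OF h(1)] using h by (auto simp: num_fps_def numeral_2_eq_2)
    then show "?q $ 0 = 0" "?q $ Suc 0 = 0" using g by (simp_all add: fps_mult_nth)
  qed
  have "(?g' * E) $ i = E $ i" if "i \<le> 2" for i
    using that g0 by (auto simp: fps_mult_nth numeral_2_eq_2 le_Suc_eq)
  moreover have "(A - fps_X * B * ?q) $ i = A $ i" if "i \<le> 2" for i
    using that q0 by (auto simp: fps_mult_nth numeral_2_eq_2 le_Suc_eq mult.assoc)
  ultimately have "E $ i = A $ i" if "i \<le> 2" for i using gE that by simp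
  then show ?thesis using E by (intro that[of E]) (auto simp: A_def d_def)
qed

text \<open>An exact second order expansion of H^2 / g. With D and G the increments of
  \<open>H\<close> and \<open>g\<close>, the linear part is 2 q D - q^2 G and the remainder is g'
  (q' - q)^2. The remainder already starts at order 2m, so it has to be kept.\<close>

lemma info_coeff_perturbation:
  fixes h h' :: "nat \<Rightarrow> real"
  defines "v \<equiv> top_layer (quot_fps h)" and "d \<equiv> \<lambda>k. h' k - h k"
  assumes h: "h 0 = 1" "h 1 = 0" "h 2 = 0" and agree: "\<And>k. k \<le> m \<Longrightarrow> h' k = h k" and m: "m \<ge> 2"
  shows "info_coeff h' (2 * m) - info_coeff h (2 * m) =
      2 * d (Suc m) * v $ m + (d (Suc m))\<^sup>2 / fact m"
    and "info_coeff h' (2 * m + 2) - info_coeff h (2 * m + 2) =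
      2 * d (m + 2) * v $ Suc m + (d (m + 2))\<^sup>2 / fact (Suc m) - real (m + 2) * d (Suc m) * (v * v) $ Suc m"
proof -
  have h': "h' 0 = 1" "h' 1 = 0" "h' 2 = 0" using agree[of 0] agree[of 1] agree[of 2] h m by auto
  let ?g' = "dens_fps h'" and ?q = "quot_fps h" and ?q' = "quot_fps h'"
  let ?D = "hermite_fps (\<lambda>k. d (Suc k) / fact k)" and ?G = "hermite_fps (\<lambda>k. d k / fact k)"
  obtain E where E: "?q' - ?q = fps_X ^ m * E"
    and En: "\<And>i. i \<le> 2 \<Longrightarrow> E $ i = smult (d (Suc (m + i)) / fact (m + i)) (hermite (m + i))"
    unfolding d_def using quot_fps_diff_expansion[where h = h and h' = h' and m = m] h agree m by metis
  have D: "num_fps h' = num_fps h + ?D"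
    unfolding num_fps_def by (rule fps_ext) (simp add: d_def diff_divide_distrib smult_diff_left)
  have G: "?g' = dens_fps h + ?G"
    unfolding dens_fps_def by (rule fps_ext) (simp add: d_def diff_divide_distrib smult_diff_left)
  have gq: "num_fps h = dens_fps h * ?q" "num_fps h' = ?g' * ?q'"
    using h h' by (simp_all add: dens_mult_quot)
  have D': "?D = ?g' * ?q' - dens_fps h * ?q" using D gq by (metis add_diff_cancel_left')
  have G': "?G = ?g' - dens_fps h" using G by (metis add_diff_cancel_left')
  have "num_fps h' * ?q' - num_fps h * ?q =
      ?q * ?D + ?q * ?D - (?q * ?q) * ?G + ?g' * ((?q' - ?q) * (?q' - ?q))"
    unfolding D' G' gq by (simp add: algebra_simps)
  also have "?g' * ((?q' - ?q) * (?q' - ?q)) = fps_X ^ (2 * m) * (?g' * (E * E))"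
    unfolding E by (simp add: mult_ac power_add[symmetric] mult_2)
  finally have split: "info_coeff h' n - info_coeff h n =
      2 * gauss ((?q * ?D) $ n) - gauss (((?q * ?q) * ?G) $ n) + gauss ((fps_X ^ (2 * m) * (?g' * (E * E))) $ n)" for n
    unfolding info_coeff_def
    by (subst gauss_diff[symmetric], subst fps_sub_nth[symmetric])
       (simp only: fps_add_nth fps_sub_nth gauss_add gauss_diff mult_2)
  have gr: "graded ?q" "graded (?q * ?q)" by (simp_all add: graded_quot_fps graded_mult h)
  have dz: "d (Suc k) / fact k = 0" if "k < m" for k using that agree by (simp add: d_def)
  have dz': "d k / fact k = 0" if "k < Suc m" for k using that agree by (simp add: d_def)
  have vv: "top_layer (?q * ?q) = v * v" by (simp add: top_layer_mult gr v_def)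
  have g0: "?g' $ 0 = 1" "?g' $ Suc 0 = 0" "?g' $ Suc (Suc 0) = 0"
    using h' by (auto simp: dens_fps_def numeral_2_eq_2)
  have X: "(fps_X ^ (2 * m) * F) $ (2 * m) = F $ 0" "(fps_X ^ (2 * m) * F) $ (2 * m + 2) = F $ 2"
    for F :: "real poly fps" using fps_X_power_mult_nth'[of "2 * m" F 0] fps_X_power_mult_nth'[of "2 * m" F 2] by auto
  have "gauss ((?g' * (E * E)) $ 0) = (d (Suc m))\<^sup>2 / fact m"
    using En[of 0] by (simp add: g0 gauss_smult gauss_hermite_mult_hermite power2_eq_square)
  then show "info_coeff h' (2 * m) - info_coeff h (2 * m) =
      2 * d (Suc m) * v $ m + (d (Suc m))\<^sup>2 / fact m"
    unfolding split X
    using gauss_graded_mult_1[of ?q m "\<lambda>k. d (Suc k) / fact k", OF gr(1) dz]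
      gauss_graded_mult_0[of "?q * ?q" "Suc m" "\<lambda>k. d k / fact k", OF gr(2) dz', of "2 * m"]
    by (simp add: v_def)
  have "(?g' * (E * E)) $ 2 = E $ 0 * E $ 2 + E $ 2 * E $ 0 + E $ 1 * E $ 1"
    by (simp add: fps_mult_nth numeral_2_eq_2 g0)
  then have term3: "gauss ((?g' * (E * E)) $ 2) = (d (m + 2))\<^sup>2 / fact (Suc m)"
    using En[of 0] En[of 1] En[of 2]
    by (simp add: gauss_add gauss_smult gauss_hermite_mult_hermite power2_eq_square del: fact_Suc)
  \<comment> \<open>The v'' inside the second layer cancels the \<open>v $ (m + 2)\<close> produced
    by the degree correction, so that only v^2 survives.\<close>
  have sec: "second_layer ?q $ m + real (m + 2) * real (m + 1) / 2 * v $ (m + 2) =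
      - real (m + 1) / 2 * (v * v) $ Suc m"
    unfolding second_layer_quot_fps[of h, OF h(1)] v_def[symmetric]
    by (simp add: field_simps del: fps_deriv_mult)
  have t1: "gauss ((?q * ?D) $ (2 * m + 2)) =
      - real (m + 1) / 2 * d (Suc m) * (v * v) $ Suc m + d (m + 2) * v $ Suc m"
    using gauss_graded_mult_2[of ?q m "\<lambda>k. d (Suc k) / fact k", OF gr(1) dz] sec by (simp add: v_def del: fact_Suc)
  have t2: "gauss (((?q * ?q) * ?G) $ (2 * m + 2)) = d (Suc m) * (v * v) $ Suc m"
    using gauss_graded_mult_1[of "?q * ?q" "Suc m" "\<lambda>k. d k / fact k", OF gr(2) dz']
    by (simp add: vv del: fact_Suc)
  show "info_coeff h' (2 * m + 2) - info_coeff h (2 * m + 2) =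
      2 * d (m + 2) * v $ Suc m + (d (m + 2))\<^sup>2 / fact (Suc m) - real (m + 2) * d (Suc m) * (v * v) $ Suc m"
    unfolding split X term3 t1 t2 by (simp add: algebra_simps del: fact_Suc) (simp add: field_simps)
qed

text \<open>Instances of the classical value a! b! c! / ((s - a)! (s - b)! (s - c)!) with 2 s = a +
  b + c; they enter the cubic terms for the index 4.\<close>

lemma gauss_hermite_triple:
  "gauss (hermite 3 * hermite 3 * hermite 4) = 216"
  "gauss (hermite 3 * hermite 4 * hermite 5) = 1440"
  "gauss (hermite 3 * hermite 3 * hermite 6) = 720"
proof -
  have *: "hermite 3 * hermite 3 = [:0, 0, 9, 0, -6, 0, 1:]"
    "hermite 3 * hermite 4 = [:0, -9, 0, 21, 0, -9, 0, 1:]"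
    by (simp_all add: hermite_explicit)
  show "gauss (hermite 3 * hermite 3 * hermite 4) = 216"
    unfolding * using gauss_mult_hermite_sub2[of "[:0, 0, 9, 0, -6, 0, 1:]" 4]
    by (simp add: eval_nat_numeral)
  show "gauss (hermite 3 * hermite 4 * hermite 5) = 1440"
    unfolding * using gauss_mult_hermite_sub2[of "[:0, -9, 0, 21, 0, -9, 0, 1:]" 5]
    by (simp add: eval_nat_numeral)
  show "gauss (hermite 3 * hermite 3 * hermite 6) = 720"
    unfolding * using gauss_mult_hermite_top[of "[:0, 0, 9, 0, -6, 0, 1:]" 6]
    by (simp add: eval_nat_numeral)
qed

text \<open>Here \<open>num_fps h\<close> is t^3 times \<open>H\<close>, and
  \<open>dens_fps h\<close> is 1 + t^4 times \<open>G\<close>, so a single step of the geometric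
  series suffices: H q equals t^6 (H^2 - t^4 H G q) in the shifted series, with q equal to
  \<open>H\<close> below order 4. Orthogonality leaves one square and the cubic terms at each of the
  two orders.\<close>

lemma info_coeff_10_12:
  assumes h: "h 0 = 1" "h 1 = 0" "h 2 = 0" "h 3 = 0" "h 5 = 0"
  shows "info_coeff h 10 = (h 6)\<^sup>2 / 120 - (h 4) ^ 3 / 4"
    and "info_coeff h 12 = (h 7)\<^sup>2 / 720 - 7 / 36 * (h 4)\<^sup>2 * h 6"
proof -
  define H where "H = Abs_fps (\<lambda>k. smult (h (4 + k) / fact (3 + k)) (hermite (3 + k)))"
  define G where "G = Abs_fps (\<lambda>k. smult (h (4 + k) / fact (4 + k)) (hermite (4 + k)))"
  have hk: "h (Suc k) = 0" if "k < 3" for k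
    using that h by (auto simp: less_Suc_eq numeral_3_eq_3 numeral_2_eq_2)
  have H: "num_fps h = fps_X ^ 3 * H"
    unfolding num_fps_def H_def by (subst hermite_fps_shift[where m = 3]) (simp_all add: hk)
  have G: "dens_fps h = 1 + fps_X ^ 4 * G"
  proof (rule fps_ext)
    fix k :: nat
    have "k = 0 \<or> (0 < k \<and> k < 4) \<or> k \<ge> 4" by auto
    then show "dens_fps h $ k = (1 + fps_X ^ 4 * G) $ k"
      using hk[of "k - 1"] h(1) by (auto simp: dens_fps_def G_def fps_X_power_mult_nth)
  qed
  define q where "q = H * fps_left_inverse (dens_fps h) 1"
  have quot: "quot_fps h = fps_X ^ 3 * q" by (simp add: quot_fps_def H q_def mult.assoc)
  have "fps_X ^ 3 * (dens_fps h * q) = fps_X ^ 3 * H"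
    using dens_mult_quot[of h, OF h(1)] by (simp add: quot H mult.left_commute)
  then have "dens_fps h * q = H" by simp
  then have q: "q = H - fps_X ^ 4 * (G * q)" by (simp add: G algebra_simps)
  have qn: "q $ n = H $ n" if "n < 4" for n
    by (subst q) (use that in \<open>simp add: fps_X_power_mult_nth\<close>)
  have "num_fps h * quot_fps h = fps_X ^ 6 * (H * q)"
    by (simp add: H quot mult_ac power_add[symmetric])
  also have "H * q = H * H - fps_X ^ 4 * (H * (G * q))"
    by (subst q) (simp add: algebra_simps)
  finally have c: "info_coeff h (6 + n) = gauss ((H * H) $ n) - gauss ((fps_X ^ 4 * (H * (G * q))) $ n)" for n
    unfolding info_coeff_def by (simp add: fps_X_power_mult_nth gauss_diff)
  have H0: "H $ n = smult (h (4 + n) / fact (3 + n)) (hermite (3 + n))" for n by (simp add: H_def)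
  have G0: "G $ n = smult (h (4 + n) / fact (4 + n)) (hermite (4 + n))" for n by (simp add: G_def)
  have H1: "H $ Suc 0 = 0" and G1: "G $ Suc 0 = 0" using h(5) by (simp_all add: H0 G0)
  have "(H * H) $ 4 = H $ 0 * H $ 4 + (H $ 2 * H $ 2 + H $ 4 * H $ 0)"
    by (simp add: fps_mult_nth eval_nat_numeral H1)
  then have HH4: "gauss ((H * H) $ 4) = (h 6)\<^sup>2 / 120"
    by (simp only: H0 gauss_add mult_smult_left mult_smult_right gauss_smult gauss_hermite_mult_hermite)
       (simp add: power2_eq_square fact_numeral)
  have "(H * H) $ 6 = H $ 0 * H $ 6 + (H $ 2 * H $ 4 + (H $ 3 * H $ 3 + (H $ 4 * H $ 2 + H $ 6 * H $ 0)))"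
    by (simp add: fps_mult_nth eval_nat_numeral H1)
  then have HH6: "gauss ((H * H) $ 6) = (h 7)\<^sup>2 / 720"
    by (simp only: H0 gauss_add mult_smult_left mult_smult_right gauss_smult gauss_hermite_mult_hermite)
       (simp add: power2_eq_square fact_numeral)
  have HGq0: "gauss ((H * (G * q)) $ 0) = (h 4) ^ 3 / 4"
    using gauss_hermite_triple(1)
    by (simp add: qn H0 G0 gauss_smult mult_ac fact_numeral power3_eq_cube)
  have "(H * (G * q)) $ 2 = H $ 0 * G $ 0 * H $ 2 + H $ 0 * H $ 0 * G $ 2 + H $ 0 * G $ 0 * H $ 2"
    by (simp add: fps_mult_nth eval_nat_numeral H1 G1 qn algebra_simps)
  then have HGq2: "gauss ((H * (G * q)) $ 2) = 7 / 36 * (h 4)\<^sup>2 * h 6"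
    by (simp only: gauss_add)
       (simp add: H0 G0 gauss_smult fact_numeral power2_eq_square gauss_hermite_triple(2,3))
  show "info_coeff h 10 = (h 6)\<^sup>2 / 120 - (h 4) ^ 3 / 4"
    using c[of 4] HH4 HGq0 by (simp add: fps_X_power_mult_nth)
  show "info_coeff h 12 = (h 7)\<^sup>2 / 720 - 7 / 36 * (h 4)\<^sup>2 * h 6"
    using c[of 6] HH6 HGq2 by (simp add: fps_X_power_mult_nth)
qed

text \<open>The logarithmic derivative of an even series is odd.\<close>

lemma top_layer_quot_fps_even_eq_0:
  assumes h: "h 0 = 1" and odd: "\<And>k. odd k \<Longrightarrow> h k = 0" and "even n"
  shows "top_layer (quot_fps h) $ n = 0"
  using \<open>even n\<close>
proof (induction n rule: less_induct)
  case (less n)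
  let ?v = "top_layer (quot_fps h)"
  have "(egf h * ?v) $ n = egf h $ 0 * ?v $ n + (\<Sum>i = Suc 0..n. egf h $ i * ?v $ (n - i))"
    unfolding fps_mult_nth by (subst sum.atLeast_Suc_atMost) auto
  also have "(\<Sum>i = Suc 0..n. egf h $ i * ?v $ (n - i)) = 0"
  proof (intro sum.neutral ballI)
    fix i assume "i \<in> {Suc 0..n}"
    then show "egf h $ i * ?v $ (n - i) = 0"
      using less.IH[of "n - i"] less.prems odd[of i] by (cases "even i") (auto simp: egf_def)
  qed
  finally have "?v $ n = fps_deriv (egf h) $ n"
    unfolding top_layer_quot_fps[of h, OF h] by (simp add: egf_def h)
  also have "\<dots> = 0" using odd[of "Suc n"] less.prems by (simp add: fps_deriv_egf egf_def)
  finally show ?case .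
qed

text \<open>At odd n the linear term at order 2n - 2 disappears together with \<open>v\<close>,
  leaving a square. At even n there are two roots, and order 2n selects one through the sign of
  \<open>(v * v) $ n\<close>.\<close>

lemma info_coeff_determines:
  fixes h h' :: "nat \<Rightarrow> real"
  assumes h: "h 0 = 1" "h 1 = 0" "h 2 = 0" and h': "h' 0 = 1" "h' 1 = 0" "h' 2 = 0"
    and odd: "\<And>k. odd k \<Longrightarrow> h k = 0"
    and pos: "\<And>n. even n \<Longrightarrow> n \<ge> 4 \<Longrightarrow> top_layer (quot_fps h) $ (n - 1) > 0"
    and eq: "\<And>j. info_coeff h' j = info_coeff h j"
  shows "h' = h"
proof -
  define v where "v = top_layer (quot_fps h)"
  have veven: "v $ n = 0" if "even n" for n
    unfolding v_def using top_layer_quot_fps_even_eq_0[of h, OF h(1) odd that] .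
  have vM: "egf h * v = fps_deriv (egf h)" unfolding v_def by (rule top_layer_quot_fps) (rule h)
  have e0: "egf h $ 0 = 1" "egf h $ Suc 0 = 0" "egf h $ Suc (Suc 0) = 0" "egf h $ Suc (Suc (Suc 0)) = 0"
  proof -
    have "h 3 = 0" using odd[of 3] by simp
    then show "egf h $ 0 = 1" "egf h $ Suc 0 = 0" "egf h $ Suc (Suc 0) = 0" "egf h $ Suc (Suc (Suc 0)) = 0"
      using h by (auto simp: egf_def eval_nat_numeral)
  qed
  have v1: "v $ Suc 0 = 0"
    using arg_cong[OF vM, of "\<lambda>F. F $ Suc 0"] h e0 by (simp add: fps_mult_nth egf_def eval_nat_numeral)
  have v3: "v $ 3 = h 4 / 6"
    using arg_cong[OF vM, of "\<lambda>F. F $ 3"] e0 v1 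
    by (simp add: fps_mult_nth eval_nat_numeral) (simp add: egf_def eval_nat_numeral)
  have v5: "v $ 5 = h 6 / 120"
    using arg_cong[OF vM, of "\<lambda>F. F $ 5"] e0 v1 veven[of 0] veven[of 2]
    by (simp add: fps_mult_nth eval_nat_numeral) (simp add: egf_def eval_nat_numeral)
  have vge: "v $ n \<ge> 0" for n
    using veven[of n] v1 pos[of "Suc n"] unfolding v_def[symmetric]
    by (cases "even n"; cases "n = 1") (auto simp: less_imp_le Suc_le_eq elim!: oddE)
  have first: "2 * (h' (Suc m) - h (Suc m)) * v $ m + (h' (Suc m) - h (Suc m))\<^sup>2 / fact m = 0"
    and second: "2 * (h' (m + 2) - h (m + 2)) * v $ Suc m + (h' (m + 2) - h (m + 2))\<^sup>2 / fact (Suc m) -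
        real (m + 2) * (h' (Suc m) - h (Suc m)) * (v * v) $ Suc m = 0"
    if "m \<ge> 2" "\<And>k. k \<le> m \<Longrightarrow> h' k = h k" for m
    using info_coeff_perturbation[of h m h', OF h that(2,1)] eq unfolding v_def by auto
  have odd_step: "h' n = h n" if "odd n" "n \<ge> 3" "\<And>k. k < n \<Longrightarrow> h' k = h k" for n
  proof -
    obtain m where m: "n = Suc m" using \<open>n \<ge> 3\<close> by (cases n) auto
    have "v $ m = 0" using veven m that by auto
    then show ?thesis using first[of m] that m by auto
  qed
  have h4: "h 4 > 0" and h6: "h 6 > 0" using pos[of 4] pos[of 6] v3 v5 unfolding v_def[symmetric] by auto
  have le3: "h' k = h k" if "k \<le> 3" for k
  proof -
    have le2: "h' k = h k" if "k < 3" for k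
      using that h h' by (auto simp: less_Suc_eq numeral_3_eq_3 numeral_2_eq_2)
    then show ?thesis using odd_step[of 3] that by (cases "k = 3") auto
  qed
  \<comment> \<open>If \<open>h' 4 = - h 4\<close>, order 10 forces \<open>\<bar>h' 6\<bar> < h 6\<close> and order 12 forces \<open>h' 6 \<ge> h 6\<close>.\<close>
  have four: "h' 4 = h 4"
  proof (rule ccontr)
    assume ne: "h' 4 \<noteq> h 4"
    have "2 * (h' 4 - h 4) * (h 4 / 6) + (h' 4 - h 4)\<^sup>2 / 6 = 0"
      using first[of 3] le3 v3 by (simp add: fact_numeral)
    then have "(h' 4 - h 4) * (h' 4 + h 4) = 0" by (simp add: field_simps power2_eq_square)
    then have h'4: "h' 4 = - h 4" using ne by simp
    \<comment> \<open>\<open>v\<close> starts at order 3. Order 8 therefore carries no sign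
      information about \<open>h' 4\<close> and only yields \<open>h' 5 = h 5\<close>.\<close>
    have "(v * v) $ 4 = 0"
      using veven[of 0] veven[of 2] v1 by (simp add: fps_mult_nth eval_nat_numeral)
    then have "h' 5 = h 5" using second[of 3] le3 veven[of 4] by simp
    then have h'5: "h' 5 = 0" using odd[of 5] by simp
    have "h' 3 = 0" using le3[of 3] odd[of 3] by simp
    note c = info_coeff_10_12[of h', OF h' this h'5]
    note c' = info_coeff_10_12[of h, OF h odd[of 3] odd[of 5], simplified]
    have "(h' 6)\<^sup>2 / 120 + (h 4) ^ 3 / 4 = (h 6)\<^sup>2 / 120 - (h 4) ^ 3 / 4"
      using eq[of 10] c(1) c'(1) h'4 by simp
    moreover have "(h 4) ^ 3 > 0" using h4 by simp
    ultimately have "(h' 6)\<^sup>2 < (h 6)\<^sup>2" by linarith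
    then have lt: "h' 6 < h 6" using h6 by (simp add: power2_less_imp_less)
    have "(h' 7)\<^sup>2 / 720 - 7 / 36 * (h 4)\<^sup>2 * h' 6 = - (7 / 36 * (h 4)\<^sup>2 * h 6)"
      using eq[of 12] c(2) c'(2) odd[of 7] h'4 by simp
    then have "(h' 7)\<^sup>2 / 720 = 7 / 36 * (h 4)\<^sup>2 * (h' 6 - h 6)" by (simp add: algebra_simps)
    also have "\<dots> < 0" using h4 lt by (simp add: mult_pos_neg)
    finally show False by (smt (verit) zero_le_power2 divide_nonneg_pos)
  qed
  have "h' n = h n" for n
  proof (induction n rule: less_induct)
    case (less n)
    show ?case
    proof (cases "n \<le> 4 \<or> odd n")
      case True
      then show ?thesis using le3[of n] four odd_step[of n] less
        by (cases "n \<le> 3"; cases "n = 4") auto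
    next
      case False
      then have "n \<ge> 6" by presburger
      with False obtain m where m: "n = Suc m" "m \<ge> 5" "odd m" by (cases n) auto
      have vm: "v $ m > 0" using pos[of n] False m unfolding v_def by auto
      \<comment> \<open>All coefficients of \<open>v\<close> are nonnegative, so one product bounds
        the sum from below. For even n \<ge> 6 both 3 and n - 3 are odd and at least 3, where
        \<open>v\<close> is positive.\<close>
      have "(v * v) $ n \<ge> v $ 3 * v $ (n - 3)"
        unfolding fps_mult_nth using m by (intro member_le_sum[of 3 "{0..n}" "\<lambda>i. v $ i * v $ (n - i)"]) (auto simp: vge)
      moreover have "v $ 3 * v $ (n - 3) > 0"
      proof -
        have "even (n - 2)" "n - 2 \<ge> 4" "n - 2 - 1 = n - 3" using False \<open>n \<ge> 6\<close> by auto
        then show ?thesis using pos[of 4] pos[of "n - 2"] unfolding v_def by simp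
      qed
      ultimately have vv: "(v * v) $ n > 0" by linarith
      have ag: "h' k = h k" if "k \<le> m" for k using less that m by simp
      \<comment> \<open>Without the linear term in \<open>h' (m + 2) - h (m + 2)\<close>, the order
        2n equation says that a square is a positive multiple of \<open>h' n - h n\<close>.\<close>
      have "v $ n = 0" using veven False by simp
      then have "real (m + 2) * (h' n - h n) * (v * v) $ n = (h' (m + 2) - h (m + 2))\<^sup>2 / fact n"
        using second[of m, OF _ ag] m by simp
      also have "\<dots> \<ge> 0" by simp
      finally have ge: "h' n - h n \<ge> 0" using vv
        by (auto simp: zero_le_mult_iff)
      have "(h' n - h n) * (2 * v $ m + (h' n - h n) / fact m) = 0"
        using first[of m, OF _ ag] m by (simp add: algebra_simps power2_eq_square)
      moreover have "2 * v $ m + (h' n - h n) / fact m > 0" using vm ge by (simp add: add_pos_nonneg)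
      ultimately show ?thesis by simp
    qed
  qed
  then show ?thesis by auto
qed

section \<open>Mehler's kernel\<close>

text \<open>The density of \<open>t x + sqrt (1 - t\<^sup>2) N\<close> with respect to the law of \<open>N\<close>. Its power series in \<open>t\<close> is identified
  by a linear ODE, and the remainder is controlled by Cauchy's estimate on a disc of radius comparable to \<open>1 / (1 + \<bar>x\<bar>)\<close>.\<close>

definition mehler :: "real \<Rightarrow> real \<Rightarrow> real \<Rightarrow> real" where
  "mehler t x z = exp ((2 * t * x * z - t\<^sup>2 * (x\<^sup>2 + z\<^sup>2)) / (2 * (1 - t\<^sup>2))) / sqrt (1 - t\<^sup>2)"

definition mehler_term :: "real \<Rightarrow> real \<Rightarrow> nat \<Rightarrow> real" where
  "mehler_term x z k = poly (hermite k) x * poly (hermite k) z / fact k"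

text \<open>This is the coefficient of u^(n+3) in the differential equation of
  \<open>mehler_series_ode\<close>. The three-term recurrence reduces all Hermite values to those at
  n and n + 1, and a polynomial identity remains.\<close>

lemma mehler_term_rec:
  "real (n + 4) * mehler_term x z (n + 4) - 2 * real (n + 2) * mehler_term x z (n + 2) + real n * mehler_term x z n =
   mehler_term x z (n + 2) - mehler_term x z n + x * z * (mehler_term x z (n + 3) + mehler_term x z (n + 1))
     - (x\<^sup>2 + z\<^sup>2) * mehler_term x z (n + 2)"
proof -
  define p where "p k = poly (hermite k) x" for k
  define r where "r k = poly (hermite k) z" for k
  have p: "p (Suc (Suc k)) = x * p (Suc k) - real (Suc k) * p k"
    and r: "r (Suc (Suc k)) = z * r (Suc k) - real (Suc k) * r k" for k
    by (simp_all add: p_def r_def hermite.simps(3))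
  have T: "mehler_term x z (n + 1) = p (Suc n) * r (Suc n) / (real (n + 1) * fact n)"
    "mehler_term x z (n + 2) = p (Suc (Suc n)) * r (Suc (Suc n)) / (real (n + 2) * real (n + 1) * fact n)"
    "mehler_term x z (n + 3) = p (Suc (Suc (Suc n))) * r (Suc (Suc (Suc n))) / (real (n + 3) * real (n + 2) * real (n + 1) * fact n)"
    "real (n + 4) * mehler_term x z (n + 4) = p (Suc (Suc (Suc (Suc n)))) * r (Suc (Suc (Suc (Suc n)))) / (real (n + 3) * real (n + 2) * real (n + 1) * fact n)"
    by (simp_all add: mehler_term_def p_def r_def eval_nat_numeral mult_ac)
  have T0: "mehler_term x z n = p n * r n / fact n" by (simp add: mehler_term_def p_def r_def)
  define a where "a = p n" define b where "b = p (Suc n)" define c where "c = r n" define d where "d = r (Suc n)"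
  define N where "N = real n"
  have N: "N + 1 \<noteq> 0" "N + 2 \<noteq> 0" "N + 3 \<noteq> 0" by (simp_all add: N_def)
  have rl: "real (n + 1) = N + 1" "real (n + 2) = N + 2" "real (n + 3) = N + 3" "real n = N" by (simp_all add: N_def)
  define p2 where "p2 = x * b - (N + 1) * a" define p3 where "p3 = x * p2 - (N + 2) * b"
  define p4 where "p4 = x * p3 - (N + 3) * p2"
  define r2 where "r2 = z * d - (N + 1) * c" define r3 where "r3 = z * r2 - (N + 2) * d"
  define r4 where "r4 = z * r3 - (N + 3) * r2"
  have P: "p (Suc (Suc n)) = p2" "p (Suc (Suc (Suc n))) = p3" "p (Suc (Suc (Suc (Suc n)))) = p4"
     "r (Suc (Suc n)) = r2" "r (Suc (Suc (Suc n))) = r3" "r (Suc (Suc (Suc (Suc n)))) = r4"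
    by (simp_all add: p r p2_def p3_def p4_def r2_def r3_def r4_def a_def b_def c_def d_def N_def algebra_simps)
  have "p4 * r4 - 2 * (N + 2) * (N + 3) * p2 * r2 + N * (N + 1) * (N + 2) * (N + 3) * (a * c) =
      (N + 3) * (p2 * r2) - (N + 1) * (N + 2) * (N + 3) * (a * c) + x * z * (p3 * r3 + (N + 2) * (N + 3) * (b * d))
       - (x\<^sup>2 + z\<^sup>2) * (N + 3) * (p2 * r2)"
    unfolding p4_def p3_def p2_def r4_def r3_def r2_def by algebra
  then show ?thesis
    unfolding T T0 P rl a_def[symmetric] b_def[symmetric] c_def[symmetric] d_def[symmetric]
    using N by (simp add: divide_simps) (simp add: algebra_simps)
qed

text \<open>With \<open>P $ 0 = 1\<close>, coefficient n of the equation determines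
  \<open>F $ Suc n\<close> from the earlier coefficients.\<close>

lemma fps_linear_ode_unique:
  fixes F :: "'a::field_char_0 fps"
  assumes "P $ 0 = 1" "P * fps_deriv F = Q * F" "F $ 0 = 0"
  shows "F = 0"
proof -
  have "\<forall>k\<le>n. F $ k = 0" for n
  proof (induction n)
    case (Suc n)
    have "(Q * F) $ n = 0" using Suc by (simp add: fps_mult_nth)
    moreover have "(P * fps_deriv F) $ n = P $ 0 * fps_deriv F $ n + (\<Sum>i = Suc 0..n. P $ i * fps_deriv F $ (n - i))"
      unfolding fps_mult_nth by (subst sum.atLeast_Suc_atMost) auto
    moreover have "(\<Sum>i = Suc 0..n. P $ i * fps_deriv F $ (n - i)) = 0"
      using Suc by (intro sum.neutral) auto
    ultimately have "of_nat (Suc n) * F $ Suc n = 0" using assms by simp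
    then have "F $ Suc n = 0" using of_nat_neq_0[where 'a = 'a, of n] by (metis mult_eq_0_iff)
    then show ?case using Suc by (auto simp: le_Suc_eq)
  qed (use assms in auto)
  then show ?thesis by (auto simp: fps_eq_iff)
qed

text \<open>The equation is obtained by differentiating the closed formula
  \<open>mehler_complex\<close> in u and clearing the denominator (1 - u^2)^2.\<close>

lemma mehler_series_ode:
  fixes x z :: real
  defines "A \<equiv> Abs_fps (\<lambda>k. complex_of_real (mehler_term x z k))"
  shows "(1 - fps_X ^ 2) ^ 2 * fps_deriv A =
    (fps_X * (1 - fps_X ^ 2) + fps_const (of_real (x * z)) * (1 + fps_X ^ 2) - fps_const (of_real (x\<^sup>2 + z\<^sup>2)) * fps_X) * A"
    (is "_ = ?Q * A")
proof (rule fps_ext)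
  fix n
  let ?c = "\<lambda>k. complex_of_real (mehler_term x z k)"
  have L: "((1 - fps_X ^ 2) ^ 2 * fps_deriv A) $ n = of_nat (n + 1) * ?c (n + 1)
      - (if n \<ge> 2 then 2 * of_nat (n - 1) * ?c (n - 1) else 0) + (if n \<ge> 4 then of_nat (n - 3) * ?c (n - 3) else 0)"
  proof -
    have "(1 - fps_X ^ 2) ^ 2 * fps_deriv A =
        fps_deriv A - fps_const 2 * (fps_X ^ 2 * fps_deriv A) + fps_X ^ 4 * fps_deriv A"
      unfolding numeral_fps_const[symmetric] by (simp add: power2_eq_square algebra_simps eval_nat_numeral)
    moreover have "n \<ge> 2 \<Longrightarrow> Suc (n - 2) = n - Suc 0" "n \<ge> 4 \<Longrightarrow> Suc (n - 4) = n - 3" by auto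
    ultimately show ?thesis
      by (simp only: fps_add_nth fps_sub_nth fps_mult_left_const_nth fps_X_power_mult_nth)
         (auto simp: A_def algebra_simps)
  qed
  have R: "(?Q * A) $ n
     = (if n \<ge> 1 then ?c (n - 1) else 0) - (if n \<ge> 3 then ?c (n - 3) else 0) +
       of_real (x * z) * (?c n + (if n \<ge> 2 then ?c (n - 2) else 0)) - of_real (x\<^sup>2 + z\<^sup>2) * (if n \<ge> 1 then ?c (n - 1) else 0)"
  proof -
    have "?Q * A
      = fps_X ^ 1 * A - fps_X ^ 3 * A + fps_const (of_real (x * z)) * (A + fps_X ^ 2 * A) - fps_const (of_real (x\<^sup>2 + z\<^sup>2)) * (fps_X ^ 1 * A)"
      by (simp add: algebra_simps eval_nat_numeral)
    then show ?thesis by (simp only: fps_add_nth fps_sub_nth fps_mult_left_const_nth fps_X_power_mult_nth) (auto simp: A_def)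
  qed
  have small: "mehler_term x z 0 = 1" "mehler_term x z (Suc 0) = x * z" "mehler_term x z 2 = (x\<^sup>2 - 1) * (z\<^sup>2 - 1) / 2"
    "mehler_term x z 3 = (x ^ 3 - 3 * x) * (z ^ 3 - 3 * z) / 6"
    by (simp_all add: mehler_term_def hermite_explicit fact_numeral power2_eq_square power3_eq_cube algebra_simps)
  let ?l = "real (n + 1) * mehler_term x z (n + 1)
      - (if n \<ge> 2 then 2 * real (n - 1) * mehler_term x z (n - 1) else 0) + (if n \<ge> 4 then real (n - 3) * mehler_term x z (n - 3) else 0)"
  let ?r = "(if n \<ge> 1 then mehler_term x z (n - 1) else 0) - (if n \<ge> 3 then mehler_term x z (n - 3) else 0) +
       x * z * (mehler_term x z n + (if n \<ge> 2 then mehler_term x z (n - 2) else 0)) - (x\<^sup>2 + z\<^sup>2) * (if n \<ge> 1 then mehler_term x z (n - 1) else 0)"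
  have re: "complex_of_real ?l = complex_of_real ?r"
  proof -
    \<comment> \<open>Below order 3 the recursion would reach negative indices, so these
      coefficients are compared directly.\<close>
    consider "n = 0" | "n = 1" | "n = 2" | "n \<ge> 3" by linarith
    then have "?l = ?r"
    proof cases
      case 4
      then obtain k where "n = k + 3" by (metis add.commute le_Suc_ex)
      then show ?thesis using mehler_term_rec[of k x z] by (cases "k = 0") (simp_all add: algebra_simps numeral_2_eq_2)
    next
      case 1 then show ?thesis by (simp add: small)
    next
      case 2
      then have "n + 1 = 2" by simp
      then show ?thesis using 2 small(3) by (simp add: small(1,2) numeral_2_eq_2) (simp add: field_simps)
    next
      case 3
      then have "n + 1 = 3" by simp
      then show ?thesis using 3 by (simp add: small) (simp add: field_simps power2_eq_square power3_eq_cube)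
    qed
    then show ?thesis by simp
  qed
  have "((1 - fps_X ^ 2) ^ 2 * fps_deriv A) $ n = of_real ?l"
    unfolding L by (simp split: if_splits)
  also note re
  also have "complex_of_real ?r
    = (?Q * A) $ n"
    unfolding R by (simp split: if_splits)
  finally show "((1 - fps_X ^ 2) ^ 2 * fps_deriv A) $ n = (?Q * A) $ n" .
qed

text \<open>The continuation of \<open>mehler\<close> to complex t. In the unit disc 1 - u^2 has
  positive real part, so the principal logarithm yields a holomorphic inverse square root.\<close>

definition mehler_complex :: "real \<Rightarrow> real \<Rightarrow> complex \<Rightarrow> complex" where
  "mehler_complex x z u = exp (- Ln (1 - u\<^sup>2) / 2) *
     exp ((2 * u * of_real (x * z) - u\<^sup>2 * of_real (x\<^sup>2 + z\<^sup>2)) / (2 * (1 - u\<^sup>2)))"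

lemma one_minus_square_in_slit:
  fixes u :: complex
  assumes "norm u < 1"
  shows "1 - u\<^sup>2 \<notin> \<real>\<^sub>\<le>\<^sub>0" "1 - u\<^sup>2 \<noteq> 0"
proof -
  have "norm (u\<^sup>2) < 1" using assms by (simp add: norm_power power_less_one_iff)
  then have "Re (u\<^sup>2) < 1" using complex_Re_le_cmod[of "u\<^sup>2"] by linarith
  then have "Re (1 - u\<^sup>2) > 0" by simp
  then show "1 - u\<^sup>2 \<notin> \<real>\<^sub>\<le>\<^sub>0" "1 - u\<^sup>2 \<noteq> 0" by (auto simp: complex_nonpos_Reals_iff)
qed

lemma mehler_complex_deriv:
  assumes "norm u < 1"
  shows "(mehler_complex x z has_field_derivative
     (u * (1 - u\<^sup>2) + of_real (x * z) * (1 + u\<^sup>2) - of_real (x\<^sup>2 + z\<^sup>2) * u) / (1 - u\<^sup>2)\<^sup>2 * mehler_complex x z u) (at u)"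
  unfolding mehler_complex_def using one_minus_square_in_slit[OF assms]
  apply (auto intro!: derivative_eq_intros)
  apply (simp add: divide_simps)
  apply (simp add: power2_eq_square algebra_simps)
  done

lemma holomorphic_mehler_complex: "mehler_complex x z holomorphic_on ball 0 1"
  unfolding holomorphic_on_open[OF open_ball] using mehler_complex_deriv by fastforce

lemma mehler_complex_of_real:
  assumes "\<bar>t\<bar> < 1"
  shows "mehler_complex x z (of_real t) = of_real (mehler t x z)"
proof -
  have pos: "1 - t\<^sup>2 > 0" using assms by (simp add: abs_square_less_1)
  have "exp (- Ln (1 - (complex_of_real t)\<^sup>2) / 2) = exp (of_real (- ln (1 - t\<^sup>2) / 2))"
    using Ln_of_real[OF pos] by simp
  also have "\<dots> = of_real (exp (- ln (1 - t\<^sup>2) / 2))" by (rule exp_of_real)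
  also have "exp (- ln (1 - t\<^sup>2) / 2) = 1 / sqrt (1 - t\<^sup>2)"
    using pos by (simp add: exp_minus ln_sqrt[symmetric] field_simps)
  finally have 1: "exp (- Ln (1 - (complex_of_real t)\<^sup>2) / 2) = of_real (1 / sqrt (1 - t\<^sup>2))" .
  have 2: "exp ((2 * of_real t * of_real (x * z) - (of_real t)\<^sup>2 * of_real (x\<^sup>2 + z\<^sup>2)) / (2 * (1 - (of_real t)\<^sup>2)))
     = complex_of_real (exp ((2 * t * x * z - t\<^sup>2 * (x\<^sup>2 + z\<^sup>2)) / (2 * (1 - t\<^sup>2))))"
    by (simp add: exp_of_real[symmetric] mult_ac)
  show ?thesis unfolding mehler_complex_def mehler_def 1 2 by simp
qed

text \<open>The Taylor series and the Hermite series solve the same first order linear equation and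
  both have constant term 1.\<close>

lemma mehler_complex_coeff: "(deriv ^^ k) (mehler_complex x z) 0 / fact k = of_real (mehler_term x z k)"
proof -
  let ?f = "mehler_complex x z"
  define F where "F = fps_expansion ?f 0"
  define A where "A = Abs_fps (\<lambda>k. complex_of_real (mehler_term x z k))"
  let ?P = "(1 - fps_X ^ 2) ^ 2 :: complex fps"
  let ?Q = "fps_X * (1 - fps_X ^ 2) + fps_const (of_real (x * z)) * (1 + fps_X ^ 2) - fps_const (of_real (x\<^sup>2 + z\<^sup>2)) * fps_X :: complex fps"
  have F: "?f has_fps_expansion F"
    unfolding F_def by (rule has_fps_expansion_fps_expansion[OF open_ball _ holomorphic_mehler_complex]) simp
  have 1: "(\<lambda>u. (1 - u ^ 2) ^ 2 * deriv ?f u) has_fps_expansion (?P * fps_deriv F)"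
    by (intro fps_expansion_intros F)
  have 2: "(\<lambda>u. (u * (1 - u ^ 2) + of_real (x * z) * (1 + u ^ 2) - of_real (x\<^sup>2 + z\<^sup>2) * u) * ?f u) has_fps_expansion (?Q * F)"
    by (intro fps_expansion_intros F)
  have "eventually (\<lambda>u::complex. u \<in> ball 0 1) (nhds 0)"
    by (rule eventually_nhds_in_open) auto
  then have "eventually (\<lambda>u. (1 - u ^ 2) ^ 2 * deriv ?f u =
      (u * (1 - u ^ 2) + of_real (x * z) * (1 + u ^ 2) - of_real (x\<^sup>2 + z\<^sup>2) * u) * ?f u) (nhds 0)"
  proof eventually_elim
    case (elim u)
    then have u: "norm u < 1" by simp
    show ?case using DERIV_imp_deriv[OF mehler_complex_deriv[OF u, of x z]] one_minus_square_in_slit(2)[OF u] by simp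
  qed
  then have "?P * fps_deriv F = ?Q * F"
    using 1 2 by (subst (asm) has_fps_expansion_cong[OF _ refl]) (auto intro: fps_expansion_unique_complex)
  then have ode: "?P * fps_deriv (F - A) = ?Q * (F - A)"
    using mehler_series_ode[of x z] unfolding A_def by (simp add: algebra_simps)
  have "F $ 0 = 1" by (simp add: F_def fps_expansion_def mehler_complex_def)
  moreover have "A $ 0 = 1" by (simp add: A_def mehler_term_def)
  ultimately have "F - A = 0" by (intro fps_linear_ode_unique[OF _ ode]) (simp_all add: fps_mult_nth power2_eq_square)
  then have "F $ k = A $ k" by simp
  then show ?thesis by (simp add: F_def A_def fps_expansion_def)
qed

text \<open>Once |u| (1 + |x|) is bounded, the exponent has modulus at most (1 + z^2) / 12 and no
  growth in \<open>x\<close> remains. The factor 2 is 4/3 for the inverse root times 3/2 for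
  exp(1/12).\<close>

lemma norm_mehler_complex_le:
  assumes u: "norm u * (1 + \<bar>x\<bar>) \<le> 1 / 8"
  shows "norm (mehler_complex x z u) \<le> 2 * exp (z\<^sup>2 / 12)"
proof -
  have nu: "norm u \<le> 1 / 8" and ux: "norm u * \<bar>x\<bar> \<le> 1 / 8"
    using u mult_left_mono[of 1 "1 + \<bar>x\<bar>" "norm u"] mult_left_mono[of "\<bar>x\<bar>" "1 + \<bar>x\<bar>" "norm u"] by auto
  have u2: "norm (u\<^sup>2) \<le> 1 / 64"
    using mult_mono[OF nu nu] by (simp add: norm_mult power2_eq_square)
  have d: "norm (1 - u\<^sup>2) \<ge> 63 / 64"
    using norm_triangle_ineq2[of 1 "u\<^sup>2"] u2 by simp
  have ne: "1 - u\<^sup>2 \<noteq> 0" using d by auto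
  have "(exp (- Ln (1 - u\<^sup>2) / 2))\<^sup>2 = exp (- Ln (1 - u\<^sup>2))"
    by (simp add: power2_eq_square exp_add[symmetric] field_simps)
  also have "\<dots> = inverse (1 - u\<^sup>2)" using ne by (simp add: exp_minus)
  finally have "(norm (exp (- Ln (1 - u\<^sup>2) / 2)))\<^sup>2 = inverse (norm (1 - u\<^sup>2))"
    by (simp only: norm_power[symmetric] norm_inverse[symmetric])
  also have "\<dots> \<le> inverse (63 / 64)" using d by (intro le_imp_inverse_le) auto
  also have "\<dots> \<le> (4 / 3 :: real)\<^sup>2" by (simp add: power2_eq_square)
  finally have 1: "norm (exp (- Ln (1 - u\<^sup>2) / 2)) \<le> 4 / 3"
    by (rule power2_le_imp_le) simp
  let ?w = "(2 * u * of_real (x * z) - u\<^sup>2 * of_real (x\<^sup>2 + z\<^sup>2)) / (2 * (1 - u\<^sup>2))"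
  have "norm (2 * u * of_real (x * z) - u\<^sup>2 * of_real (x\<^sup>2 + z\<^sup>2)) \<le>
      norm (2 * u * of_real (x * z)) + norm (u\<^sup>2 * of_real (x\<^sup>2 + z\<^sup>2))" by (rule norm_triangle_ineq4)
  also have "\<dots> = 2 * (norm u * \<bar>x\<bar>) * \<bar>z\<bar> + (norm u * \<bar>x\<bar>)\<^sup>2 + norm (u\<^sup>2) * z\<^sup>2"
  proof -
    have "norm (u\<^sup>2 * of_real (x\<^sup>2 + z\<^sup>2)) = (norm u)\<^sup>2 * (x\<^sup>2 + z\<^sup>2)"
      unfolding norm_mult norm_of_real norm_power by simp
    then show ?thesis
      by (simp add: norm_mult abs_mult power_mult_distrib norm_power algebra_simps)
  qed
  also have "\<dots> \<le> 2 * (1 / 8) * \<bar>z\<bar> + (1 / 8)\<^sup>2 + 1 / 64 * z\<^sup>2"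
    using ux u2 by (intro add_mono mult_right_mono mult_left_mono power_mono) auto
  also have "\<dots> \<le> 9 / 64 * (1 + z\<^sup>2)"
  proof -
    have "0 \<le> (\<bar>z\<bar> - 1)\<^sup>2" by simp
    then have "2 * \<bar>z\<bar> \<le> 1 + z\<^sup>2" by (simp add: power2_diff)
    then show ?thesis by (simp add: power2_eq_square)
  qed
  finally have n: "norm (2 * u * of_real (x * z) - u\<^sup>2 * of_real (x\<^sup>2 + z\<^sup>2)) \<le> 9 / 64 * (1 + z\<^sup>2)" .
  have "norm ?w = norm (2 * u * of_real (x * z) - u\<^sup>2 * of_real (x\<^sup>2 + z\<^sup>2)) / (2 * norm (1 - u\<^sup>2))"
    by (simp only: norm_divide norm_mult norm_numeral)
  also have "\<dots> \<le> (9 / 64 * (1 + z\<^sup>2)) / (2 * (63 / 64))"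
    using n d by (intro frac_le) auto
  also have "\<dots> \<le> 1 / 12 + z\<^sup>2 / 12" by (simp add: field_simps)
  finally have "norm (exp ?w) \<le> exp (1 / 12 + z\<^sup>2 / 12)"
    by (rule order_trans[OF norm_exp iffD2[OF exp_le_cancel_iff]])
  also have "\<dots> \<le> 3 / 2 * exp (z\<^sup>2 / 12)"
    using exp_bound[of "1 / 12"] by (simp add: exp_add power2_eq_square)
  finally have "norm (exp (- Ln (1 - u\<^sup>2) / 2)) * norm (exp ?w) \<le> 4 / 3 * (3 / 2 * exp (z\<^sup>2 / 12))"
    by (intro mult_mono 1) auto
  then show ?thesis by (simp add: mehler_complex_def norm_mult)
qed

text \<open>Cauchy's estimate with radius r = 1 / (8 (1 + |x|)). The assumption says t \<le> r / 2,
  so the geometric tail at most doubles its first term and turns the 2 into 4. Each power of t is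
  accompanied by a power of 1 + |x|, which a moment of the law will absorb.\<close>

lemma mehler_expansion:
  assumes t: "0 \<le> t" "t * (1 + \<bar>x\<bar>) \<le> 1 / 16"
  shows "\<bar>mehler t x z - (\<Sum>k<N. t ^ k * mehler_term x z k)\<bar> \<le> 4 * exp (z\<^sup>2 / 12) * (8 * t * (1 + \<bar>x\<bar>)) ^ N"
proof -
  define r where "r = 1 / (8 * (1 + \<bar>x\<bar>))"
  have r: "0 < r" "r \<le> 1 / 8" by (simp_all add: r_def field_simps)
  define B where "B = 2 * exp (z\<^sup>2 / 12)"
  define y where "y = 8 * t * (1 + \<bar>x\<bar>)"
  have y: "0 \<le> y" "y \<le> 1 / 2" "t / r = y" "t = y * r" using t by (simp_all add: y_def r_def field_simps)
  have tr: "t < r" using y r mult_right_mono[OF y(2), of r] by simp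
  have hol: "mehler_complex x z holomorphic_on ball 0 r"
    by (rule holomorphic_on_subset[OF holomorphic_mehler_complex]) (use r in auto)
  have cont: "continuous_on (cball 0 r) (mehler_complex x z)"
    by (rule continuous_on_subset[OF holomorphic_on_imp_continuous_on[OF holomorphic_mehler_complex]]) (use r in auto)
  have coeff: "\<bar>mehler_term x z k\<bar> \<le> B / r ^ k" for k
  proof -
    have "norm ((deriv ^^ k) (mehler_complex x z) 0) \<le> fact k * B / r ^ k"
      by (rule Cauchy_inequality[OF hol cont r(1)])
         (auto simp: B_def r_def intro!: norm_mehler_complex_le)
    moreover have "(deriv ^^ k) (mehler_complex x z) 0 = of_real (fact k * mehler_term x z k)"
      using mehler_complex_coeff[of k x z] by (simp add: field_simps)
    ultimately have "fact k * \<bar>mehler_term x z k\<bar> \<le> fact k * (B / r ^ k)"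
      by (simp only: norm_of_real) (simp add: abs_mult)
    then show ?thesis by (simp only: mult_le_cancel_left_pos[OF fact_gt_zero])
  qed
  have "(\<lambda>n. (deriv ^^ n) (mehler_complex x z) 0 / fact n * (of_real t - 0) ^ n) sums mehler_complex x z (of_real t)"
    by (rule holomorphic_power_series[OF hol]) (use t tr in auto)
  then have "(\<lambda>n. complex_of_real (mehler_term x z n * t ^ n)) sums complex_of_real (mehler t x z)"
    using mehler_complex_of_real[of t x z] t tr r by (simp add: mehler_complex_coeff)
  then have sums: "(\<lambda>n. mehler_term x z n * t ^ n) sums mehler t x z" by (simp only: sums_of_real_iff)
  then have "(\<lambda>n. mehler_term x z (n + N) * t ^ (n + N)) sums (mehler t x z - (\<Sum>k<N. mehler_term x z k * t ^ k))"
    by (rule sums_split_initial_segment)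
  moreover have gs: "(\<lambda>n. B * y ^ N * y ^ n) sums (B * y ^ N * (1 / (1 - y)))"
    using y by (intro sums_mult geometric_sums) auto
  moreover have "norm (mehler_term x z (n + N) * t ^ (n + N)) \<le> B * y ^ N * y ^ n" for n
  proof -
    have "norm (mehler_term x z (n + N) * t ^ (n + N)) \<le> B / r ^ (n + N) * t ^ (n + N)"
      using mult_right_mono[OF coeff[of "n + N"], of "t ^ (n + N)"] t by (simp add: abs_mult)
    also have "\<dots> = B * y ^ (n + N)" unfolding y(3)[symmetric] by (simp add: power_divide)
    finally show ?thesis by (simp add: power_add mult_ac)
  qed
  ultimately have "norm (mehler t x z - (\<Sum>k<N. mehler_term x z k * t ^ k)) \<le> B * y ^ N * (1 / (1 - y))"
    using norm_suminf_le[of "\<lambda>n. mehler_term x z (n + N) * t ^ (n + N)" "\<lambda>n. B * y ^ N * y ^ n"]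
    by (simp only: sums_iff)
  also have "\<dots> \<le> B * y ^ N * 2"
    using y by (intro mult_left_mono) (auto simp: B_def field_simps)
  finally show ?thesis by (simp add: B_def y_def mult_ac)
qed

lemma mehler_pos: "\<bar>t\<bar> < 1 \<Longrightarrow> mehler t x z > 0"
  by (simp add: mehler_def abs_square_less_1)

lemma normal_density_mehler:
  assumes "0 < t" "t < 1"
  shows "normal_density (t * x) (sqrt (1 - t\<^sup>2)) z = std_normal_density z * mehler t x z"
proof -
  have pos: "1 - t\<^sup>2 > 0" using assms by (simp add: power_less_one_iff)
  have "- z\<^sup>2 / 2 + (2 * t * x * z - t\<^sup>2 * (x\<^sup>2 + z\<^sup>2)) / (2 * (1 - t\<^sup>2)) = - (z - t * x)\<^sup>2 / (2 * (1 - t\<^sup>2))"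
    using pos by (simp add: field_simps power2_eq_square)
  then have "exp (- (z - t * x)\<^sup>2 / (2 * (1 - t\<^sup>2))) = exp (- z\<^sup>2 / 2) * exp ((2 * t * x * z - t\<^sup>2 * (x\<^sup>2 + z\<^sup>2)) / (2 * (1 - t\<^sup>2)))"
    by (metis exp_add)
  then show ?thesis
    using pos by (simp add: normal_density_def mehler_def real_sqrt_mult)
qed

section \<open>Moments and cumulants\<close>

lemma has_vector_derivative_quadratic_bound:
  fixes f :: "real \<Rightarrow> 'a::real_normed_vector"
  assumes "\<And>h. norm (f (t + h) - f t - h *\<^sub>R d) \<le> C * h\<^sup>2"
  shows "(f has_vector_derivative d) (at t)"
  unfolding has_vector_derivative_def has_derivative_at
proof
  show "bounded_linear (\<lambda>x. x *\<^sub>R d)" by (rule bounded_linear_scaleR_left)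
  have bound: "norm (norm (f (t + h) - f t - h *\<^sub>R d) / norm h) \<le> norm (C * h) * 1" for h
  proof (cases "h = 0")
    case False
    have "norm (f (t + h) - f t - h *\<^sub>R d) \<le> \<bar>C\<bar> * h\<^sup>2"
      using assms[of h] mult_right_mono[OF abs_ge_self[of C], of "h\<^sup>2"] by simp
    then show ?thesis using False by (simp add: divide_simps abs_mult power2_eq_square mult_ac)
  qed simp
  have lim: "(\<lambda>h. C * h) \<midarrow>0\<rightarrow> 0" by (auto intro!: tendsto_eq_intros)
  show "(\<lambda>h. norm (f (t + h) - f t - h *\<^sub>R d) / norm h) \<midarrow>0\<rightarrow> 0"
    by (rule tendsto_0_le[OF lim always_eventually[OF allI[OF bound]]])
qed

text \<open>The candidate for the n-th derivative of the characteristic function.\<close>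

definition char_moment :: "real measure \<Rightarrow> nat \<Rightarrow> real \<Rightarrow> complex" where
  "char_moment \<mu> n t = (CLINT x|\<mu>. (\<i> * of_real x) ^ n * iexp (t * x))"

context real_distribution
begin

lemma integrable_char_moment:
  assumes "integrable M (\<lambda>x. \<bar>x\<bar> ^ n)"
  shows "complex_integrable M (\<lambda>x. (\<i> * of_real x) ^ n * iexp (t * x))"
  by (rule Bochner_Integration.integrable_bound[OF assms]) (auto simp: norm_mult norm_power)

text \<open>Differentiation under the integral sign: the second order Taylor bound for
  \<open>iexp\<close> dominates the remainder by |x|^(n+2) h^2 / 2, which is integrable.\<close>

lemma has_vector_derivative_char_moment:
  assumes mom: "\<And>p. integrable M (\<lambda>x. \<bar>x\<bar> ^ p)"
  shows "(char_moment M n has_vector_derivative char_moment M (Suc n) t) (at t)"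
proof (rule has_vector_derivative_quadratic_bound[where C = "(\<integral>x. \<bar>x\<bar> ^ (n + 2) \<partial>M) / 2"])
  fix h
  note int = integrable_char_moment[OF mom]
  let ?F = "\<lambda>x. (\<i> * complex_of_real x) ^ n * iexp (t * x) * (iexp (h * x) - (\<Sum>k\<le>1. (\<i> * of_real (h * x)) ^ k / fact k))"
  have eq: "?F = (\<lambda>x. (\<i> * of_real x) ^ n * iexp ((t + h) * x) - (\<i> * of_real x) ^ n * iexp (t * x)
      - h *\<^sub>R ((\<i> * of_real x) ^ Suc n * iexp (t * x)))"
    by (rule ext) (simp add: algebra_simps exp_add[symmetric] scaleR_conv_of_real)
  have intF: "complex_integrable M ?F"
    unfolding eq by (intro Bochner_Integration.integrable_diff integrable_scaleR_right int)
  have *: "char_moment M n (t + h) - char_moment M n t - h *\<^sub>R char_moment M (Suc n) t = (CLINT x|M. ?F x)"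
    unfolding char_moment_def eq
    by (subst Bochner_Integration.integral_diff, intro Bochner_Integration.integrable_diff int,
        intro integrable_scaleR_right int, subst Bochner_Integration.integral_diff, rule int, rule int,
        subst integral_scaleR_right, rule refl)
  have "norm (CLINT x|M. ?F x) \<le> (\<integral>x. norm (?F x) \<partial>M)" by (rule integral_norm_bound)
  also have "\<dots> \<le> (\<integral>x. \<bar>x\<bar> ^ (n + 2) * (h\<^sup>2 / 2) \<partial>M)"
  proof (rule integral_mono)
    show "integrable M (\<lambda>x. norm (?F x))" using intF by (rule integrable_norm)
    show "integrable M (\<lambda>x. \<bar>x\<bar> ^ (n + 2) * (h\<^sup>2 / 2))" by (rule integrable_mult_left) (rule mom)
    fix x
    have "norm (?F x) = \<bar>x\<bar> ^ n * norm (iexp (h * x) - (\<Sum>k\<le>1. (\<i> * of_real (h * x)) ^ k / fact k))"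
    proof -
      have "norm ((\<i> * complex_of_real x) ^ n) = \<bar>x\<bar> ^ n" by (simp add: norm_power norm_mult)
      moreover have "norm (iexp (t * x)) = 1" by (rule norm_exp_i_times)
      ultimately show ?thesis by (simp only: norm_mult mult_1_right)
    qed
    also have "\<dots> \<le> \<bar>x\<bar> ^ n * (\<bar>h * x\<bar> ^ Suc 1 / fact (Suc 1))"
      by (intro mult_left_mono iexp_approx1) auto
    also have "\<dots> = \<bar>x\<bar> ^ (n + 2) * (h\<^sup>2 / 2)"
      by (simp add: power_add power2_eq_square abs_mult mult_ac)
    finally show "norm (?F x) \<le> \<bar>x\<bar> ^ (n + 2) * (h\<^sup>2 / 2)" .
  qed
  also have "\<dots> = (\<integral>x. \<bar>x\<bar> ^ (n + 2) \<partial>M) / 2 * h\<^sup>2" by simp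
  finally show "norm (char_moment M n (t + h) - char_moment M n t - h *\<^sub>R char_moment M (Suc n) t)
      \<le> (\<integral>x. \<bar>x\<bar> ^ (n + 2) \<partial>M) / 2 * h\<^sup>2" unfolding * .
qed

end

text \<open>Pascal's rule in the shape that arises when the Leibniz sum is differentiated once
  more.\<close>

lemma sum_choose_Suc:
  fixes a :: "nat \<Rightarrow> 'a::comm_semiring_1"
  shows "(\<Sum>k\<le>Suc n. of_nat (Suc n choose k) * a k) = (\<Sum>k\<le>n. of_nat (n choose k) * (a k + a (Suc k)))"
proof -
  have "(\<Sum>k\<le>Suc n. of_nat (Suc n choose k) * a k) =
      a 0 + (\<Sum>k\<le>n. of_nat (n choose Suc k) * a (Suc k)) + (\<Sum>k\<le>n. of_nat (n choose k) * a (Suc k))"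
    by (simp add: sum.atMost_Suc_shift algebra_simps sum.distrib del: sum.atMost_Suc)
  also have "a 0 + (\<Sum>k\<le>n. of_nat (n choose Suc k) * a (Suc k)) = (\<Sum>k\<le>Suc n. of_nat (n choose k) * a k)"
    by (subst sum.atMost_Suc_shift) simp
  also have "\<dots> = (\<Sum>k\<le>n. of_nat (n choose k) * a k)" by (simp add: binomial_eq_0)
  finally show ?thesis by (simp add: algebra_simps sum.distrib)
qed

section \<open>The logarithm of the characteristic function and the cumulants\<close>

lemma nth_vderiv_Suc: "nth_vderiv (Suc n) f t = vector_derivative (nth_vderiv n f) (at t)"
  by (simp add: nth_vderiv_def)

text \<open>The Leibniz rule for f_0 (Ln f_0)' = f_1. Since \<open>vector_derivative\<close> has a
  value even where no derivative exists, the induction must carry the differentiability of every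
  iterated derivative along with the identity.\<close>

lemma nth_vderiv_Ln_recursion:
  fixes f :: "nat \<Rightarrow> real \<Rightarrow> complex"
  assumes U: "open U" "t \<in> U"
    and deriv: "\<And>n t. t \<in> U \<Longrightarrow> (f n has_vector_derivative f (Suc n) t) (at t)"
    and slit: "\<And>t. t \<in> U \<Longrightarrow> f 0 t \<notin> \<real>\<^sub>\<le>\<^sub>0"
  shows "(\<Sum>k\<le>n. of_nat (n choose k) * (f (n - k) t * nth_vderiv (Suc k) (\<lambda>t. Ln (f 0 t)) t)) = f (Suc n) t"
proof -
  define L where "L n = nth_vderiv n (\<lambda>t. Ln (f 0 t))" for n
  have L_Suc: "L (Suc n) t = vector_derivative (L n) (at t)" for n t by (simp add: L_def nth_vderiv_Suc)
  have "\<forall>t\<in>U. (L n has_vector_derivative L (Suc n) t) (at t) \<and>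
      (\<Sum>k\<le>n. of_nat (n choose k) * (f (n - k) t * L (Suc k) t)) = f (Suc n) t" for n
  proof (induction n rule: less_induct)
    case (less n)
    show ?case
    proof (cases n)
      case 0
      show ?thesis
      proof
        fix t assume t: "t \<in> U"
        have "((Ln \<circ> f 0) has_vector_derivative (f 1 t * inverse (f 0 t))) (at t)"
          by (rule field_vector_diff_chain_at)
             (use deriv[OF t, of 0] has_field_derivative_Ln[OF slit[OF t]] in auto)
        then have D: "(L 0 has_vector_derivative (f 1 t * inverse (f 0 t))) (at t)"
          by (simp add: L_def nth_vderiv_def o_def)
        then have "L 1 t = f 1 t * inverse (f 0 t)" using L_Suc[of 0 t] by (simp add: vector_derivative_at)
        moreover have "f 0 t \<noteq> 0" using slit[OF t] by auto
        ultimately show "(L n has_vector_derivative L (Suc n) t) (at t) \<and>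
          (\<Sum>k\<le>n. of_nat (n choose k) * (f (n - k) t * L (Suc k) t)) = f (Suc n) t"
          using D 0 by simp
      qed
    next
      case (Suc m)
      have IH: "(L k has_vector_derivative L (Suc k) t) (at t)" if "k \<le> m" "t \<in> U" for k t
        using less[of k] that Suc by auto
      have id: "(\<Sum>k\<le>m. of_nat (m choose k) * (f (m - k) t * L (Suc k) t)) = f (Suc m) t" if "t \<in> U" for t
        using less[of m] that Suc by auto
      have D: "(L n has_vector_derivative L (Suc n) t) (at t)" if t: "t \<in> U" for t
      proof -
        \<comment> \<open>The identity at order m solved for its last term \<open>L n\<close>. It
          writes \<open>L n\<close> by functions already known to be differentiable, and
          \<open>f 0\<close> does not vanish off the slit.\<close>
        define R where "R s = (f n s - (\<Sum>k<m. of_nat (m choose k) * (f (m - k) s * L (Suc k) s))) * inverse (f 0 s)" for s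
        have L': "L (Suc k) differentiable (at t)" if "k < m" for k
          using IH[of "Suc k" t] that t by (auto intro: differentiableI_vector)
        have "f 0 t \<noteq> 0" using slit[OF t] by auto
        then have "R differentiable (at t)"
          unfolding R_def using L' deriv[OF t]
          by (intro differentiable_mult differentiable_diff differentiable_sum differentiable_inverse
              differentiable_const ballI) (auto intro: differentiableI_vector)
        then obtain D where "(R has_vector_derivative D) (at t)"
          by (auto simp: vector_derivative_works)
        moreover have "R s = L n s" if s: "s \<in> U" for s
        proof -
          have "f 0 s \<noteq> 0" using slit[OF s] by auto
          moreover have "(\<Sum>k<m. of_nat (m choose k) * (f (m - k) s * L (Suc k) s)) + f 0 s * L n s = f n s"
            using id[OF s] Suc by (simp add: lessThan_Suc_atMost[symmetric])
          ultimately show ?thesis unfolding R_def by (simp add: field_simps)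
        qed
        ultimately have "(L n has_vector_derivative D) (at t)"
          by (rule has_vector_derivative_transform_within_open[OF _ U(1) t])
        then show ?thesis using L_Suc[of n t] by (simp add: vector_derivative_at)
      qed
      have "(\<Sum>k\<le>n. of_nat (n choose k) * (f (n - k) t * L (Suc k) t)) = f (Suc n) t" if t: "t \<in> U" for t
      proof -
        have L': "(L (Suc k) has_vector_derivative L (Suc (Suc k)) t) (at t)" if "k \<le> m" for k
          using IH[of "Suc k" t] D[OF t] t that Suc by (cases "k = m") auto
        have "((\<lambda>s. \<Sum>k\<le>m. of_nat (m choose k) * (f (m - k) s * L (Suc k) s)) has_vector_derivative
            (\<Sum>k\<le>m. of_nat (m choose k) * (f (m - k) t * L (Suc (Suc k)) t + f (Suc (m - k)) t * L (Suc k) t))) (at t)"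
          by (intro has_vector_derivative_sum has_vector_derivative_mult_right has_vector_derivative_mult deriv[OF t] L') auto
        then have "(f (Suc m) has_vector_derivative
            (\<Sum>k\<le>m. of_nat (m choose k) * (f (m - k) t * L (Suc (Suc k)) t + f (Suc (m - k)) t * L (Suc k) t))) (at t)"
          by (rule has_vector_derivative_transform_within_open[OF _ U(1) t]) (rule id)
        then have "(\<Sum>k\<le>m. of_nat (m choose k) * (f (m - k) t * L (Suc (Suc k)) t + f (Suc (m - k)) t * L (Suc k) t)) = f (Suc n) t"
          using deriv[OF t, of "Suc m"] Suc vector_derivative_unique_at by blast
        moreover have "(\<Sum>k\<le>Suc m. of_nat (Suc m choose k) * (f (Suc m - k) t * L (Suc k) t)) =
          (\<Sum>k\<le>m. of_nat (m choose k) * (f (m - k) t * L (Suc (Suc k)) t + f (Suc (m - k)) t * L (Suc k) t))"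
          unfolding sum_choose_Suc by (intro sum.cong) (auto simp: Suc_diff_le add.commute)
        ultimately show ?thesis by (simp add: Suc)
      qed
      then show ?thesis using D by simp
    qed
  qed
  then show ?thesis using U by (auto simp: L_def)
qed

lemma real_distribution_law:
  assumes "prob_space M" "X \<in> borel_measurable M"
  shows "real_distribution (law M X)"
  unfolding law_def using assms by (simp add: prob_space.real_distribution_distr)

lemma has_all_moments_law:
  assumes "X \<in> borel_measurable M" "has_all_moments M X"
  shows "integrable (law M X) (\<lambda>x. \<bar>x\<bar> ^ p)" "integrable (law M X) (\<lambda>x. x ^ p)"
proof -
  show "integrable (law M X) (\<lambda>x. \<bar>x\<bar> ^ p)"
    using assms by (simp add: law_def has_all_moments_def integrable_distr_eq)
  then show "integrable (law M X) (\<lambda>x. x ^ p)"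
    by (rule Bochner_Integration.integrable_bound) (auto simp: law_def power_abs)
qed

text \<open>The Leibniz identity at 0, after cancelling the common factor i^(n+1). The moments are
  real, so the identity passes to the real parts of the cumulants.\<close>

lemma moment_cumulant_recursion:
  assumes "prob_space M" and X: "X \<in> borel_measurable M" and mom: "has_all_moments M X"
  defines "m \<equiv> \<lambda>k. \<integral>x. x ^ k \<partial>law M X"
  shows "(\<Sum>k\<le>n. real (n choose k) * (m (n - k) * Re (cumulant M X (Suc k)))) = m (Suc n)"
proof -
  let ?\<mu> = "law M X"
  interpret real_distribution ?\<mu> by (rule real_distribution_law) fact+
  note moms = has_all_moments_law[OF X mom]
  let ?f = "char_moment ?\<mu>"
  have f0: "?f 0 = char ?\<mu>" by (rule ext) (simp add: char_moment_def char_def)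
  have deriv: "(?f n has_vector_derivative ?f (Suc n) t) (at t)" for n t
    by (rule has_vector_derivative_char_moment) (rule moms)
  \<comment> \<open>A neighbourhood of 0 on which the characteristic function stays away from the
    branch cut of \<open>Ln\<close>.\<close>
  define U where "U = {t. Re (?f 0 t) > 0}"
  have "continuous_on UNIV (?f 0)"
    using deriv by (auto intro!: continuous_at_imp_continuous_on has_vector_derivative_continuous)
  then have "open U" unfolding U_def by (intro open_Collect_less continuous_intros)
  moreover have "0 \<in> U" by (simp add: U_def f0 char_zero)
  moreover have "?f 0 t \<notin> \<real>\<^sub>\<le>\<^sub>0" if "t \<in> U" for t
    using that by (auto simp: U_def complex_nonpos_Reals_iff)
  ultimately have rec: "(\<Sum>k\<le>n. of_nat (n choose k) * (?f (n - k) 0 * nth_vderiv (Suc k) (\<lambda>t. Ln (?f 0 t)) 0)) = ?f (Suc n) 0"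
    by (intro nth_vderiv_Ln_recursion[where U = U] deriv) auto
  have fm: "?f j 0 = \<i> ^ j * of_real (m j)" for j
  proof -
    have "?f j 0 = (CLINT x|?\<mu>. \<i> ^ j * of_real (x ^ j))" by (simp add: char_moment_def power_mult_distrib)
    also have "\<dots> = \<i> ^ j * of_real (m j)" unfolding m_def
      by (subst integral_mult_right_zero) (simp only: integral_complex_of_real)
    finally show ?thesis .
  qed
  have L: "nth_vderiv k (\<lambda>t. Ln (?f 0 t)) 0 = \<i> ^ k * cumulant M X k" for k
  proof -
    have "\<i> ^ k * (- \<i>) ^ k = 1" by (simp add: power_mult_distrib[symmetric])
    then show ?thesis by (simp add: cumulant_def f0 mult.assoc[symmetric])
  qed
  have "\<i> ^ Suc n * (\<Sum>k\<le>n. of_nat (n choose k) * (of_real (m (n - k)) * cumulant M X (Suc k))) = \<i> ^ Suc n * of_real (m (Suc n))"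
  proof -
    have "of_nat (n choose k) * (?f (n - k) 0 * nth_vderiv (Suc k) (\<lambda>t. Ln (?f 0 t)) 0) =
        \<i> ^ Suc n * (of_nat (n choose k) * (of_real (m (n - k)) * cumulant M X (Suc k)))" if "k \<le> n" for k
    proof -
      have "\<i> ^ (n - k) * \<i> ^ Suc k = \<i> ^ Suc n" using that by (simp only: power_add[symmetric]) simp
      then show ?thesis unfolding fm L by (simp add: mult_ac)
    qed
    then have "\<i> ^ Suc n * (\<Sum>k\<le>n. of_nat (n choose k) * (of_real (m (n - k)) * cumulant M X (Suc k))) =
      (\<Sum>k\<le>n. of_nat (n choose k) * (?f (n - k) 0 * nth_vderiv (Suc k) (\<lambda>t. Ln (?f 0 t)) 0))"
      unfolding sum_distrib_left by (intro sum.cong) auto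
    then show ?thesis using rec fm by simp
  qed
  then have "(\<Sum>k\<le>n. of_nat (n choose k) * (of_real (m (n - k)) * cumulant M X (Suc k))) = of_real (m (Suc n))"
    by simp
  then have "Re (\<Sum>k\<le>n. of_nat (n choose k) * (of_real (m (n - k)) * cumulant M X (Suc k))) = m (Suc n)"
    by simp
  then show ?thesis by simp
qed

section \<open>The Gaussian channel\<close>

lemma mehler_measurable [measurable]: "(\<lambda>w. mehler t (fst w) (snd w)) \<in> borel_measurable (borel \<Otimes>\<^sub>M borel)"
  unfolding mehler_def by measurable

lemma nn_integral_std_gaussian_affine:
  assumes t: "0 < t" "t < 1" and [measurable]: "f \<in> borel_measurable borel"
  shows "(\<integral>\<^sup>+n. f (t * x + sqrt (1 - t\<^sup>2) * n) \<partial>std_gaussian) = (\<integral>\<^sup>+z. ennreal (mehler t x z) * f z \<partial>std_gaussian)"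
proof -
  define b where "b = sqrt (1 - t\<^sup>2)"
  have b: "b > 0" using t by (simp add: b_def power_less_one_iff)
  have [measurable]: "mehler t x \<in> borel_measurable borel" unfolding mehler_def[abs_def] by measurable
  have "(\<integral>\<^sup>+z. ennreal (mehler t x z) * f z \<partial>std_gaussian) = (\<integral>\<^sup>+z. ennreal (normal_density (t * x) b z) * f z \<partial>lborel)"
    unfolding std_gaussian_def b_def normal_density_mehler[OF t]
    by (subst nn_integral_density) (auto simp: ennreal_mult'' mehler_pos t less_imp_le mult_ac)
  also have "\<dots> = (\<integral>\<^sup>+n. ennreal b * (ennreal (normal_density (t * x) b (t * x + b * n)) * f (t * x + b * n)) \<partial>lborel)"
    using b by (subst nn_integral_real_affine[where c = b and t = "t * x"]) (auto simp: nn_integral_cmult)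
  also have "\<dots> = (\<integral>\<^sup>+n. ennreal (std_normal_density n) * f (t * x + b * n) \<partial>lborel)"
  proof (intro nn_integral_cong)
    fix n
    have "b * normal_density (t * x) b (t * x + b * n) = std_normal_density n"
      using b by (simp add: normal_density_def real_sqrt_mult power_mult_distrib)
    then have "ennreal b * ennreal (normal_density (t * x) b (t * x + b * n)) = ennreal (std_normal_density n)"
      using b by (simp add: ennreal_mult[symmetric])
    then show "ennreal b * (ennreal (normal_density (t * x) b (t * x + b * n)) * f (t * x + b * n)) =
        ennreal (std_normal_density n) * f (t * x + b * n)" by (simp add: mult.assoc[symmetric])
  qed
  also have "\<dots> = (\<integral>\<^sup>+n. f (t * x + b * n) \<partial>std_gaussian)"
    unfolding std_gaussian_def by (subst nn_integral_density) auto
  finally show ?thesis by (simp add: b_def)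
qed

section \<open>Bayes' formula for an input of mean 0 and variance 1\<close>

locale standardized = real_distribution \<nu> for \<nu> :: "real measure" +
  assumes moments: "\<And>p. integrable \<nu> (\<lambda>x. \<bar>x\<bar> ^ p)"
    and mean_0: "(\<integral>x. x \<partial>\<nu>) = 0" and var_1: "(\<integral>x. x\<^sup>2 \<partial>\<nu>) = 1"
begin

sublocale gaussian: prob_space std_gaussian
  by (rule prob_space_std_gaussian)

sublocale pair: pair_prob_space \<nu> std_gaussian ..

text \<open>The law of (X, t X + sqrt(1 - t^2) N), encoded by a density so that conditioning on the
  second coordinate becomes integration against \<open>mehler\<close>.\<close>

definition joint :: "real \<Rightarrow> (real \<times> real) measure" where
  "joint t = density (\<nu> \<Otimes>\<^sub>M std_gaussian) (\<lambda>w. ennreal (mehler t (fst w) (snd w)))"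

definition marginal :: "real \<Rightarrow> real \<Rightarrow> real" where
  "marginal t z = (\<integral>x. mehler t x z \<partial>\<nu>)"

text \<open>Bayes' formula for the conditional mean of the input given the observation z.\<close>

definition posterior :: "real \<Rightarrow> real \<Rightarrow> real" where
  "posterior t z = (\<integral>x. x * mehler t x z \<partial>\<nu>) / marginal t z"

lemma sets_pair [simp, measurable_cong]: "sets (\<nu> \<Otimes>\<^sub>M std_gaussian) = sets (borel \<Otimes>\<^sub>M borel)"
  by (rule sets_pair_measure_cong) auto

lemma sets_joint [simp, measurable_cong]: "sets (joint t) = sets (borel \<Otimes>\<^sub>M borel)"
  by (simp add: joint_def)

lemma mehler_measurable1 [measurable]: "(\<lambda>x. mehler t x z) \<in> borel_measurable borel"
  unfolding mehler_def by measurable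

lemma nn_integral_joint:
  assumes [measurable]: "f \<in> borel_measurable (borel \<Otimes>\<^sub>M borel)" and t: "0 < t" "t < 1"
  shows "(\<integral>\<^sup>+w. f w \<partial>joint t) = (\<integral>\<^sup>+x. (\<integral>\<^sup>+n. f (x, t * x + sqrt (1 - t\<^sup>2) * n) \<partial>std_gaussian) \<partial>\<nu>)"
proof -
  have "(\<integral>\<^sup>+w. f w \<partial>joint t) = (\<integral>\<^sup>+w. ennreal (mehler t (fst w) (snd w)) * f w \<partial>(\<nu> \<Otimes>\<^sub>M std_gaussian))"
    unfolding joint_def by (subst nn_integral_density) auto
  also have "\<dots> = (\<integral>\<^sup>+x. (\<integral>\<^sup>+z. ennreal (mehler t x z) * f (x, z) \<partial>std_gaussian) \<partial>\<nu>)"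
    by (subst gaussian.nn_integral_fst[symmetric]) auto
  also have "\<dots> = (\<integral>\<^sup>+x. (\<integral>\<^sup>+n. f (x, t * x + sqrt (1 - t\<^sup>2) * n) \<partial>std_gaussian) \<partial>\<nu>)"
    by (intro nn_integral_cong nn_integral_std_gaussian_affine[OF t, symmetric]) measurable
  finally show ?thesis .
qed

text \<open>The exponent equals z^2 / 2 minus (t x - z)^2 / (2 (1 - t^2)). As the bound is free of
  \<open>x\<close>, any integrable function of \<open>x\<close> can be integrated against the kernel
  at fixed z, however heavy the tails.\<close>

lemma mehler_le:
  assumes t: "0 < t" "t < 1"
  shows "mehler t x z \<le> exp (z\<^sup>2 / 2) / sqrt (1 - t\<^sup>2)"
proof -
  have pos: "1 - t\<^sup>2 > 0" using t by (simp add: power_less_one_iff)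
  have "0 \<le> (t * x - z)\<^sup>2" by simp
  then have "2 * t * x * z - t\<^sup>2 * (x\<^sup>2 + z\<^sup>2) \<le> z\<^sup>2 * (1 - t\<^sup>2)"
    by (simp add: power2_eq_square algebra_simps)
  then have "(2 * t * x * z - t\<^sup>2 * (x\<^sup>2 + z\<^sup>2)) / (2 * (1 - t\<^sup>2)) \<le> z\<^sup>2 / 2"
    using pos by (simp add: field_simps)
  then show ?thesis using pos by (simp add: mehler_def divide_right_mono)
qed

lemma integrable_times_mehler:
  assumes t: "0 < t" "t < 1" and f: "integrable \<nu> f"
  shows "integrable \<nu> (\<lambda>x. f x * mehler t x z)"
proof (rule Bochner_Integration.integrable_bound)
  show "integrable \<nu> (\<lambda>x. f x * (exp (z\<^sup>2 / 2) / sqrt (1 - t\<^sup>2)))" using f by (rule integrable_mult_left)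
  have [measurable]: "f \<in> borel_measurable \<nu>" using f by auto
  show "(\<lambda>x. f x * mehler t x z) \<in> borel_measurable \<nu>" by measurable
  show "AE x in \<nu>. norm (f x * mehler t x z) \<le> norm (f x * (exp (z\<^sup>2 / 2) / sqrt (1 - t\<^sup>2)))"
  proof (intro AE_I2)
    fix x
    have "\<bar>mehler t x z\<bar> \<le> \<bar>exp (z\<^sup>2 / 2) / sqrt (1 - t\<^sup>2)\<bar>"
      using mehler_pos[of t x z] mehler_le[OF t, of x z] t by linarith
    then show "norm (f x * mehler t x z) \<le> norm (f x * (exp (z\<^sup>2 / 2) / sqrt (1 - t\<^sup>2)))"
      unfolding real_norm_def abs_mult by (intro mult_left_mono) auto
  qed
qed

lemma integrable_power: "integrable \<nu> (\<lambda>x. x ^ p)"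
  by (rule Bochner_Integration.integrable_bound[OF moments[of p]]) (auto simp: power_abs)

lemma integrable_poly: "integrable \<nu> (poly p)"
proof -
  have "poly p = (\<lambda>x. \<Sum>i\<le>degree p. coeff p i * x ^ i)" by (rule ext) (rule poly_altdef)
  then show ?thesis using integrable_power by auto
qed

lemma integrable_affine_power: "integrable \<nu> (\<lambda>x. (1 + \<bar>x\<bar>) ^ p)"
proof -
  have "(\<lambda>x::real. (1 + \<bar>x\<bar>) ^ p) = (\<lambda>x. \<Sum>k\<le>p. real (p choose k) * \<bar>x\<bar> ^ (p - k))"
    by (rule ext) (simp add: binomial_ring)
  then show ?thesis using moments by auto
qed

text \<open>Jensen's inequality, in the form \<open>exp u \<ge> exp m (1 + u - m)\<close>.\<close>

lemma marginal_lower_bound: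
  assumes t: "0 < t" "t < 1"
  shows "marginal t z \<ge> exp (- t\<^sup>2 * (1 + z\<^sup>2) / (2 * (1 - t\<^sup>2))) / sqrt (1 - t\<^sup>2)"
proof -
  have pos: "1 - t\<^sup>2 > 0" using t by (simp add: power_less_one_iff)
  define u where "u x = (2 * t * x * z - t\<^sup>2 * (x\<^sup>2 + z\<^sup>2)) / (2 * (1 - t\<^sup>2))" for x
  define m where "m = - t\<^sup>2 * (1 + z\<^sup>2) / (2 * (1 - t\<^sup>2))"
  have i1: "integrable \<nu> (\<lambda>x. x)" "integrable \<nu> (\<lambda>x. x\<^sup>2)" using integrable_power[of 1] integrable_power[of 2] by auto
  have u_eq: "u = (\<lambda>x. (2 * t * z / (2 * (1 - t\<^sup>2))) * x + (- t\<^sup>2 / (2 * (1 - t\<^sup>2))) * x\<^sup>2 + (- t\<^sup>2 * z\<^sup>2 / (2 * (1 - t\<^sup>2))))"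
    by (rule ext) (simp add: u_def field_simps add_divide_distrib diff_divide_distrib)
  have iu: "integrable \<nu> u" unfolding u_eq using i1 by auto
  have int_u: "(\<integral>x. u x \<partial>\<nu>) = m"
    unfolding u_eq using i1 by (simp add: mean_0 var_1 m_def prob_space[simplified] algebra_simps diff_divide_distrib)
  have "exp m / sqrt (1 - t\<^sup>2) = (\<integral>x. exp m * (1 + (u x - m)) / sqrt (1 - t\<^sup>2) \<partial>\<nu>)"
    using iu by (simp add: int_u prob_space[simplified])
  also have "\<dots> \<le> (\<integral>x. mehler t x z \<partial>\<nu>)"
  proof (rule integral_mono)
    show "integrable \<nu> (\<lambda>x. exp m * (1 + (u x - m)) / sqrt (1 - t\<^sup>2))" using iu by auto
    show "integrable \<nu> (\<lambda>x. mehler t x z)" using integrable_times_mehler[OF t, of "\<lambda>_. 1"] by simp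
    fix x
    have "exp m * (1 + (u x - m)) \<le> exp m * exp (u x - m)" by (intro mult_left_mono exp_ge_add_one_self) auto
    also have "\<dots> = exp (u x)" by (simp add: exp_add[symmetric])
    finally show "exp m * (1 + (u x - m)) / sqrt (1 - t\<^sup>2) \<le> mehler t x z"
      using pos by (simp add: mehler_def u_def divide_right_mono)
  qed
  finally show ?thesis by (simp add: marginal_def m_def)
qed

lemma marginal_pos:
  assumes "0 < t" "t < 1"
  shows "marginal t z > 0"
proof -
  have "1 - t\<^sup>2 > 0" using assms by (simp add: power_less_one_iff)
  then show ?thesis using marginal_lower_bound[OF assms, of z]
    by (intro less_le_trans[OF _ marginal_lower_bound[OF assms]]) simp
qed

lemma marginal_measurable [measurable]: "marginal t \<in> borel_measurable borel"
proof -
  have "(\<lambda>z. \<integral>x. mehler t x z \<partial>\<nu>) \<in> borel_measurable borel"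
    by (rule borel_measurable_lebesgue_integral) (simp add: mehler_def case_prod_beta, measurable)
  then show ?thesis by (simp add: marginal_def[abs_def])
qed

lemma posterior_measurable [measurable]: "posterior t \<in> borel_measurable borel"
proof -
  have "(\<lambda>z. \<integral>x. x * mehler t x z \<partial>\<nu>) \<in> borel_measurable borel"
    by (rule borel_measurable_lebesgue_integral) (simp add: mehler_def case_prod_beta, measurable)
  then show ?thesis unfolding posterior_def[abs_def] by measurable
qed

text \<open>Bias-variance decomposition under the unnormalised posterior, whose total mass is
  \<open>marginal t z\<close>.\<close>

lemma conditional_mse:
  assumes t: "0 < t" "t < 1"
  shows "(\<integral>x. (x - c)\<^sup>2 * mehler t x z \<partial>\<nu>) = (\<integral>x. (x - posterior t z)\<^sup>2 * mehler t x z \<partial>\<nu>) + marginal t z * (c - posterior t z)\<^sup>2"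
proof -
  note i = integrable_times_mehler[OF t, of _ z]
  have i0: "integrable \<nu> (\<lambda>x. mehler t x z)" using i[of "\<lambda>_. 1"] by simp
  have i1: "integrable \<nu> (\<lambda>x. x * mehler t x z)" using i[of "\<lambda>x. x"] integrable_power[of 1] by simp
  have i2: "integrable \<nu> (\<lambda>x. x\<^sup>2 * mehler t x z)" using i[OF integrable_power[of 2]] by simp
  have *: "(\<integral>x. (x - c)\<^sup>2 * mehler t x z \<partial>\<nu>) =
      (\<integral>x. x\<^sup>2 * mehler t x z \<partial>\<nu>) - 2 * c * (\<integral>x. x * mehler t x z \<partial>\<nu>) + c\<^sup>2 * marginal t z" for c
  proof -
    have "(\<integral>x. (x - c)\<^sup>2 * mehler t x z \<partial>\<nu>) = (\<integral>x. x\<^sup>2 * mehler t x z - 2 * c * (x * mehler t x z) + c\<^sup>2 * mehler t x z \<partial>\<nu>)"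
      by (simp add: power2_diff algebra_simps)
    also have "\<dots> = (\<integral>x. x\<^sup>2 * mehler t x z \<partial>\<nu>) - 2 * c * (\<integral>x. x * mehler t x z \<partial>\<nu>) + c\<^sup>2 * marginal t z"
      using i0 i1 i2 by (simp add: marginal_def)
    finally show ?thesis .
  qed
  have "(\<integral>x. x * mehler t x z \<partial>\<nu>) = posterior t z * marginal t z"
    using marginal_pos[OF t, of z] by (simp add: posterior_def)
  then show ?thesis unfolding *[of c] *[of "posterior t z"] by (simp add: power2_eq_square algebra_simps)
qed

lemma integral_joint:
  assumes [measurable]: "f \<in> borel_measurable (borel \<Otimes>\<^sub>M borel)" and t: "0 < t" "t < 1" and f: "integrable (joint t) f"
  shows "integrable std_gaussian (\<lambda>z. \<integral>x. f (x, z) * mehler t x z \<partial>\<nu>)"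
    and "(\<integral>w. f w \<partial>joint t) = (\<integral>z. (\<integral>x. f (x, z) * mehler t x z \<partial>\<nu>) \<partial>std_gaussian)"
proof -
  have "AE w in \<nu> \<Otimes>\<^sub>M std_gaussian. 0 \<le> mehler t (fst w) (snd w)"
    using mehler_pos t by (intro AE_I2) (simp add: less_imp_le)
  moreover have [measurable]: "f \<in> borel_measurable (\<nu> \<Otimes>\<^sub>M std_gaussian)" by simp
  ultimately have i: "integrable (\<nu> \<Otimes>\<^sub>M std_gaussian) (\<lambda>w. mehler t (fst w) (snd w) * f w)"
    and e: "(\<integral>w. f w \<partial>joint t) = (\<integral>w. mehler t (fst w) (snd w) * f w \<partial>(\<nu> \<Otimes>\<^sub>M std_gaussian))"
    using f unfolding joint_def by (simp_all add: integrable_density integral_density)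
  have i': "integrable (\<nu> \<Otimes>\<^sub>M std_gaussian) (\<lambda>(x, z). f (x, z) * mehler t x z)"
    using i by (simp add: split_beta' mult.commute)
  show "integrable std_gaussian (\<lambda>z. \<integral>x. f (x, z) * mehler t x z \<partial>\<nu>)"
    using pair.integrable_snd[OF i'] by simp
  show "(\<integral>w. f w \<partial>joint t) = (\<integral>z. (\<integral>x. f (x, z) * mehler t x z \<partial>\<nu>) \<partial>std_gaussian)"
    unfolding pair.integral_snd[OF i'] e by (simp add: split_beta' mult.commute)
qed

lemma prob_space_joint:
  assumes t: "0 < t" "t < 1"
  shows "prob_space (joint t)"
proof
  have "emeasure (joint t) (space (joint t)) = (\<integral>\<^sup>+w. 1 \<partial>joint t)" by simp
  also have "\<dots> = 1" using emeasure_space_1 by (subst nn_integral_joint[OF _ t]) (auto simp: gaussian.emeasure_space_1[simplified])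
  finally show "emeasure (joint t) (space (joint t)) = 1" .
qed

lemma integrable_joint_fst:
  fixes f :: "real \<Rightarrow> real"
  assumes t: "0 < t" "t < 1" and f: "integrable \<nu> f" "f \<in> borel_measurable borel"
  shows "integrable (joint t) (\<lambda>w. f (fst w))"
proof (rule integrableI_bounded)
  note [measurable] = f(2)
  show "(\<lambda>w. f (fst w)) \<in> borel_measurable (joint t)" by measurable
  have "(\<integral>\<^sup>+w. ennreal (norm (f (fst w))) \<partial>joint t) = (\<integral>\<^sup>+x. ennreal (norm (f x)) \<partial>\<nu>)"
    by (subst nn_integral_joint[OF _ t]) (auto simp: gaussian.emeasure_space_1[simplified])
  also have "\<dots> < \<infinity>" using f(1) by (simp add: integrable_iff_bounded)
  finally show "(\<integral>\<^sup>+w. ennreal (norm (f (fst w))) \<partial>joint t) < \<infinity>" .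
qed

text \<open>Conditional Jensen: \<open>conditional_mse\<close> at c = 0 bounds the squared posterior
  mean by the conditional second moment. Integrability is the goal, so the comparison is made with
  \<open>nn_integral\<close>.\<close>

lemma integrable_joint_posterior_sq:
  assumes t: "0 < t" "t < 1"
  shows "integrable (joint t) (\<lambda>w. (posterior t (snd w))\<^sup>2)"
proof (rule integrableI_bounded)
  show "(\<lambda>w. (posterior t (snd w))\<^sup>2) \<in> borel_measurable (joint t)" by measurable
  have mp: "mehler t x z > 0" for x z using mehler_pos t by simp
  have "(\<integral>\<^sup>+w. ennreal (norm ((posterior t (snd w))\<^sup>2)) \<partial>joint t) =
      (\<integral>\<^sup>+w. ennreal (mehler t (fst w) (snd w)) * ennreal ((posterior t (snd w))\<^sup>2) \<partial>(\<nu> \<Otimes>\<^sub>M std_gaussian))"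
    unfolding joint_def by (subst nn_integral_density) auto
  also have "\<dots> = (\<integral>\<^sup>+z. (\<integral>\<^sup>+x. ennreal (mehler t x z) * ennreal ((posterior t z)\<^sup>2) \<partial>\<nu>) \<partial>std_gaussian)"
    by (subst pair.nn_integral_snd[symmetric]) auto
  also have "\<dots> \<le> (\<integral>\<^sup>+z. (\<integral>\<^sup>+x. ennreal (mehler t x z) * ennreal (x\<^sup>2) \<partial>\<nu>) \<partial>std_gaussian)"
  proof (rule nn_integral_mono)
    fix z
    have i0: "integrable \<nu> (\<lambda>x. mehler t x z)" using integrable_times_mehler[OF t, of "\<lambda>_. 1"] by simp
    have i2: "integrable \<nu> (\<lambda>x. x\<^sup>2 * mehler t x z)" using integrable_times_mehler[OF t integrable_power[of 2]] by simp
    have "(\<integral>\<^sup>+x. ennreal (mehler t x z) * ennreal ((posterior t z)\<^sup>2) \<partial>\<nu>) = ennreal (marginal t z * (posterior t z)\<^sup>2)"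
      using i0 mp by (simp add: ennreal_mult[symmetric] less_imp_le nn_integral_eq_integral marginal_def)
    also have "\<dots> \<le> ennreal (\<integral>x. x\<^sup>2 * mehler t x z \<partial>\<nu>)"
      using conditional_mse[OF t, of 0 z] mp by (intro ennreal_leI) (simp add: integral_nonneg_AE less_imp_le)
    also have "\<dots> = (\<integral>\<^sup>+x. ennreal (mehler t x z) * ennreal (x\<^sup>2) \<partial>\<nu>)"
      using i2 mp by (simp add: ennreal_mult[symmetric] less_imp_le nn_integral_eq_integral[symmetric] mult.commute)
    finally show "(\<integral>\<^sup>+x. ennreal (mehler t x z) * ennreal ((posterior t z)\<^sup>2) \<partial>\<nu>) \<le> (\<integral>\<^sup>+x. ennreal (mehler t x z) * ennreal (x\<^sup>2) \<partial>\<nu>)" .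
  qed
  also have "\<dots> = (\<integral>\<^sup>+w. ennreal (mehler t (fst w) (snd w)) * ennreal ((fst w)\<^sup>2) \<partial>(\<nu> \<Otimes>\<^sub>M std_gaussian))"
    by (subst pair.nn_integral_snd[symmetric]) auto
  also have "\<dots> = (\<integral>\<^sup>+w. ennreal (norm ((fst w)\<^sup>2)) \<partial>joint t)"
    unfolding joint_def by (subst nn_integral_density) auto
  also have "\<dots> < \<infinity>"
    using integrable_joint_fst[OF t integrable_power[of 2]] by (simp add: integrable_iff_bounded)
  finally show "(\<integral>\<^sup>+w. ennreal (norm ((posterior t (snd w))\<^sup>2)) \<partial>joint t) < \<infinity>" .
qed

lemma integrable_joint_posterior:
  assumes t: "0 < t" "t < 1"
  shows "integrable (joint t) (\<lambda>w. posterior t (snd w))"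
proof -
  interpret joint: prob_space "joint t" by (rule prob_space_joint[OF t])
  show ?thesis by (rule joint.square_integrable_imp_integrable[OF _ integrable_joint_posterior_sq[OF t]]) measurable
qed

definition risk :: "real \<Rightarrow> real" where
  "risk t = (\<integral>w. (fst w - posterior t (snd w))\<^sup>2 \<partial>joint t)"

text \<open>Pythagoras for conditional expectations. It turns the risk into the loss of an explicit
  \<open>\<psi>\<close> minus its squared distance from the posterior mean.\<close>

lemma risk_decomposition:
  assumes t: "0 < t" "t < 1" and [measurable]: "\<psi> \<in> borel_measurable borel"
    and i: "integrable (joint t) (\<lambda>w. (fst w - \<psi> (snd w))\<^sup>2)"
  shows "risk t = (\<integral>w. (fst w - \<psi> (snd w))\<^sup>2 \<partial>joint t) - (\<integral>z. marginal t z * (\<psi> z - posterior t z)\<^sup>2 \<partial>std_gaussian)"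
    and "integrable std_gaussian (\<lambda>z. marginal t z * (\<psi> z - posterior t z)\<^sup>2)"
proof -
  have i': "integrable (joint t) (\<lambda>w. (fst w - posterior t (snd w))\<^sup>2)"
  proof (rule Bochner_Integration.integrable_bound)
    show "integrable (joint t) (\<lambda>w. 2 * (fst w)\<^sup>2 + 2 * (posterior t (snd w))\<^sup>2)"
      using integrable_joint_fst[OF t integrable_power[of 2]] integrable_joint_posterior_sq[OF t] by auto
    show "AE w in joint t. norm ((fst w - posterior t (snd w))\<^sup>2) \<le> norm (2 * (fst w)\<^sup>2 + 2 * (posterior t (snd w))\<^sup>2)"
    proof (intro AE_I2)
      fix w
      have "0 \<le> (fst w + posterior t (snd w))\<^sup>2" by simp
      then have "(fst w - posterior t (snd w))\<^sup>2 \<le> 2 * (fst w)\<^sup>2 + 2 * (posterior t (snd w))\<^sup>2"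
        by (simp add: power2_eq_square algebra_simps)
      then show "norm ((fst w - posterior t (snd w))\<^sup>2) \<le> norm (2 * (fst w)\<^sup>2 + 2 * (posterior t (snd w))\<^sup>2)"
        by simp
    qed
  qed measurable
  let ?V = "\<lambda>z. \<integral>x. (x - \<psi> z)\<^sup>2 * mehler t x z \<partial>\<nu>" and ?V' = "\<lambda>z. \<integral>x. (x - posterior t z)\<^sup>2 * mehler t x z \<partial>\<nu>"
  have V: "integrable std_gaussian ?V" "(\<integral>w. (fst w - \<psi> (snd w))\<^sup>2 \<partial>joint t) = (\<integral>z. ?V z \<partial>std_gaussian)"
    using integral_joint[OF _ t i] by simp_all
  have V': "integrable std_gaussian ?V'" "risk t = (\<integral>z. ?V' z \<partial>std_gaussian)"
    using integral_joint[OF _ t i'] unfolding risk_def by simp_all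
  have eq: "(\<lambda>z. marginal t z * (\<psi> z - posterior t z)\<^sup>2) = (\<lambda>z. ?V z - ?V' z)"
  proof
    fix z show "marginal t z * (\<psi> z - posterior t z)\<^sup>2 = ?V z - ?V' z"
      using conditional_mse[OF t, of "\<psi> z" z] by linarith
  qed
  show "integrable std_gaussian (\<lambda>z. marginal t z * (\<psi> z - posterior t z)\<^sup>2)"
    unfolding eq using V V' by (intro Bochner_Integration.integrable_diff)
  show "risk t = (\<integral>w. (fst w - \<psi> (snd w))\<^sup>2 \<partial>joint t) - (\<integral>z. marginal t z * (\<psi> z - posterior t z)\<^sup>2 \<partial>std_gaussian)"
    unfolding eq V(2) V'(2) using V V' by (simp add: Bochner_Integration.integral_diff)
qed

lemma posterior_is_conditional_mean:
  assumes t: "0 < t" "t < 1" and B: "B \<in> sets borel"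
  shows "(\<integral>w. fst w * indicator B (snd w) \<partial>joint t) = (\<integral>w. posterior t (snd w) * indicator B (snd w) \<partial>joint t)"
proof -
  note [measurable] = B
  have i1: "integrable (joint t) (\<lambda>w. fst w * indicator B (snd w))"
    by (rule Bochner_Integration.integrable_bound[OF integrable_joint_fst[OF t integrable_power[of 1]]])
       (auto simp: indicator_def)
  have i2: "integrable (joint t) (\<lambda>w. posterior t (snd w) * indicator B (snd w))"
    by (rule Bochner_Integration.integrable_bound[OF integrable_joint_posterior[OF t]])
       (auto simp: indicator_def)
  have "(\<integral>x. x * indicator B z * mehler t x z \<partial>\<nu>) = (\<integral>x. posterior t z * indicator B z * mehler t x z \<partial>\<nu>)" for z
  proof -
    have "(\<integral>x. x * indicator B z * mehler t x z \<partial>\<nu>) = (\<integral>x. indicator B z * (x * mehler t x z) \<partial>\<nu>)" by (simp add: mult_ac)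
    also have "\<dots> = indicator B z * (posterior t z * marginal t z)"
      using marginal_pos[OF t, of z] by (simp add: posterior_def)
    also have "\<dots> = (\<integral>x. posterior t z * indicator B z * mehler t x z \<partial>\<nu>)" by (simp add: marginal_def)
    finally show ?thesis .
  qed
  then show ?thesis using integral_joint(2)[OF _ t i1] integral_joint(2)[OF _ t i2] by simp
qed

end

section \<open>From the observation \<open>sqrt s X + N\<close> to the standardised channel\<close>

lemma law_scale:
  assumes "X \<in> borel_measurable M"
  shows "law M (\<lambda>\<omega>. X \<omega> / \<sigma>) = distr (law M X) borel (\<lambda>x. x / \<sigma>)"
  unfolding law_def using assms by (subst distr_distr) (auto simp: o_def)

lemma distr_pair_eq_joint:
  fixes X :: "'a \<Rightarrow> real"
  assumes M: "prob_space M" and X: "X \<in> borel_measurable M" and \<nu>: "standardized (law M (\<lambda>\<omega>. X \<omega> / \<sigma>))"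
    and t: "0 < t" "t < 1"
  shows "distr (law M X \<Otimes>\<^sub>M std_gaussian) (borel \<Otimes>\<^sub>M borel) (\<lambda>w. (fst w / \<sigma>, t * (fst w / \<sigma>) + sqrt (1 - t\<^sup>2) * snd w))
    = standardized.joint (law M (\<lambda>\<omega>. X \<omega> / \<sigma>)) t"
proof -
  let ?\<nu> = "law M (\<lambda>\<omega>. X \<omega> / \<sigma>)" and ?\<Theta> = "\<lambda>w. (fst w / \<sigma>, t * (fst w / \<sigma>) + sqrt (1 - t\<^sup>2) * snd w)"
  interpret N: standardized ?\<nu> by (rule \<nu>)
  interpret \<mu>: real_distribution "law M X" by (rule real_distribution_law) fact+
  have [measurable_cong]: "sets (law M X \<Otimes>\<^sub>M std_gaussian) = sets (borel \<Otimes>\<^sub>M borel)"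
    by (rule sets_pair_measure_cong) auto
  show ?thesis
  proof (rule measure_eqI)
    show "sets (distr (law M X \<Otimes>\<^sub>M std_gaussian) (borel \<Otimes>\<^sub>M borel) ?\<Theta>) = sets (N.joint t)" by simp
    fix A assume "A \<in> sets (distr (law M X \<Otimes>\<^sub>M std_gaussian) (borel \<Otimes>\<^sub>M borel) ?\<Theta>)"
    then have A [measurable]: "A \<in> sets (borel \<Otimes>\<^sub>M borel)" by simp
    have "emeasure (distr (law M X \<Otimes>\<^sub>M std_gaussian) (borel \<Otimes>\<^sub>M borel) ?\<Theta>) A =
        (\<integral>\<^sup>+w. indicator A w \<partial>distr (law M X \<Otimes>\<^sub>M std_gaussian) (borel \<Otimes>\<^sub>M borel) ?\<Theta>)" by simp
    also have "\<dots> = (\<integral>\<^sup>+w. indicator A (?\<Theta> w) \<partial>(law M X \<Otimes>\<^sub>M std_gaussian))"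
      by (rule nn_integral_distr) measurable
    also have "\<dots> = (\<integral>\<^sup>+x. (\<integral>\<^sup>+n. indicator A (x / \<sigma>, t * (x / \<sigma>) + sqrt (1 - t\<^sup>2) * n) \<partial>std_gaussian) \<partial>law M X)"
      by (subst N.gaussian.nn_integral_fst[symmetric]) auto
    also have "\<dots> = (\<integral>\<^sup>+x. (\<integral>\<^sup>+n. indicator A (x, t * x + sqrt (1 - t\<^sup>2) * n) \<partial>std_gaussian) \<partial>?\<nu>)"
      unfolding law_scale[OF X] by (subst nn_integral_distr) measurable
    also have "\<dots> = (\<integral>\<^sup>+w. indicator A w \<partial>N.joint t)"
      by (rule N.nn_integral_joint[symmetric]) (use t in auto)
    also have "\<dots> = emeasure (N.joint t) A" by simp
    finally show "emeasure (distr (law M X \<Otimes>\<^sub>M std_gaussian) (borel \<Otimes>\<^sub>M borel) ?\<Theta>) A = emeasure (N.joint t) A" .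
  qed
qed

lemma mmse_eq_risk:
  fixes X :: "'a \<Rightarrow> real"
  assumes M: "prob_space M" and X: "X \<in> borel_measurable M" and mom: "has_all_moments M X"
    and \<nu>: "standardized (law M (\<lambda>\<omega>. X \<omega> / \<sigma>))" and \<sigma>: "\<sigma> > 0" and t: "0 < t" "t < 1"
  shows "mmse M X (t\<^sup>2 / (\<sigma>\<^sup>2 * (1 - t\<^sup>2))) = \<sigma>\<^sup>2 * standardized.risk (law M (\<lambda>\<omega>. X \<omega> / \<sigma>)) t"
proof -
  let ?\<nu> = "law M (\<lambda>\<omega>. X \<omega> / \<sigma>)"
  define b where "b = sqrt (1 - t\<^sup>2)"
  have b: "b > 0" and b2: "b\<^sup>2 = 1 - t\<^sup>2" using t by (simp_all add: b_def power_less_one_iff power_le_one)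
  define s where "s = t\<^sup>2 / (\<sigma>\<^sup>2 * (1 - t\<^sup>2))"
  have "s = (t / (\<sigma> * b))\<^sup>2" by (simp add: s_def power_divide power_mult_distrib b2)
  then have sqrt_s: "sqrt s = t / (\<sigma> * b)" using t \<sigma> b by simp
  interpret N: standardized ?\<nu> by (rule \<nu>)
  interpret \<mu>: real_distribution "law M X" by (rule real_distribution_law) fact+
  define P where "P = law M X \<Otimes>\<^sub>M std_gaussian"
  interpret PP: pair_prob_space "law M X" std_gaussian ..
  interpret P: prob_space P unfolding P_def by (rule PP.P.prob_space_axioms)
  have setsP [simp, measurable_cong]: "sets P = sets (borel \<Otimes>\<^sub>M borel)"
    unfolding P_def by (rule sets_pair_measure_cong) auto
  have spaceP [simp]: "space P = UNIV" unfolding P_def by (simp add: space_pair_measure)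
  define \<Theta> where "\<Theta> w = (fst w / \<sigma>, t * (fst w / \<sigma>) + b * snd w)" for w :: "real \<times> real"
  have [measurable]: "\<Theta> \<in> P \<rightarrow>\<^sub>M borel \<Otimes>\<^sub>M borel" unfolding \<Theta>_def by measurable
  have joint: "distr P (borel \<Otimes>\<^sub>M borel) \<Theta> = N.joint t"
    using distr_pair_eq_joint[OF M X \<nu> t] unfolding P_def \<Theta>_def b_def .
  define Ys where "Ys = (\<lambda>(x, n). sqrt s * x + n :: real)"
  have Ys: "Ys w = snd (\<Theta> w) / b" for w
    using b \<sigma> by (simp add: Ys_def \<Theta>_def sqrt_s split_beta field_simps)
  have [measurable]: "Ys \<in> borel_measurable P" unfolding Ys_def by measurable
  define F where "F = vimage_algebra (space P) Ys borel"
  have setsF: "sets F = {Ys -` A \<inter> space P | A. A \<in> sets borel}"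
    unfolding F_def by (rule sets_vimage_algebra2) simp
  have sub: "subalgebra P F"
    unfolding subalgebra_def setsF by (auto simp: F_def intro: measurable_sets[of Ys P borel, simplified])
  interpret F: finite_measure_subalgebra P F
    by (unfold_locales) (rule sub)
  define g where "g w = \<sigma> * N.posterior t (snd (\<Theta> w))" for w
  have g_eq: "g = (\<lambda>w. \<sigma> * N.posterior t (b * Ys w))" using b by (auto simp: g_def Ys)
  have "Ys \<in> F \<rightarrow>\<^sub>M borel" unfolding F_def by (rule measurable_vimage_algebra1) simp
  then have gF: "g \<in> borel_measurable F" unfolding g_eq by measurable
  have fst_int: "integrable P fst"
  proof -
    have "integrable (distr P (borel \<Otimes>\<^sub>M borel) \<Theta>) (\<lambda>w. \<sigma> * fst w)"
      unfolding joint using N.integrable_joint_fst[OF t N.integrable_power[of 1]] by auto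
    then have "integrable P (\<lambda>w. \<sigma> * fst (\<Theta> w))" by (subst (asm) integrable_distr_eq) auto
    then show ?thesis using \<sigma> by (simp add: \<Theta>_def)
  qed
  have g_int: "integrable P g"
  proof -
    have "integrable (distr P (borel \<Otimes>\<^sub>M borel) \<Theta>) (\<lambda>w. \<sigma> * N.posterior t (snd w))"
      unfolding joint using N.integrable_joint_posterior[OF t] by auto
    then show ?thesis unfolding g_def by (subst (asm) integrable_distr_eq) auto
  qed
  have "AE w in P. real_cond_exp P F fst w = g w"
  proof (rule F.real_cond_exp_charact[OF _ fst_int g_int gF])
    fix A assume "A \<in> sets F"
    then obtain B where A: "A = Ys -` B" and [measurable]: "B \<in> sets borel" by (auto simp: setsF)
    \<comment> \<open>\<open>Ys\<close> is the second coordinate of \<open>\<Theta>\<close> divided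
      by b, so an event about \<open>Ys\<close> becomes one about that coordinate after rescaling
      the set.\<close>
    define B' where "B' = (\<lambda>z. z / b) -` B"
    have [measurable]: "B' \<in> sets borel"
      unfolding B'_def using measurable_sets[of "\<lambda>z. z / b" borel borel B] by simp
    have ind: "indicator A w = (indicator B' (snd (\<Theta> w)) :: real)" for w
      by (auto simp: A B'_def Ys indicator_def)
    have "(\<integral>w\<in>A. fst w \<partial>P) = (\<integral>w. \<sigma> * (fst (\<Theta> w) * indicator B' (snd (\<Theta> w))) \<partial>P)"
      unfolding set_lebesgue_integral_def using \<sigma> by (intro Bochner_Integration.integral_cong) (auto simp: ind \<Theta>_def)
    also have "\<dots> = (\<integral>w. \<sigma> * (fst w * indicator B' (snd w)) \<partial>N.joint t)"
      unfolding joint[symmetric] by (rule integral_distr[symmetric]) measurable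
    also have "\<dots> = (\<integral>w. \<sigma> * (N.posterior t (snd w) * indicator B' (snd w)) \<partial>N.joint t)"
      using N.posterior_is_conditional_mean[OF t, of B'] by simp
    also have "\<dots> = (\<integral>w. \<sigma> * (N.posterior t (snd (\<Theta> w)) * indicator B' (snd (\<Theta> w))) \<partial>P)"
      unfolding joint[symmetric] by (rule integral_distr) measurable
    also have "\<dots> = (\<integral>w\<in>A. g w \<partial>P)"
      unfolding set_lebesgue_integral_def by (intro Bochner_Integration.integral_cong) (auto simp: ind g_def)
    finally show "(\<integral>w\<in>A. fst w \<partial>P) = (\<integral>w\<in>A. g w \<partial>P)" .
  qed
  then have AE: "AE w in P. (fst w - real_cond_exp P F fst w)\<^sup>2 = (fst w - g w)\<^sup>2" by auto
  have "mmse M X s = (\<integral>w. (fst w - real_cond_exp P F fst w)\<^sup>2 \<partial>P)"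
    unfolding mmse_def Let_def P_def[symmetric] Ys_def[symmetric] F_def[symmetric] ..
  also have "\<dots> = (\<integral>w. (fst w - g w)\<^sup>2 \<partial>P)"
    by (rule integral_cong_AE[OF _ _ AE]) (use fst_int g_int in \<open>auto intro!: borel_measurable_power borel_measurable_diff borel_measurable_cond_exp2\<close>)
  also have "\<dots> = (\<integral>w. \<sigma>\<^sup>2 * (fst (\<Theta> w) - N.posterior t (snd (\<Theta> w)))\<^sup>2 \<partial>P)"
  proof (rule Bochner_Integration.integral_cong[OF refl])
    fix w
    have "fst w - g w = \<sigma> * (fst (\<Theta> w) - N.posterior t (snd (\<Theta> w)))"
      using \<sigma> by (simp add: g_def \<Theta>_def algebra_simps)
    then show "(fst w - g w)\<^sup>2 = \<sigma>\<^sup>2 * (fst (\<Theta> w) - N.posterior t (snd (\<Theta> w)))\<^sup>2"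
      by (simp add: power_mult_distrib)
  qed
  also have "\<dots> = (\<integral>w. \<sigma>\<^sup>2 * (fst w - N.posterior t (snd w))\<^sup>2 \<partial>N.joint t)"
    unfolding joint[symmetric] by (rule integral_distr[symmetric]) measurable
  also have "\<dots> = \<sigma>\<^sup>2 * N.risk t" by (simp add: N.risk_def)
  finally show ?thesis by (simp add: s_def)
qed

text \<open>An input of variance 0 cannot be standardised, and this case has to be covered until the
  variance of \<open>Y\<close> is known.\<close>

lemma mmse_AE_zero:
  fixes X :: "'a \<Rightarrow> real"
  assumes M: "prob_space M" and X: "X \<in> borel_measurable M" and z: "AE x in law M X. x = 0"
  shows "mmse M X s = 0"
proof -
  interpret \<mu>: real_distribution "law M X" by (rule real_distribution_law) fact+
  interpret G: prob_space std_gaussian by (rule prob_space_std_gaussian)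
  define P where "P = law M X \<Otimes>\<^sub>M std_gaussian"
  interpret PP: pair_prob_space "law M X" std_gaussian ..
  interpret P: prob_space P unfolding P_def by (rule PP.P.prob_space_axioms)
  have setsP [simp, measurable_cong]: "sets P = sets (borel \<Otimes>\<^sub>M borel)"
    unfolding P_def by (rule sets_pair_measure_cong) auto
  have spaceP [simp]: "space P = UNIV" unfolding P_def by (simp add: space_pair_measure)
  define Ys where "Ys = (\<lambda>(x, n). sqrt s * x + n :: real)"
  have [measurable]: "Ys \<in> borel_measurable P" unfolding Ys_def by measurable
  define F where "F = vimage_algebra (space P) Ys borel"
  have sub: "subalgebra P F"
    unfolding subalgebra_def F_def by (subst sets_vimage_algebra2) (auto intro: measurable_sets[of Ys P borel, simplified])
  interpret F: finite_measure_subalgebra P F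
    by (unfold_locales) (rule sub)
  have fst0: "AE w in P. fst w = 0"
  proof -
    have "{w \<in> space P. fst w = 0} \<in> sets P" by measurable
    then show ?thesis unfolding P_def by (rule PP.AE_pair_measure) (use z in auto)
  qed
  have [measurable]: "(fst :: real \<times> real \<Rightarrow> real) \<in> borel_measurable P" by measurable
  have "AE w in P. real_cond_exp P F fst w = real_cond_exp P F (\<lambda>_. 0) w"
    by (rule F.real_cond_exp_cong) (use fst0 in auto)
  moreover have "AE w in P. real_cond_exp P F (\<lambda>_. 0) w = (0::real)"
    by (rule F.real_cond_exp_F_meas) auto
  ultimately have "AE w in P. (fst w - real_cond_exp P F fst w)\<^sup>2 = 0" using fst0 by eventually_elim simp
  moreover have "mmse M X s = (\<integral>w. (fst w - real_cond_exp P F fst w)\<^sup>2 \<partial>P)"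
    unfolding mmse_def Let_def P_def[symmetric] Ys_def[symmetric] F_def[symmetric] ..
  ultimately show ?thesis by (simp add: integral_eq_zero_AE)
qed

section \<open>Asymptotic expansion of the risk\<close>

lemma hermite_expansion:
  assumes "degree p \<le> N"
  shows "p = (\<Sum>k\<le>N. smult (gauss (p * hermite k) / fact k) (hermite k))"
proof -
  define r where "r = p - (\<Sum>k\<le>N. smult (gauss (p * hermite k) / fact k) (hermite k))"
  have deg: "degree r \<le> N"
    unfolding r_def by (intro degree_diff_le assms degree_sum_le) (auto intro: order_trans[OF degree_hermite_le])
  have orth: "gauss (r * hermite j) = 0" if "j \<le> N" for j
  proof -
    have "gauss ((\<Sum>k\<le>N. smult (gauss (p * hermite k) / fact k) (hermite k)) * hermite j) =
        (\<Sum>k\<le>N. gauss (p * hermite k) / fact k * (if k = j then fact j else 0))"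
      by (simp add: sum_distrib_right gauss_sum gauss_smult gauss_hermite_mult_hermite)
    also have "\<dots> = (\<Sum>k\<le>N. if k = j then gauss (p * hermite j) else 0)" by (intro sum.cong) auto
    also have "\<dots> = gauss (p * hermite j)" using that by simp
    finally show ?thesis by (simp add: r_def left_diff_distrib gauss_diff)
  qed
  have "r = 0"
  proof (rule ccontr)
    assume "r \<noteq> 0"
    \<comment> \<open>Paired with the Hermite polynomial of its own degree, a nonzero polynomial
      returns a multiple of its leading coefficient.\<close>
    then have "gauss (r * hermite (degree r)) \<noteq> 0" using gauss_mult_hermite_top[of r "degree r"] by simp
    then show False using orth[OF deg] by simp
  qed
  then show ?thesis by (simp add: r_def)
qed

text \<open>Hermite polynomials are eigenfunctions of the Ornstein-Uhlenbeck semigroup. For V p = E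
  p(t x + b N), Stein's identity gives V (z p) = t x V p + (1 - t^2) V p', which matches the
  three-term recurrence.\<close>

lemma gauss_affine_hermite:
  "gauss (pcompose (hermite k) [:t * x, sqrt (1 - t\<^sup>2):]) = t ^ k * poly (hermite k) x" if t: "0 < t" "t < 1"
proof -
  define b where "b = sqrt (1 - t\<^sup>2)"
  have b2: "b * b = 1 - t\<^sup>2" using t by (simp add: b_def power_le_one)
  define V where "V p = gauss (pcompose p [:t * x, b:])" for p
  have Vz: "V ([:0, 1:] * p) = t * x * V p + (1 - t\<^sup>2) * V (pderiv p)" for p
  proof -
    have "pcompose ([:0, 1:] * p) [:t * x, b:] = smult (t * x) (pcompose p [:t * x, b:]) + smult b ([:0, 1:] * pcompose p [:t * x, b:])"
      by (simp add: pcompose_mult pcompose_pCons)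
    then have "V ([:0, 1:] * p) = t * x * V p + b * gauss ([:0, 1:] * pcompose p [:t * x, b:])"
      unfolding V_def by (simp only: gauss_add gauss_smult)
    also have "gauss ([:0, 1:] * pcompose p [:t * x, b:]) = b * V (pderiv p)"
      unfolding gauss_stein V_def pderiv_pcompose by (simp add: pderiv_pCons gauss_smult)
    finally show ?thesis by (simp add: b2[symmetric])
  qed
  have "V (hermite k) = t ^ k * poly (hermite k) x"
  proof (induction k rule: hermite.induct)
    case 1
    show ?case by (simp add: V_def gauss_1 pcompose_1)
  next
    case 2
    have "V [:0, 1:] = t * x * V 1 + (1 - t\<^sup>2) * V 0" using Vz[of 1] by (simp add: pderiv_1)
    then show ?case by (simp add: V_def gauss_1 pcompose_1)
  next
    case (3 n)
    have "V (hermite (Suc (Suc n))) = V ([:0, 1:] * hermite (Suc n)) - real (Suc n) * V (hermite n)"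
      unfolding V_def hermite.simps(3) by (simp only: pcompose_diff pcompose_smult gauss_diff gauss_smult)
    also have "\<dots> = t * x * V (hermite (Suc n)) + (1 - t\<^sup>2) * (real (Suc n) * V (hermite n)) - real (Suc n) * V (hermite n)"
      unfolding Vz pderiv_hermite_Suc by (simp only: V_def pcompose_smult gauss_smult)
    also have "\<dots> = t ^ Suc (Suc n) * poly (hermite (Suc (Suc n))) x"
      unfolding 3 by (simp add: hermite.simps(3) algebra_simps power2_eq_square)
    finally show ?case .
  qed
  then show ?thesis by (simp add: V_def b_def)
qed

lemma borel_measurable_poly [measurable]: "poly (p :: real poly) \<in> borel_measurable borel"
  by (intro borel_measurable_continuous_onI continuous_intros)

lemma integrable_std_gaussian_affine_power: "integrable std_gaussian (\<lambda>x. (1 + \<bar>x\<bar>) ^ p)"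
proof -
  have "integrable std_gaussian (\<lambda>x. \<bar>x\<bar> ^ k)" for k
    using integrable_norm[OF integrable_std_gaussian_power[of k]] by (simp add: power_abs)
  moreover have "(\<lambda>x::real. (1 + \<bar>x\<bar>) ^ p) = (\<lambda>x. \<Sum>k\<le>p. real (p choose k) * \<bar>x\<bar> ^ (p - k))"
    by (rule ext) (simp add: binomial_ring)
  ultimately show ?thesis by auto
qed

lemma poly_le_affine_power:
  fixes p :: "real poly"
  assumes "degree p \<le> d"
  shows "\<bar>poly p z\<bar> \<le> (\<Sum>i\<le>degree p. \<bar>coeff p i\<bar>) * (1 + \<bar>z\<bar>) ^ d"
proof -
  have "\<bar>poly p z\<bar> \<le> (\<Sum>i\<le>degree p. \<bar>coeff p i * z ^ i\<bar>)" unfolding poly_altdef by (rule sum_abs)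
  also have "\<dots> \<le> (\<Sum>i\<le>degree p. \<bar>coeff p i\<bar> * (1 + \<bar>z\<bar>) ^ d)"
  proof (intro sum_mono)
    fix i assume i: "i \<in> {..degree p}"
    have "\<bar>z\<bar> ^ i \<le> (1 + \<bar>z\<bar>) ^ i" by (intro power_mono) auto
    also have "\<dots> \<le> (1 + \<bar>z\<bar>) ^ d" using i assms by (intro power_increasing) auto
    finally show "\<bar>coeff p i * z ^ i\<bar> \<le> \<bar>coeff p i\<bar> * (1 + \<bar>z\<bar>) ^ d"
      by (simp add: abs_mult power_abs mult_left_mono)
  qed
  finally show ?thesis by (simp add: sum_distrib_right)
qed

context standardized
begin

definition herm :: "nat \<Rightarrow> real" where
  "herm k = (\<integral>x. poly (hermite k) x \<partial>\<nu>)"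

lemma herm_0: "herm 0 = 1" and herm_1: "herm 1 = 0" and herm_2: "herm 2 = 0"
proof -
  show "herm 0 = 1" using prob_space by (simp add: herm_def)
  show "herm 1 = 0" using mean_0 by (simp add: herm_def)
  have "herm 2 = (\<integral>x. x\<^sup>2 - 1 \<partial>\<nu>)" by (simp add: herm_def hermite_explicit power2_eq_square)
  also have "\<dots> = 0" using integrable_power[of 2] prob_space var_1 by simp
  finally show "herm 2 = 0" .
qed

lemma joint_eq_distr:
  assumes t: "0 < t" "t < 1"
  shows "joint t = distr (\<nu> \<Otimes>\<^sub>M std_gaussian) (borel \<Otimes>\<^sub>M borel) (\<lambda>w. (fst w, t * fst w + sqrt (1 - t\<^sup>2) * snd w))"
proof -
  have law: "law \<nu> (\<lambda>x. x) = \<nu>" unfolding law_def by (rule distr_id2) simp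
  then have "law \<nu> (\<lambda>x. x / 1) = \<nu>" by simp
  then have "standardized (law \<nu> (\<lambda>x. x / 1))" using standardized_axioms by simp
  from distr_pair_eq_joint[OF prob_space_axioms _ this t] show ?thesis by (simp add: law)
qed

text \<open>Uniform in t, because 1 + |t x + b n| is at most (1 + |x|) (1 + |n|) for |t| and |b| at
  most 1.\<close>

lemma joint_moment_bound:
  assumes t: "0 < t" "t < 1"
  shows "(\<integral>\<^sup>+w. ennreal ((1 + \<bar>fst w\<bar>) ^ i * (1 + \<bar>snd w\<bar>) ^ j) \<partial>joint t) \<le>
    ennreal ((\<integral>x. (1 + \<bar>x\<bar>) ^ (i + j) \<partial>\<nu>) * (\<integral>n. (1 + \<bar>n\<bar>) ^ j \<partial>std_gaussian))"
proof -
  have b: "\<bar>sqrt (1 - t\<^sup>2)\<bar> \<le> 1" using t by (simp add: power_le_one)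
  have le: "1 + \<bar>t * x + sqrt (1 - t\<^sup>2) * n\<bar> \<le> (1 + \<bar>x\<bar>) * (1 + \<bar>n\<bar>)" for x n
  proof -
    have "\<bar>t * x + sqrt (1 - t\<^sup>2) * n\<bar> \<le> \<bar>t * x\<bar> + \<bar>sqrt (1 - t\<^sup>2) * n\<bar>" by (rule abs_triangle_ineq)
    also have "\<dots> \<le> 1 * \<bar>x\<bar> + 1 * \<bar>n\<bar>"
      unfolding abs_mult using b t by (intro add_mono mult_right_mono) auto
    also have "\<dots> \<le> \<bar>x\<bar> + \<bar>n\<bar> + \<bar>x\<bar> * \<bar>n\<bar>" by simp
    finally show ?thesis by (simp add: algebra_simps)
  qed
  have "(\<integral>\<^sup>+w. ennreal ((1 + \<bar>fst w\<bar>) ^ i * (1 + \<bar>snd w\<bar>) ^ j) \<partial>joint t) =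
      (\<integral>\<^sup>+x. (\<integral>\<^sup>+n. ennreal ((1 + \<bar>x\<bar>) ^ i * (1 + \<bar>t * x + sqrt (1 - t\<^sup>2) * n\<bar>) ^ j) \<partial>std_gaussian) \<partial>\<nu>)"
    by (subst nn_integral_joint[OF _ t]) auto
  also have "\<dots> \<le> (\<integral>\<^sup>+x. (\<integral>\<^sup>+n. ennreal ((1 + \<bar>x\<bar>) ^ (i + j)) * ennreal ((1 + \<bar>n\<bar>) ^ j) \<partial>std_gaussian) \<partial>\<nu>)"
  proof (intro nn_integral_mono)
    fix x n :: real
    have "(1 + \<bar>t * x + sqrt (1 - t\<^sup>2) * n\<bar>) ^ j \<le> ((1 + \<bar>x\<bar>) * (1 + \<bar>n\<bar>)) ^ j"
      using le by (intro power_mono) auto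
    then have "(1 + \<bar>x\<bar>) ^ i * (1 + \<bar>t * x + sqrt (1 - t\<^sup>2) * n\<bar>) ^ j \<le> (1 + \<bar>x\<bar>) ^ i * ((1 + \<bar>x\<bar>) * (1 + \<bar>n\<bar>)) ^ j"
      by (intro mult_left_mono) auto
    then show "ennreal ((1 + \<bar>x\<bar>) ^ i * (1 + \<bar>t * x + sqrt (1 - t\<^sup>2) * n\<bar>) ^ j) \<le> ennreal ((1 + \<bar>x\<bar>) ^ (i + j)) * ennreal ((1 + \<bar>n\<bar>) ^ j)"
      by (simp add: ennreal_mult[symmetric] power_add power_mult_distrib mult_ac ennreal_leI)
  qed
  also have "\<dots> = (\<integral>\<^sup>+x. ennreal ((1 + \<bar>x\<bar>) ^ (i + j)) \<partial>\<nu>) * (\<integral>\<^sup>+n. ennreal ((1 + \<bar>n\<bar>) ^ j) \<partial>std_gaussian)"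
    by (simp add: nn_integral_cmult nn_integral_multc)
  also have "\<dots> = ennreal ((\<integral>x. (1 + \<bar>x\<bar>) ^ (i + j) \<partial>\<nu>) * (\<integral>n. (1 + \<bar>n\<bar>) ^ j \<partial>std_gaussian))"
    using integrable_affine_power integrable_std_gaussian_affine_power
    by (simp add: nn_integral_eq_integral ennreal_mult)
  finally show ?thesis .
qed

lemma integrable_joint_affine_power:
  assumes t: "0 < t" "t < 1"
  shows "integrable (joint t) (\<lambda>w. (1 + \<bar>fst w\<bar>) ^ i * (1 + \<bar>snd w\<bar>) ^ j)"
proof (rule integrableI_bounded)
  have "(\<integral>\<^sup>+w. ennreal (norm ((1 + \<bar>fst w\<bar>) ^ i * (1 + \<bar>snd w\<bar>) ^ j)) \<partial>joint t) =
      (\<integral>\<^sup>+w. ennreal ((1 + \<bar>fst w\<bar>) ^ i * (1 + \<bar>snd w\<bar>) ^ j) \<partial>joint t)"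
    by (intro nn_integral_cong arg_cong[of _ _ ennreal]) auto
  then show "(\<integral>\<^sup>+w. ennreal (norm ((1 + \<bar>fst w\<bar>) ^ i * (1 + \<bar>snd w\<bar>) ^ j)) \<partial>joint t) < \<infinity>"
    using joint_moment_bound[OF t, of i j] by (simp add: order_le_less_trans)
qed measurable

lemma integrable_joint_poly:
  assumes t: "0 < t" "t < 1"
  shows "integrable (joint t) (\<lambda>w. poly p (fst w) * poly q (snd w))"
proof (rule Bochner_Integration.integrable_bound)
  let ?C = "(\<Sum>i\<le>degree p. \<bar>coeff p i\<bar>) * (\<Sum>i\<le>degree q. \<bar>coeff q i\<bar>)"
  show "integrable (joint t) (\<lambda>w. ?C * ((1 + \<bar>fst w\<bar>) ^ degree p * (1 + \<bar>snd w\<bar>) ^ degree q))"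
    using integrable_joint_affine_power[OF t] by (rule integrable_mult_right)
  show "AE w in joint t. norm (poly p (fst w) * poly q (snd w)) \<le> norm (?C * ((1 + \<bar>fst w\<bar>) ^ degree p * (1 + \<bar>snd w\<bar>) ^ degree q))"
  proof (intro AE_I2)
    fix w :: "real \<times> real"
    have "\<bar>poly p (fst w)\<bar> * \<bar>poly q (snd w)\<bar> \<le>
      ((\<Sum>i\<le>degree p. \<bar>coeff p i\<bar>) * (1 + \<bar>fst w\<bar>) ^ degree p) * ((\<Sum>i\<le>degree q. \<bar>coeff q i\<bar>) * (1 + \<bar>snd w\<bar>) ^ degree q)"
      by (intro mult_mono poly_le_affine_power) (auto intro!: mult_nonneg_nonneg sum_nonneg)
    then show "norm (poly p (fst w) * poly q (snd w)) \<le> norm (?C * ((1 + \<bar>fst w\<bar>) ^ degree p * (1 + \<bar>snd w\<bar>) ^ degree q))"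
      by (simp add: abs_mult mult_ac sum_nonneg)
  qed
qed measurable

lemma integral_joint_poly_hermite:
  assumes t: "0 < t" "t < 1"
  shows "(\<integral>w. poly p (fst w) * poly (hermite k) (snd w) \<partial>joint t) = t ^ k * (\<integral>x. poly (p * hermite k) x \<partial>\<nu>)"
proof -
  let ?b = "sqrt (1 - t\<^sup>2)"
  let ?f = "\<lambda>w. poly p (fst w) * poly (hermite k) (t * fst w + ?b * snd w)"
  have i: "integrable (\<nu> \<Otimes>\<^sub>M std_gaussian) ?f"
    using integrable_joint_poly[OF t, of p "hermite k"] unfolding joint_eq_distr[OF t] by (subst (asm) integrable_distr_eq) auto
  have "(\<integral>w. poly p (fst w) * poly (hermite k) (snd w) \<partial>joint t) = (\<integral>w. ?f w \<partial>(\<nu> \<Otimes>\<^sub>M std_gaussian))"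
    unfolding joint_eq_distr[OF t] by (subst integral_distr) auto
  also have "\<dots> = (\<integral>x. (\<integral>n. ?f (x, n) \<partial>std_gaussian) \<partial>\<nu>)" by (rule pair.integral_fst'[OF i, symmetric])
  also have "\<dots> = (\<integral>x. poly p x * (t ^ k * poly (hermite k) x) \<partial>\<nu>)"
  proof (rule Bochner_Integration.integral_cong[OF refl])
    fix x
    have "(\<integral>n. poly (hermite k) (t * x + ?b * n) \<partial>std_gaussian) = gauss (pcompose (hermite k) [:t * x, ?b:])"
      by (simp add: gauss_def poly_pcompose mult.commute)
    then show "(\<integral>n. ?f (x, n) \<partial>std_gaussian) = poly p x * (t ^ k * poly (hermite k) x)"
      using gauss_affine_hermite[OF t, of k x] by simp
  qed
  also have "\<dots> = (\<integral>x. t ^ k * poly (p * hermite k) x \<partial>\<nu>)"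
    by (intro Bochner_Integration.integral_cong) (auto simp: mult_ac)
  also have "\<dots> = t ^ k * (\<integral>x. poly (p * hermite k) x \<partial>\<nu>)" by (rule integral_mult_right_zero)
  finally show ?thesis .
qed

lemma integral_joint_poly:
  assumes t: "0 < t" "t < 1" and N: "degree q \<le> N"
  shows "(\<integral>w. poly p (fst w) * poly q (snd w) \<partial>joint t) =
    (\<Sum>k\<le>N. t ^ k * (\<integral>x. poly (p * hermite k) x \<partial>\<nu>) / fact k * gauss (q * hermite k))"
proof -
  have "(\<integral>w. poly p (fst w) * poly q (snd w) \<partial>joint t) =
      (\<integral>w. (\<Sum>k\<le>N. gauss (q * hermite k) / fact k * (poly p (fst w) * poly (hermite k) (snd w))) \<partial>joint t)"
    by (subst hermite_expansion[OF N]) (simp add: poly_sum sum_distrib_left mult_ac)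
  also have "\<dots> = (\<Sum>k\<le>N. gauss (q * hermite k) / fact k * (t ^ k * (\<integral>x. poly (p * hermite k) x \<partial>\<nu>)))"
    by (subst Bochner_Integration.integral_sum)
       (simp_all only: integrable_mult_right integrable_joint_poly[OF t] integral_mult_right_zero integral_joint_poly_hermite[OF t])
  finally show ?thesis by (simp add: mult_ac)
qed

text \<open>The relation z He_k = He_(k+1) + k He_(k-1), integrated. At k = 0 the truncated
  \<open>k - 1\<close> is harmless, as its factor is 0.\<close>

lemma integral_X_mult_hermite: "(\<integral>x. poly ([:0, 1:] * hermite k) x \<partial>\<nu>) = herm (Suc k) + real k * herm (k - 1)"
proof (cases k)
  case 0
  then show ?thesis by (simp add: herm_def)
next
  case (Suc j)
  have "[:0, 1:] * hermite k = hermite (Suc k) + smult (real k) (hermite (k - 1))"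
    by (simp add: Suc hermite.simps(3))
  then show ?thesis using integrable_poly by (simp add: herm_def del: mult_pCons_left)
qed

text \<open>A weak form of Tweedie's formula: the residual X - t Z tested against q(Z) sees (1 -
  t^2) H. The terms with \<open>herm (k - 1)\<close> cancel after an index shift. The bound
  \<open>N\<close> exceeds the degree of \<open>q\<close> strictly because z q(z) is expanded as
  well.\<close>

lemma integral_joint_residual:
  assumes t: "0 < t" "t < 1" and N: "degree q < N"
  shows "(\<integral>w. (fst w - t * snd w) * poly q (snd w) \<partial>joint t) =
    (1 - t\<^sup>2) * (\<Sum>k\<le>N. t ^ k * herm (Suc k) / fact k * gauss (q * hermite k))"
proof -
  let ?X = "[:0, 1:] :: real poly"
  have i1: "integrable (joint t) (\<lambda>w. poly ?X (fst w) * poly q (snd w))"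
    and i2: "integrable (joint t) (\<lambda>w. poly 1 (fst w) * poly (?X * q) (snd w))"
    by (rule integrable_joint_poly[OF t])+
  have "(\<integral>w. (fst w - t * snd w) * poly q (snd w) \<partial>joint t) =
      (\<integral>w. poly ?X (fst w) * poly q (snd w) - t * (poly 1 (fst w) * poly (?X * q) (snd w)) \<partial>joint t)"
    by (intro Bochner_Integration.integral_cong) (auto simp: algebra_simps)
  also have "\<dots> = (\<integral>w. poly ?X (fst w) * poly q (snd w) \<partial>joint t) - t * (\<integral>w. poly 1 (fst w) * poly (?X * q) (snd w) \<partial>joint t)"
    using i1 i2 by (subst Bochner_Integration.integral_diff) (auto simp del: poly_mult poly_1 poly_pCons mult_pCons_left)
  also have "(\<integral>w. poly ?X (fst w) * poly q (snd w) \<partial>joint t) =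
      (\<Sum>k\<le>N. t ^ k * (herm (Suc k) + real k * herm (k - 1)) / fact k * gauss (q * hermite k))"
    unfolding integral_X_mult_hermite[symmetric] by (rule integral_joint_poly) (use t N in auto)
  also have "(\<integral>w. poly 1 (fst w) * poly (?X * q) (snd w) \<partial>joint t) =
      (\<Sum>k\<le>N. t ^ k * herm k / fact k * gauss ((?X * q) * hermite k))"
  proof -
    have "degree (?X * q) \<le> N" using N degree_mult_le[of ?X q] by simp
    then show ?thesis using integral_joint_poly[OF t, of "?X * q" N 1] by (simp add: herm_def)
  qed
  also have "\<dots> = (\<Sum>k\<le>N. t ^ k * herm k / fact k * (gauss (q * hermite (Suc k)) + real k * gauss (q * hermite (k - 1))))"
  proof (intro sum.cong refl)
    fix k
    have "(?X * q) * hermite k = q * hermite (Suc k) + smult (real k) (q * hermite (k - 1))"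
    proof (cases k)
      case (Suc j)
      then have "?X * hermite k = hermite (Suc k) + smult (real k) (hermite (k - 1))" by (simp add: hermite.simps(3))
      then have "q * (?X * hermite k) = q * hermite (Suc k) + smult (real k) (q * hermite (k - 1))"
        by (simp only: distrib_left mult_smult_right)
      then show ?thesis by (simp only: mult_ac)
    qed simp
    then show "t ^ k * herm k / fact k * gauss ((?X * q) * hermite k) =
        t ^ k * herm k / fact k * (gauss (q * hermite (Suc k)) + real k * gauss (q * hermite (k - 1)))"
      by (simp only: gauss_add gauss_smult)
  qed
  also have "\<dots> = (\<Sum>k\<le>N. t ^ k * herm k / fact k * gauss (q * hermite (Suc k))) +
      (\<Sum>k\<le>N. t ^ k * herm k / fact k * (real k * gauss (q * hermite (k - 1))))"
    by (simp add: sum.distrib algebra_simps)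
  also have "t * \<dots> = (\<Sum>k\<le>N. t ^ k * (real k * herm (k - 1)) / fact k * gauss (q * hermite k)) +
      t\<^sup>2 * (\<Sum>k\<le>N. t ^ k * herm (Suc k) / fact k * gauss (q * hermite k))"
  proof -
    obtain L where L: "N = Suc L" using N by (cases N) auto
    have z: "gauss (q * hermite (Suc N)) = 0" "gauss (q * hermite N) = 0"
      using N by (auto intro!: gauss_mult_hermite_eq_0)
    have "(\<Sum>k\<le>N. t ^ k * (real k * herm (k - 1)) / fact k * gauss (q * hermite k)) =
       (\<Sum>k\<le>L. t ^ Suc k * (real (Suc k) * herm k) / fact (Suc k) * gauss (q * hermite (Suc k)))"
      unfolding L by (subst sum.atMost_Suc_shift) simp
    also have "\<dots> = t * (\<Sum>k\<le>L. t ^ k * herm k / fact k * gauss (q * hermite (Suc k)))"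
      unfolding sum_distrib_left by (intro sum.cong) (auto simp: divide_simps)
    also have "(\<Sum>k\<le>L. t ^ k * herm k / fact k * gauss (q * hermite (Suc k))) = (\<Sum>k\<le>N. t ^ k * herm k / fact k * gauss (q * hermite (Suc k)))"
      using z by (simp add: L)
    finally have 1: "t * (\<Sum>k\<le>N. t ^ k * herm k / fact k * gauss (q * hermite (Suc k))) =
      (\<Sum>k\<le>N. t ^ k * (real k * herm (k - 1)) / fact k * gauss (q * hermite k))" ..
    have "(\<Sum>k\<le>N. t ^ k * herm k / fact k * (real k * gauss (q * hermite (k - 1)))) =
       (\<Sum>k\<le>L. t ^ Suc k * herm (Suc k) / fact (Suc k) * (real (Suc k) * gauss (q * hermite k)))"
      unfolding L by (subst sum.atMost_Suc_shift) simp
    also have "\<dots> = t * (\<Sum>k\<le>L. t ^ k * herm (Suc k) / fact k * gauss (q * hermite k))"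
      unfolding sum_distrib_left by (intro sum.cong) (auto simp: divide_simps)
    also have "(\<Sum>k\<le>L. t ^ k * herm (Suc k) / fact k * gauss (q * hermite k)) = (\<Sum>k\<le>N. t ^ k * herm (Suc k) / fact k * gauss (q * hermite k))"
      using z by (simp add: L)
    finally show ?thesis using 1 by (simp add: power2_eq_square distrib_left)
  qed
  finally show ?thesis by (simp add: algebra_simps sum.distrib add_divide_distrib)
qed

end

section \<open>Truncating products of formal series at finite order\<close>

lemma double_sum_truncation:
  fixes c :: "nat \<Rightarrow> nat \<Rightarrow> real"
  assumes t: "0 \<le> t" "t \<le> 1" and m: "m \<le> A" "m \<le> B"
  shows "\<bar>(\<Sum>k<A. \<Sum>j<B. t ^ (k + j) * c k j) - (\<Sum>n<m. t ^ n * (\<Sum>i\<le>n. c i (n - i)))\<bar> \<le> t ^ m * (\<Sum>k<A. \<Sum>j<B. \<bar>c k j\<bar>)"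
proof -
  let ?T = "{(i, j). i + j < m}" and ?P = "{..<A} \<times> {..<B}"
  let ?g = "\<lambda>(k, j). t ^ (k + j) * c k j"
  have sub: "?T \<subseteq> ?P" using m by auto
  have "(\<Sum>n<m. t ^ n * (\<Sum>i\<le>n. c i (n - i))) = (\<Sum>n<m. \<Sum>i\<le>n. t ^ (i + (n - i)) * c i (n - i))"
    by (simp add: sum_distrib_left)
  also have "\<dots> = (\<Sum>w\<in>?T. ?g w)" by (rule sum.triangle_reindex[symmetric])
  finally have T: "(\<Sum>n<m. t ^ n * (\<Sum>i\<le>n. c i (n - i))) = (\<Sum>w\<in>?T. ?g w)" .
  have P: "(\<Sum>k<A. \<Sum>j<B. t ^ (k + j) * c k j) = (\<Sum>w\<in>?P. ?g w)" by (simp add: sum.cartesian_product)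
  have "(\<Sum>w\<in>?P. ?g w) - (\<Sum>w\<in>?T. ?g w) = (\<Sum>w\<in>?P - ?T. ?g w)"
    by (rule sum_diff[OF _ sub, symmetric]) auto
  also have "\<bar>\<dots>\<bar> \<le> (\<Sum>w\<in>?P - ?T. t ^ m * \<bar>case_prod c w\<bar>)"
  proof (rule order_trans[OF sum_abs], rule sum_mono)
    fix w assume w: "w \<in> ?P - ?T"
    then have "m \<le> fst w + snd w" by auto
    then have "t ^ (fst w + snd w) \<le> t ^ m" using t by (intro power_decreasing) auto
    then show "\<bar>?g w\<bar> \<le> t ^ m * \<bar>case_prod c w\<bar>" using t by (auto simp: split_beta abs_mult mult_right_mono)
  qed
  also have "\<dots> \<le> (\<Sum>w\<in>?P. t ^ m * \<bar>case_prod c w\<bar>)" using t by (intro sum_mono2) auto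
  also have "\<dots> = t ^ m * (\<Sum>k<A. \<Sum>j<B. \<bar>c k j\<bar>)"
    by (simp add: sum.cartesian_product sum_distrib_left split_beta)
  finally show ?thesis unfolding T P .
qed

definition cut_fps :: "nat \<Rightarrow> 'a::zero fps \<Rightarrow> 'a fps" where
  "cut_fps m F = Abs_fps (\<lambda>j. if j < m then F $ j else 0)"

lemma cut_fps_nth: "cut_fps m F $ j = (if j < m then F $ j else 0)"
  by (simp add: cut_fps_def)

lemma fps_minus_cut:
  fixes F :: "'a::comm_ring_1 fps"
  shows "F - cut_fps m F = fps_X ^ m * fps_shift m F"
  by (rule fps_ext) (simp add: cut_fps_nth fps_X_power_mult_nth)

lemma smult_sum_right: "smult c (sum f A) = (\<Sum>i\<in>A. smult c (f i))"
  by (induction A rule: infinite_finite_induct) (auto simp: smult_add_right)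

lemma cut_square_expansion:
  fixes F :: "real poly fps"
  shows "(\<Sum>i<m. smult (t ^ i) (F $ i)) * (\<Sum>j<m. smult (t ^ j) (F $ j)) =
    (\<Sum>l<2 * m. smult (t ^ l) ((cut_fps m F * cut_fps m F) $ l))"
proof -
  let ?c = "\<lambda>i. cut_fps m F $ i"
  have "(\<Sum>l<2 * m. smult (t ^ l) ((cut_fps m F * cut_fps m F) $ l)) = (\<Sum>l<2 * m. \<Sum>i\<le>l. smult (t ^ (i + (l - i))) (?c i * ?c (l - i)))"
    by (simp add: fps_mult_nth smult_sum_right atLeast0AtMost)
  also have "\<dots> = (\<Sum>(i, j)\<in>{(i, j). i + j < 2 * m}. smult (t ^ (i + j)) (?c i * ?c j))"
    by (rule sum.triangle_reindex[symmetric])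
  also have "\<dots> = (\<Sum>(i, j)\<in>{..<m} \<times> {..<m}. smult (t ^ (i + j)) (?c i * ?c j))"
  proof (rule sum.mono_neutral_right)
    have "{(i, j). i + j < 2 * m} \<subseteq> {..<2 * m} \<times> {..<2 * m}" by auto
    then show "finite {(i, j). i + j < 2 * m}" by (rule finite_subset) auto
  qed (auto simp: cut_fps_nth split: if_splits)
  also have "\<dots> = (\<Sum>(i, j)\<in>{..<m} \<times> {..<m}. smult (t ^ i) (F $ i) * smult (t ^ j) (F $ j))"
    by (intro sum.cong) (auto simp: cut_fps_nth power_add mult_ac)
  also have "\<dots> = (\<Sum>i<m. smult (t ^ i) (F $ i)) * (\<Sum>j<m. smult (t ^ j) (F $ j))"
    by (simp add: sum_product sum.cartesian_product)
  finally show ?thesis ..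
qed

text \<open>Completing the square, 2 H K - g K^2 = H q - g (q - K)^2. As q - K starts at t^m,
  cutting at m leaves all orders below 2m intact.\<close>

lemma info_coeff_cut:
  assumes h: "h 0 = 1" and n: "n < 2 * m"
  defines "K \<equiv> cut_fps m (quot_fps h)"
  shows "2 * gauss ((num_fps h * K) $ n) - gauss ((dens_fps h * (K * K)) $ n) = info_coeff h n"
proof -
  let ?q = "quot_fps h" and ?R = "fps_shift m (quot_fps h)"
  have gq: "num_fps h = dens_fps h * ?q" by (simp add: dens_mult_quot h)
  have "num_fps h * K + num_fps h * K - dens_fps h * (K * K) = num_fps h * ?q - dens_fps h * ((?q - K) * (?q - K))"
    unfolding gq by (simp add: algebra_simps)
  also have "dens_fps h * ((?q - K) * (?q - K)) = fps_X ^ (2 * m) * (dens_fps h * (?R * ?R))"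
    unfolding K_def fps_minus_cut by (simp add: mult_ac power_add[symmetric] mult_2)
  finally have "(num_fps h * K + num_fps h * K - dens_fps h * (K * K)) $ n = (num_fps h * ?q) $ n"
    using n by (simp add: fps_X_power_mult_nth)
  then show ?thesis unfolding info_coeff_def
    by (metis (no_types, lifting) fps_add_nth fps_sub_nth gauss_add gauss_diff mult_2)
qed

context standardized
begin

definition approx_quot :: "nat \<Rightarrow> real \<Rightarrow> real poly" where
  "approx_quot m t = (\<Sum>j<m. smult (t ^ j) (quot_fps herm $ j))"

text \<open>The formal posterior mean with the ratio H / g cut at order m.\<close>

definition estimator :: "nat \<Rightarrow> real \<Rightarrow> real poly" where
  "estimator m t = [:0, t:] + smult (1 - t\<^sup>2) (approx_quot m t)"

lemma degree_approx_quot: "degree (approx_quot m t) \<le> m"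
  unfolding approx_quot_def
  by (intro degree_sum_le) (auto intro!: order_trans[OF degree_smult_le] order_trans[OF gradedD(1)[OF graded_quot_fps[of herm, OF herm_0]]])

text \<open>The square is expanded around t Z, where E (X - t Z)^2 = 1 - t^2. The cross term is the
  weak Tweedie formula, and the bound on \<open>N\<close> makes the Hermite sums exhaust both the
  truncated ratio and its square.\<close>

lemma estimator_risk_identity:
  assumes t: "0 < t" "t < 1" and N: "2 * m < N"
  shows "(\<integral>w. (fst w - poly (estimator m t) (snd w))\<^sup>2 \<partial>joint t) = (1 - t\<^sup>2) - (1 - t\<^sup>2)\<^sup>2 *
     (2 * (\<Sum>k\<le>N. t ^ k * gauss (num_fps herm $ k * approx_quot m t))
      - (\<Sum>k\<le>N. t ^ k * gauss (dens_fps herm $ k * (approx_quot m t * approx_quot m t))))"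
proof -
  let ?q = "approx_quot m t" and ?X = "[:0, 1:] :: real poly"
  have deg: "degree ?q < N" "degree (?q * ?q) \<le> N"
    using degree_approx_quot[of m t] degree_mult_le[of ?q ?q] N by linarith+
  have i: "integrable (joint t) (\<lambda>w. (fst w)\<^sup>2)" "integrable (joint t) (\<lambda>w. fst w * snd w)"
    "integrable (joint t) (\<lambda>w. (snd w)\<^sup>2)" "integrable (joint t) (\<lambda>w. fst w * poly ?q (snd w))"
    "integrable (joint t) (\<lambda>w. snd w * poly ?q (snd w))" "integrable (joint t) (\<lambda>w. (poly ?q (snd w))\<^sup>2)"
    using integrable_joint_poly[OF t, of "?X * ?X" 1] integrable_joint_poly[OF t, of ?X ?X]
      integrable_joint_poly[OF t, of 1 "?X * ?X"] integrable_joint_poly[OF t, of ?X ?q]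
      integrable_joint_poly[OF t, of 1 "?X * ?q"] integrable_joint_poly[OF t, of 1 "?q * ?q"]
    by (simp_all add: power2_eq_square)
  have e1: "(\<integral>w. (fst w)\<^sup>2 \<partial>joint t) = 1"
    using integral_joint_poly_hermite[OF t, of "?X * ?X" 0] var_1 by (simp add: power2_eq_square)
  have e2: "(\<integral>w. fst w * snd w \<partial>joint t) = t"
    using integral_joint_poly_hermite[OF t, of ?X 1] var_1 by (simp add: power2_eq_square)
  have e3: "(\<integral>w. (snd w)\<^sup>2 \<partial>joint t) = 1"
  proof -
    interpret joint: prob_space "joint t" by (rule prob_space_joint[OF t])
    have "(\<integral>w. (snd w)\<^sup>2 - 1 \<partial>joint t) = t\<^sup>2 * herm 2"
      using integral_joint_poly_hermite[OF t, of 1 2] by (simp add: hermite_explicit herm_def power2_eq_square)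
    then show ?thesis using i(3) joint.prob_space herm_2 by simp
  qed
  have e4: "(\<integral>w. fst w * poly ?q (snd w) \<partial>joint t) - t * (\<integral>w. snd w * poly ?q (snd w) \<partial>joint t) =
      (1 - t\<^sup>2) * (\<Sum>k\<le>N. t ^ k * gauss (num_fps herm $ k * ?q))"
  proof -
    have "(\<integral>w. fst w * poly ?q (snd w) \<partial>joint t) - t * (\<integral>w. snd w * poly ?q (snd w) \<partial>joint t) =
       (\<integral>w. fst w * poly ?q (snd w) - t * (snd w * poly ?q (snd w)) \<partial>joint t)"
      using i by simp
    also have "\<dots> = (\<integral>w. (fst w - t * snd w) * poly ?q (snd w) \<partial>joint t)"
      by (intro Bochner_Integration.integral_cong) (auto simp: algebra_simps)
    also have "\<dots> = (1 - t\<^sup>2) * (\<Sum>k\<le>N. t ^ k * gauss (num_fps herm $ k * ?q))"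
      unfolding integral_joint_residual[OF t deg(1)] by (simp add: num_fps_def gauss_smult mult_ac)
    finally show ?thesis .
  qed
  have e5: "(\<integral>w. (poly ?q (snd w))\<^sup>2 \<partial>joint t) = (\<Sum>k\<le>N. t ^ k * gauss (dens_fps herm $ k * (?q * ?q)))"
    using integral_joint_poly[OF t deg(2), of 1] by (simp add: power2_eq_square herm_def dens_fps_def gauss_smult mult_ac)
  have "(\<integral>w. (fst w - poly (estimator m t) (snd w))\<^sup>2 \<partial>joint t) =
     (\<integral>w. (fst w)\<^sup>2 - 2 * t * (fst w * snd w) + t\<^sup>2 * (snd w)\<^sup>2 - 2 * (1 - t\<^sup>2) * (fst w * poly ?q (snd w))
        + 2 * (1 - t\<^sup>2) * t * (snd w * poly ?q (snd w)) + (1 - t\<^sup>2)\<^sup>2 * (poly ?q (snd w))\<^sup>2 \<partial>joint t)"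
    by (intro Bochner_Integration.integral_cong) (auto simp: estimator_def power2_eq_square algebra_simps)
  also have "\<dots> = 1 - 2 * t * t + t\<^sup>2 * 1 - 2 * (1 - t\<^sup>2) * (\<integral>w. fst w * poly ?q (snd w) \<partial>joint t)
      + 2 * (1 - t\<^sup>2) * t * (\<integral>w. snd w * poly ?q (snd w) \<partial>joint t) + (1 - t\<^sup>2)\<^sup>2 * (\<integral>w. (poly ?q (snd w))\<^sup>2 \<partial>joint t)"
    using i e1 e2 e3 by simp
  also have "\<dots> = (1 - t\<^sup>2) - 2 * (1 - t\<^sup>2) * ((\<integral>w. fst w * poly ?q (snd w) \<partial>joint t) - t * (\<integral>w. snd w * poly ?q (snd w) \<partial>joint t))
      + (1 - t\<^sup>2)\<^sup>2 * (\<integral>w. (poly ?q (snd w))\<^sup>2 \<partial>joint t)"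
    by (simp add: power2_eq_square algebra_simps)
  finally show ?thesis unfolding e4 e5 by (simp add: power2_eq_square algebra_simps)
qed

lemma estimator_risk_expansion:
  obtains C where "\<And>t. 0 < t \<Longrightarrow> t < 1 \<Longrightarrow>
    \<bar>(\<integral>w. (fst w - poly (estimator m t) (snd w))\<^sup>2 \<partial>joint t) - ((1 - t\<^sup>2) - (1 - t\<^sup>2)\<^sup>2 * (\<Sum>n<2 * m. t ^ n * info_coeff herm n))\<bar> \<le> C * t ^ (2 * m)"
proof -
  define K where "K = cut_fps m (quot_fps herm)"
  define N where "N = 2 * m + 1"
  define c1 where "c1 k j = gauss (num_fps herm $ k * K $ j)" for k j
  define c2 where "c2 k l = gauss (dens_fps herm $ k * (K * K) $ l)" for k l
  define C1 where "C1 = (\<Sum>k<Suc N. \<Sum>j<2 * m. \<bar>c1 k j\<bar>)"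
  define C2 where "C2 = (\<Sum>k<Suc N. \<Sum>j<2 * m. \<bar>c2 k j\<bar>)"
  show ?thesis
  proof (rule that[of "2 * C1 + C2"])
    fix t :: real assume t: "0 < t" "t < 1"
    define S1 where "S1 = (\<Sum>k\<le>N. t ^ k * gauss (num_fps herm $ k * approx_quot m t))"
    define S2 where "S2 = (\<Sum>k\<le>N. t ^ k * gauss (dens_fps herm $ k * (approx_quot m t * approx_quot m t)))"
    have q: "approx_quot m t = (\<Sum>j<2 * m. smult (t ^ j) (K $ j))"
      unfolding approx_quot_def K_def by (rule sum.mono_neutral_cong_left) (auto simp: cut_fps_nth)
    have S1: "S1 = (\<Sum>k<Suc N. \<Sum>j<2 * m. t ^ (k + j) * c1 k j)"
      unfolding S1_def q c1_def by (simp add: lessThan_Suc_atMost sum_distrib_left gauss_sum gauss_smult power_add mult_ac)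
    have qq: "approx_quot m t * approx_quot m t = (\<Sum>l<2 * m. smult (t ^ l) ((K * K) $ l))"
      unfolding approx_quot_def K_def by (rule cut_square_expansion)
    have S2: "S2 = (\<Sum>k<Suc N. \<Sum>j<2 * m. t ^ (k + j) * c2 k j)"
      unfolding S2_def qq c2_def by (simp add: lessThan_Suc_atMost sum_distrib_left gauss_sum gauss_smult power_add mult_ac)
    have b1: "\<bar>S1 - (\<Sum>n<2 * m. t ^ n * gauss ((num_fps herm * K) $ n))\<bar> \<le> t ^ (2 * m) * C1"
      unfolding S1 C1_def fps_mult_nth gauss_sum c1_def[symmetric] atLeast0AtMost
      by (rule double_sum_truncation) (use t in \<open>auto simp: N_def\<close>)
    have b2: "\<bar>S2 - (\<Sum>n<2 * m. t ^ n * gauss ((dens_fps herm * (K * K)) $ n))\<bar> \<le> t ^ (2 * m) * C2"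
      unfolding S2 C2_def fps_mult_nth[of "dens_fps herm"] gauss_sum c2_def[symmetric] atLeast0AtMost
      by (rule double_sum_truncation) (use t in \<open>auto simp: N_def\<close>)
    have sum_eq: "2 * (\<Sum>n<2 * m. t ^ n * gauss ((num_fps herm * K) $ n)) - (\<Sum>n<2 * m. t ^ n * gauss ((dens_fps herm * (K * K)) $ n)) =
      (\<Sum>n<2 * m. t ^ n * info_coeff herm n)"
      unfolding sum_distrib_left sum_subtractf[symmetric]
      by (intro sum.cong refl) (simp add: info_coeff_cut[of herm, OF herm_0, symmetric] K_def algebra_simps)
    have id: "(\<integral>w. (fst w - poly (estimator m t) (snd w))\<^sup>2 \<partial>joint t) = (1 - t\<^sup>2) - (1 - t\<^sup>2)\<^sup>2 * (2 * S1 - S2)"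
      unfolding S1_def S2_def by (rule estimator_risk_identity[OF t]) (simp add: N_def)
    have "\<bar>(\<integral>w. (fst w - poly (estimator m t) (snd w))\<^sup>2 \<partial>joint t) - ((1 - t\<^sup>2) - (1 - t\<^sup>2)\<^sup>2 * (\<Sum>n<2 * m. t ^ n * info_coeff herm n))\<bar>
        = (1 - t\<^sup>2)\<^sup>2 * \<bar>(2 * S1 - S2) - (\<Sum>n<2 * m. t ^ n * info_coeff herm n)\<bar>"
    proof -
      have "(1 - t\<^sup>2) - (1 - t\<^sup>2)\<^sup>2 * (2 * S1 - S2) - ((1 - t\<^sup>2) - (1 - t\<^sup>2)\<^sup>2 * (\<Sum>n<2 * m. t ^ n * info_coeff herm n)) =
        - ((1 - t\<^sup>2)\<^sup>2 * ((2 * S1 - S2) - (\<Sum>n<2 * m. t ^ n * info_coeff herm n)))" by (simp add: algebra_simps)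
      then show ?thesis unfolding id by (simp only: abs_minus_cancel abs_mult) simp
    qed
    also have "\<dots> \<le> 1 * ((2 * C1 + C2) * t ^ (2 * m))"
    proof (rule mult_mono)
      show "(1 - t\<^sup>2)\<^sup>2 \<le> 1" using t by (intro power_le_one) (auto simp: power_le_one)
      show "\<bar>(2 * S1 - S2) - (\<Sum>n<2 * m. t ^ n * info_coeff herm n)\<bar> \<le> (2 * C1 + C2) * t ^ (2 * m)"
        using b1 b2 sum_eq by (simp add: algebra_simps)
    qed auto
    finally show "\<bar>(\<integral>w. (fst w - poly (estimator m t) (snd w))\<^sup>2 \<partial>joint t) - ((1 - t\<^sup>2) - (1 - t\<^sup>2)\<^sup>2 * (\<Sum>n<2 * m. t ^ n * info_coeff herm n))\<bar>
      \<le> (2 * C1 + C2) * t ^ (2 * m)" by simp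
  qed
qed

end

text \<open>From (|z| - 24)^2 \<ge> 0 one gets 1 + |z| \<le> 13 + z^2 / 48, and y^d / d! \<le> exp
  y. The rate 1/48 leaves room for the 1/12 of the Mehler remainder below 1/8.\<close>

lemma affine_power_le_exp: "(1 + \<bar>z\<bar> :: real) ^ d \<le> fact d * exp 13 * exp (z\<^sup>2 / 48)"
proof -
  have "0 \<le> (\<bar>z\<bar> - 24)\<^sup>2" by simp
  then have "1 + \<bar>z\<bar> \<le> 13 + z\<^sup>2 / 48" by (simp add: power2_eq_square algebra_simps)
  moreover have "(1 + \<bar>z\<bar>) ^ d / fact d \<le> exp (1 + \<bar>z\<bar>)"
  proof -
    have s: "(\<lambda>n. (1 + \<bar>z\<bar>) ^ n /\<^sub>R fact n) sums exp (1 + \<bar>z\<bar>)" by (rule exp_converges)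
    have "(\<Sum>n\<in>{d}. (1 + \<bar>z\<bar>) ^ n /\<^sub>R fact n) \<le> exp (1 + \<bar>z\<bar>)"
      using sum_le_suminf[OF sums_summable[OF s], of "{d}"] sums_unique[OF s] by simp
    then show ?thesis by (simp add: field_simps)
  qed
  ultimately have "(1 + \<bar>z\<bar>) ^ d / fact d \<le> exp (13 + z\<^sup>2 / 48)"
    by (meson exp_le_cancel_iff order_trans)
  then have "(1 + \<bar>z\<bar>) ^ d \<le> fact d * exp (13 + z\<^sup>2 / 48)" by (simp add: pos_divide_le_eq mult.commute)
  then show ?thesis unfolding exp_add by (simp add: mult.assoc)
qed

lemma poly_le_exp:
  fixes p :: "real poly"
  obtains K where "K \<ge> 0" "\<And>z. \<bar>poly p z\<bar> \<le> K * exp (z\<^sup>2 / 48)"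
proof
  let ?c = "\<Sum>i\<le>degree p. \<bar>coeff p i\<bar>"
  have c: "?c \<ge> 0" by (intro sum_nonneg) auto
  then show "?c * (fact (degree p) * exp 13) \<ge> 0" by simp
  fix z
  have "\<bar>poly p z\<bar> \<le> ?c * (1 + \<bar>z\<bar>) ^ degree p" by (rule poly_le_affine_power) simp
  also have "\<dots> \<le> ?c * (fact (degree p) * exp 13 * exp (z\<^sup>2 / 48))"
    using c affine_power_le_exp by (intro mult_left_mono) auto
  finally show "\<bar>poly p z\<bar> \<le> ?c * (fact (degree p) * exp 13) * exp (z\<^sup>2 / 48)" by (simp add: mult_ac)
qed

lemma sum_poly_le_exp:
  fixes p :: "'i \<Rightarrow> real poly"
  assumes "finite I"
  obtains K where "K \<ge> 0" "\<And>z. (\<Sum>i\<in>I. \<bar>poly (p i) z\<bar>) \<le> K * exp (z\<^sup>2 / 48)"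
proof -
  have "\<exists>K. K \<ge> 0 \<and> (\<forall>z. \<bar>poly (p i) z\<bar> \<le> K * exp (z\<^sup>2 / 48))" for i using poly_le_exp by metis
  then obtain K where K: "\<And>i. K i \<ge> 0" "\<And>i z. \<bar>poly (p i) z\<bar> \<le> K i * exp (z\<^sup>2 / 48)" by metis
  show ?thesis
  proof (rule that[of "\<Sum>i\<in>I. K i"])
    show "(\<Sum>i\<in>I. \<bar>poly (p i) z\<bar>) \<le> (\<Sum>i\<in>I. K i) * exp (z\<^sup>2 / 48)" for z
      unfolding sum_distrib_right by (intro sum_mono K)
  qed (intro sum_nonneg K)
qed

text \<open>Against the Gaussian density the exponent becomes - z^2 / 8, that of a normal law with
  standard deviation 2. The rate 3/8 collects 2/8 from a squared error and 1/8 from dividing by the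
  marginal.\<close>

lemma integrable_std_gaussian_exp: "integrable std_gaussian (\<lambda>z. exp (3 * z\<^sup>2 / 8))"
proof -
  have "sqrt 8 = 2 * sqrt (2 :: real)" using real_sqrt_mult[of 4 2] by simp
  then have *: "2 * normal_density 0 2 z = std_normal_density z * exp (3 * z\<^sup>2 / 8)" for z
    by (simp add: normal_density_def exp_add[symmetric] real_sqrt_mult field_simps)
  have "integrable lborel (\<lambda>z. 2 * normal_density 0 2 z)" by simp
  then show ?thesis unfolding std_gaussian_def *
    by (subst integrable_density) auto
qed

context standardized
begin

text \<open>Jensen's lower bound made uniform: t^2 / (2 (1 - t^2)) \<le> 1/8 for t \<le> 1/16, and
  exp(-1/8) \<ge> 1/2.\<close>

lemma marginal_ge:
  assumes t: "0 < t" "t \<le> 1 / 16"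
  shows "marginal t z \<ge> exp (- (z\<^sup>2 / 8)) / 2"
proof -
  have t2: "t\<^sup>2 \<le> 1 / 256" using power_mono[OF t(2), of 2] t by (simp add: power2_eq_square)
  have pos: "1 - t\<^sup>2 > 0" "sqrt (1 - t\<^sup>2) \<le> 1" using t2 by auto
  have "t\<^sup>2 / (2 * (1 - t\<^sup>2)) \<le> 1 / 8" using t2 pos by (simp add: field_simps)
  then have "t\<^sup>2 / (2 * (1 - t\<^sup>2)) * (1 + z\<^sup>2) \<le> 1 / 8 * (1 + z\<^sup>2)"
    by (rule mult_right_mono) simp
  then have "- (1 / 8 * (1 + z\<^sup>2)) \<le> - t\<^sup>2 * (1 + z\<^sup>2) / (2 * (1 - t\<^sup>2))" by simp
  then have "- (1 / 8) - z\<^sup>2 / 8 \<le> - t\<^sup>2 * (1 + z\<^sup>2) / (2 * (1 - t\<^sup>2))" by (simp only: distrib_left)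
  then have "exp (- (1 / 8) - z\<^sup>2 / 8) \<le> exp (- t\<^sup>2 * (1 + z\<^sup>2) / (2 * (1 - t\<^sup>2)))"
    by (simp only: exp_le_cancel_iff)
  also have "\<dots> \<le> exp (- t\<^sup>2 * (1 + z\<^sup>2) / (2 * (1 - t\<^sup>2))) / sqrt (1 - t\<^sup>2)"
    using pos by (simp add: field_simps)
  also have "\<dots> \<le> marginal t z" by (rule marginal_lower_bound) (use t in auto)
  finally have "exp (- (1 / 8)) * exp (- (z\<^sup>2 / 8)) \<le> marginal t z" by (simp add: exp_add[symmetric])
  moreover have "exp (- (1 / 8 :: real)) \<ge> 1 / 2" using exp_ge_add_one_self[of "- (1 / 8) :: real"] by linarith
  then have "1 / 2 * exp (- (z\<^sup>2 / 8)) \<le> exp (- (1 / 8)) * exp (- (z\<^sup>2 / 8))"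
    by (rule mult_right_mono) simp
  ultimately show ?thesis by linarith
qed

text \<open>For heavy tails the density is not square integrable, so large \<open>x\<close> must be split off: there the
  Cauchy-Schwarz inequality removes the denominator, while on \<open>S\<close> the lower bound for the marginal is used.\<close>

lemma posterior_error_split:
  fixes c z :: real and S :: "real set"
  assumes t: "0 < t" "t < 1" and [measurable]: "S \<in> sets borel"
  defines "a \<equiv> \<integral>x. (c - x) * mehler t x z * indicator S x \<partial>\<nu>"
  shows "marginal t z * (c - posterior t z)\<^sup>2 \<le>
    2 * a\<^sup>2 / marginal t z + 2 * (\<integral>x. (x - c)\<^sup>2 * indicator (- S) x * mehler t x z \<partial>\<nu>)"
proof -
  let ?k = "\<lambda>x. mehler t x z" and ?I = "indicator (- S) :: real \<Rightarrow> real"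
  define b where "b = (\<integral>x. (c - x) * ?k x * ?I x \<partial>\<nu>)"
  define V where "V = (\<integral>x. (x - c)\<^sup>2 * ?I x * ?k x \<partial>\<nu>)"
  define g where "g = marginal t z"
  have g: "g > 0" unfolding g_def by (rule marginal_pos[OF t])
  have k: "?k x > 0" for x using mehler_pos t by simp
  have i0: "integrable \<nu> ?k" using integrable_times_mehler[OF t, of "\<lambda>_. 1"] by simp
  have i1: "integrable \<nu> (\<lambda>x. x * ?k x)" using integrable_times_mehler[OF t integrable_power[of 1]] by simp
  have ic: "integrable \<nu> (\<lambda>x. (c - x) * ?k x)" using i0 i1 by (simp add: left_diff_distrib)
  have iS: "integrable \<nu> (\<lambda>x. (c - x) * ?k x * indicator S x)" and iI: "integrable \<nu> (\<lambda>x. (c - x) * ?k x * ?I x)"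
    by (rule Bochner_Integration.integrable_bound[OF ic]; auto simp: indicator_def)+
  have iV: "integrable \<nu> (\<lambda>x. (x - c)\<^sup>2 * ?I x * ?k x)"
  proof -
    have "integrable \<nu> (\<lambda>x. poly ([:-c, 1:] * [:-c, 1:]) x * ?k x)"
      by (rule integrable_times_mehler[OF t integrable_poly])
    then have "integrable \<nu> (\<lambda>x. (x - c)\<^sup>2 * ?k x)" by (simp add: power2_eq_square algebra_simps)
    then show ?thesis by (rule Bochner_Integration.integrable_bound) (auto simp: indicator_def)
  qed
  have "g * (c - posterior t z) = (\<integral>x. (c - x) * ?k x \<partial>\<nu>)"
    using g i0 i1 by (simp add: posterior_def g_def marginal_def left_diff_distrib right_diff_distrib)
  also have "\<dots> = (\<integral>x. (c - x) * ?k x * indicator S x + (c - x) * ?k x * ?I x \<partial>\<nu>)"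
    by (intro Bochner_Integration.integral_cong) (auto simp: indicator_def)
  also have "\<dots> = a + b" unfolding a_def b_def using iS iI by simp
  finally have "(g * (c - posterior t z))\<^sup>2 = (a + b)\<^sup>2" by simp
  then have "g * (g * (c - posterior t z)\<^sup>2) = (a + b)\<^sup>2" by (simp add: power2_eq_square mult_ac)
  moreover have "(a + b)\<^sup>2 \<le> 2 * a\<^sup>2 + 2 * b\<^sup>2"
  proof -
    have "0 \<le> (a - b)\<^sup>2" by simp
    then show ?thesis by (simp add: power2_eq_square algebra_simps)
  qed
  moreover have "b\<^sup>2 \<le> g * V"
  proof -
    \<comment> \<open>Cauchy-Schwarz by hand: \<open>b / g\<close> is the mean of (c - x) restricted
      to the complement of \<open>S\<close> under the normalised kernel, so this integral is a
      multiple of a variance.\<close>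
    have "0 \<le> (\<integral>x. (b / g - (c - x) * ?I x)\<^sup>2 * ?k x \<partial>\<nu>)"
      using k by (intro integral_nonneg_AE AE_I2) (simp add: less_imp_le)
    also have "\<dots> = (\<integral>x. (b / g)\<^sup>2 * ?k x - 2 * (b / g) * ((c - x) * ?k x * ?I x) + (x - c)\<^sup>2 * ?I x * ?k x \<partial>\<nu>)"
      by (intro Bochner_Integration.integral_cong) (auto simp: indicator_def power2_eq_square algebra_simps)
    also have "\<dots> = (b / g)\<^sup>2 * g - 2 * (b / g) * b + V"
      using i0 iI iV by (simp add: g_def marginal_def b_def V_def)
    also have "\<dots> = V - b\<^sup>2 / g" using g by (simp add: power2_eq_square)
    finally show ?thesis using g by (simp add: field_simps)
  qed
  ultimately have "g * (g * (c - posterior t z)\<^sup>2) \<le> g * (2 * a\<^sup>2 / g + 2 * V)"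
    using g by (simp add: distrib_left)
  then show ?thesis using g by (simp add: g_def V_def)
qed

text \<open>The posterior mean \<open>c\<close> solves \<open>(\<integral> (c - x) k d\<nu>) = 0\<close>; inserting the truncated Mehler series
  and the truncated quotient leaves only terms of order at least \<open>m\<close> in \<open>t\<close>.\<close>

definition estimator_fps :: "nat \<Rightarrow> real poly fps" where
  "estimator_fps m = fps_X * fps_const [:0, 1:] + (1 - fps_X ^ 2) * cut_fps m (quot_fps herm)"

text \<open>The range m + 2 arises because the cut ratio has orders below m and the factor 1 - t^2
  raises them by at most two.\<close>

lemma poly_estimator:
  "poly (estimator m t) z = (\<Sum>j<m + 2. t ^ j * poly (estimator_fps m $ j) z)"
proof -
  let ?K = "cut_fps m (quot_fps herm)"
  have nth: "estimator_fps m $ j = (if j = 1 then [:0, 1:] else 0) + ?K $ j - (if j < 2 then 0 else ?K $ (j - 2))" for j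
  proof -
    have "estimator_fps m = fps_const [:0, 1:] * fps_X + ?K - fps_X ^ 2 * ?K"
      unfolding estimator_fps_def by (simp add: algebra_simps)
    then show ?thesis by (simp add: fps_X_power_mult_nth)
  qed
  have "(\<Sum>j<m + 2. t ^ j * poly (estimator_fps m $ j) z) =
      (\<Sum>j<m + 2. t ^ j * poly (if j = 1 then [:0, 1:] else 0) z) + (\<Sum>j<m + 2. t ^ j * poly (?K $ j) z)
      - (\<Sum>j<m + 2. t ^ j * poly (if j < 2 then 0 else ?K $ (j - 2)) z)"
    unfolding nth by (simp only: poly_add poly_diff distrib_left right_diff_distrib sum.distrib sum_subtractf)
  also have "(\<Sum>j<m + 2. t ^ j * poly (if j = 1 then [:0, 1:] else 0) z) = (\<Sum>j<m + 2. if j = 1 then t * z else 0)"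
    by (intro sum.cong) auto
  also have "\<dots> = t * z" by simp
  also have "(\<Sum>j<m + 2. t ^ j * poly (?K $ j) z) = poly (approx_quot m t) z"
    unfolding approx_quot_def poly_sum by (rule sum.mono_neutral_cong_right) (auto simp: cut_fps_nth)
  also have "(\<Sum>j<m + 2. t ^ j * poly (if j < 2 then 0 else ?K $ (j - 2)) z) = (\<Sum>j<m. t ^ (j + 2) * poly (?K $ j) z)"
    by (simp add: sum.lessThan_Suc_shift del: sum.lessThan_Suc)
  also have "\<dots> = t\<^sup>2 * poly (approx_quot m t) z"
    unfolding approx_quot_def poly_sum sum_distrib_left by (intro sum.cong) (auto simp: cut_fps_nth power_add power2_eq_square mult_ac)
  finally show ?thesis by (simp add: estimator_def algebra_simps)
qed

text \<open>The right side is the formal coefficient of t^n in the integral of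
  \<open>x * mehler t x z\<close>, so this is the normal equation of the posterior mean. The part of
  the ratio that was cut off carries t^m and stays invisible.\<close>

lemma dens_mult_estimator:
  assumes "n < m"
  shows "(dens_fps herm * estimator_fps m) $ n =
    smult ((herm (Suc n) + real n * herm (n - 1)) / fact n) (hermite n)"
proof -
  let ?g = "dens_fps herm" and ?q = "quot_fps herm" and ?K = "cut_fps m (quot_fps herm)"
  have "?g * estimator_fps m = fps_const [:0, 1:] * (fps_X * ?g) + (1 - fps_X ^ 2) * num_fps herm
      - fps_X ^ m * ((1 - fps_X ^ 2) * (?g * fps_shift m ?q))"
  proof -
    have K: "?K = ?q - fps_X ^ m * fps_shift m ?q" using fps_minus_cut[of ?q m] by (simp add: algebra_simps)
    show ?thesis unfolding estimator_fps_def dens_mult_quot[of herm, OF herm_0, symmetric] K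
      by (simp add: algebra_simps)
  qed
  also have "\<dots> = fps_const [:0, 1:] * (fps_X ^ 1 * ?g) + (num_fps herm - fps_X ^ 2 * num_fps herm)
      - fps_X ^ m * ((1 - fps_X ^ 2) * (?g * fps_shift m ?q))" by (simp add: algebra_simps)
  finally have "(?g * estimator_fps m) $ n = [:0, 1:] * (if n < 1 then 0 else ?g $ (n - 1))
      + (num_fps herm $ n - (if n < 2 then 0 else num_fps herm $ (n - 2)))"
    using assms by (simp only: fps_add_nth fps_sub_nth fps_mult_left_const_nth fps_X_power_mult_nth) auto
  also have "\<dots> = smult ((herm (Suc n) + real n * herm (n - 1)) / fact n) (hermite n)"
  proof -
    consider "n = 0" | "n = 1" | j where "n = Suc (Suc j)" by (metis One_nat_def not0_implies_Suc)
    then show ?thesis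
    proof cases
      case 3
      define Y where "Y = [:0, 1:] * hermite (Suc j)"
      define F where "F = (fact j :: real)"
      have F: "fact (Suc j) = real (Suc j) * F" "fact (Suc (Suc j)) = real (Suc (Suc j)) * (real (Suc j) * F)" "F \<noteq> 0"
        by (simp_all add: F_def)
      have H: "hermite n = Y - smult (real (Suc j)) (hermite j)" by (simp add: 3 Y_def hermite.simps(3))
      have "[:0, 1:] * (if n < 1 then 0 else ?g $ (n - 1)) = smult (herm (Suc j) / fact (Suc j)) Y"
        unfolding Y_def by (simp add: 3 dens_fps_def)
      then show ?thesis
        unfolding num_fps_def hermite_fps_nth H
        by (intro poly_eqI) (simp add: 3 F F_def[symmetric] field_simps del: fact_Suc of_nat_Suc mult_pCons_left)
    qed (auto simp: dens_fps_def num_fps_def herm_0 smult_add_left add_divide_distrib)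
  qed
  finally show ?thesis .
qed

end

lemma integral_abs_le:
  fixes f g :: "'a \<Rightarrow> real"
  assumes "integrable M f" "integrable M g" "\<And>x. \<bar>f x\<bar> \<le> g x"
  shows "\<bar>\<integral>x. f x \<partial>M\<bar> \<le> (\<integral>x. g x \<partial>M)"
proof -
  have "\<bar>\<integral>x. f x \<partial>M\<bar> \<le> (\<integral>x. \<bar>f x\<bar> \<partial>M)" by (rule integral_abs_bound)
  also have "\<dots> \<le> (\<integral>x. g x \<partial>M)" using assms by (intro integral_mono) auto
  finally show ?thesis .
qed

context standardized
begin

lemma estimator_le_exp:
  obtains K where "K \<ge> 0" "\<And>t z. 0 < t \<Longrightarrow> t < 1 \<Longrightarrow> \<bar>poly (estimator m t) z\<bar> + 1 \<le> K * exp (z\<^sup>2 / 48)"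
proof -
  obtain K where K: "K \<ge> 0" "\<And>z. (\<Sum>j<m + 2. \<bar>poly (estimator_fps m $ j) z\<bar>) \<le> K * exp (z\<^sup>2 / 48)"
    by (rule sum_poly_le_exp[of "{..<m + 2}" "\<lambda>j. estimator_fps m $ j"]) auto
  show ?thesis
  proof (rule that[of "K + 1"])
    fix t z :: real assume t: "0 < t" "t < 1"
    have "\<bar>poly (estimator m t) z\<bar> \<le> (\<Sum>j<m + 2. \<bar>t ^ j * poly (estimator_fps m $ j) z\<bar>)"
      unfolding poly_estimator by (rule sum_abs)
    also have "\<dots> \<le> (\<Sum>j<m + 2. \<bar>poly (estimator_fps m $ j) z\<bar>)"
      using t by (intro sum_mono) (auto simp: abs_mult power_le_one intro!: mult_left_le_one_le)
    also have "\<dots> \<le> K * exp (z\<^sup>2 / 48)" by (rule K)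
    finally have "\<bar>poly (estimator m t) z\<bar> \<le> K * exp (z\<^sup>2 / 48)" .
    moreover have "1 \<le> exp (z\<^sup>2 / 48)" by simp
    ultimately show "\<bar>poly (estimator m t) z\<bar> + 1 \<le> (K + 1) * exp (z\<^sup>2 / 48)"
      unfolding distrib_right by linarith
  qed (use K in auto)
qed

text \<open>The exponential bound serves integrals against the Gaussian; under
  \<open>joint t\<close> only moments are controlled, so there the growth must be
  polynomial.\<close>

lemma estimator_le_affine_power:
  obtains K where "K \<ge> 0" "\<And>t z. 0 < t \<Longrightarrow> t < 1 \<Longrightarrow> \<bar>poly (estimator m t) z\<bar> + 1 \<le> K * (1 + \<bar>z\<bar>) ^ (m + 1)"
proof -
  define c where "c j = (\<Sum>i\<le>degree (quot_fps herm $ j). \<bar>coeff (quot_fps herm $ j) i\<bar>)" for j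
  have c: "c j \<ge> 0" for j unfolding c_def by (intro sum_nonneg) auto
  have q: "\<bar>poly (quot_fps herm $ j) z\<bar> \<le> c j * (1 + \<bar>z\<bar>) ^ (m + 1)" if "j < m" for j z
    unfolding c_def using gradedD(1)[OF graded_quot_fps[of herm, OF herm_0], of j] that
    by (intro poly_le_affine_power) auto
  show ?thesis
  proof (rule that[of "2 + (\<Sum>j<m. c j)"])
    fix t z :: real assume t: "0 < t" "t < 1"
    let ?w = "(1 + \<bar>z\<bar>) ^ (m + 1)"
    have w: "1 + \<bar>z\<bar> \<le> ?w" using power_increasing[of 1 "m + 1" "1 + \<bar>z\<bar>"] by simp
    have "\<bar>poly (approx_quot m t) z\<bar> \<le> (\<Sum>j<m. \<bar>t ^ j * poly (quot_fps herm $ j) z\<bar>)"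
      unfolding approx_quot_def poly_sum poly_smult by (rule sum_abs)
    also have "\<dots> \<le> (\<Sum>j<m. c j * ?w)"
    proof (rule sum_mono)
      fix j assume "j \<in> {..<m}"
      then have "\<bar>poly (quot_fps herm $ j) z\<bar> \<le> c j * ?w" using q by auto
      moreover have "\<bar>t ^ j * poly (quot_fps herm $ j) z\<bar> \<le> \<bar>poly (quot_fps herm $ j) z\<bar>"
        using t by (auto simp: abs_mult power_le_one intro!: mult_left_le_one_le)
      ultimately show "\<bar>t ^ j * poly (quot_fps herm $ j) z\<bar> \<le> c j * ?w" by linarith
    qed
    finally have Q: "\<bar>poly (approx_quot m t) z\<bar> \<le> (\<Sum>j<m. c j) * ?w" by (simp add: sum_distrib_right)
    have "\<bar>1 - t\<^sup>2\<bar> \<le> 1" using t by (simp add: power_le_one)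
    then have "\<bar>(1 - t\<^sup>2) * poly (approx_quot m t) z\<bar> \<le> \<bar>poly (approx_quot m t) z\<bar>"
      unfolding abs_mult by (intro mult_left_le_one_le) auto
    moreover have "\<bar>t * z\<bar> \<le> \<bar>z\<bar>" using t by (auto simp: abs_mult intro!: mult_left_le_one_le)
    moreover have "poly (estimator m t) z = t * z + (1 - t\<^sup>2) * poly (approx_quot m t) z"
      by (simp add: estimator_def)
    ultimately have "\<bar>poly (estimator m t) z\<bar> \<le> \<bar>z\<bar> + (\<Sum>j<m. c j) * ?w" using Q by linarith
    then show "\<bar>poly (estimator m t) z\<bar> + 1 \<le> (2 + (\<Sum>j<m. c j)) * ?w"
      unfolding distrib_right[of 2] using w by linarith
  qed (simp add: add_nonneg_nonneg sum_nonneg c)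
qed

lemma mehler_terms_le:
  obtains K where "K \<ge> 0" "\<And>t x z. 0 < t \<Longrightarrow> t < 1 \<Longrightarrow>
    \<bar>\<Sum>k<m. t ^ k * mehler_term x z k\<bar> \<le> K * exp (z\<^sup>2 / 48) * (1 + \<bar>x\<bar>) ^ m"
proof -
  define c where "c k = (\<Sum>i\<le>degree (hermite k). \<bar>coeff (hermite k) i\<bar>)" for k
  have c: "c k \<ge> 0" for k unfolding c_def by (intro sum_nonneg) auto
  obtain K where K: "K \<ge> 0" "\<And>z. (\<Sum>k<m. \<bar>poly (smult (c k) (hermite k)) z\<bar>) \<le> K * exp (z\<^sup>2 / 48)"
    by (rule sum_poly_le_exp[of "{..<m}" "\<lambda>k. smult (c k) (hermite k)"]) auto
  show ?thesis
  proof (rule that[OF K(1)])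
    fix t x z :: real assume t: "0 < t" "t < 1"
    have "\<bar>t ^ k * mehler_term x z k\<bar> \<le> \<bar>poly (smult (c k) (hermite k)) z\<bar> * (1 + \<bar>x\<bar>) ^ m" if "k < m" for k
    proof -
      have "\<bar>poly (hermite k) x\<bar> \<le> c k * (1 + \<bar>x\<bar>) ^ m"
        unfolding c_def using degree_hermite_le[of k] that by (intro poly_le_affine_power) auto
      then have "\<bar>poly (hermite k) x\<bar> * \<bar>poly (hermite k) z\<bar> \<le> (c k * (1 + \<bar>x\<bar>) ^ m) * \<bar>poly (hermite k) z\<bar>"
        by (rule mult_right_mono) simp
      then have "\<bar>poly (hermite k) x * poly (hermite k) z\<bar> \<le> \<bar>poly (smult (c k) (hermite k)) z\<bar> * (1 + \<bar>x\<bar>) ^ m"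
        using c[of k] by (simp add: abs_mult mult_ac)
      moreover have "\<bar>t ^ k * mehler_term x z k\<bar> \<le> \<bar>poly (hermite k) x * poly (hermite k) z\<bar>"
      proof -
        have "\<bar>t ^ k * mehler_term x z k\<bar> = (t ^ k / fact k) * \<bar>poly (hermite k) x * poly (hermite k) z\<bar>"
          using t by (simp add: mehler_term_def abs_mult)
        also have "\<dots> \<le> \<bar>poly (hermite k) x * poly (hermite k) z\<bar>"
        proof (rule mult_left_le_one_le)
          have "t ^ k \<le> 1" using t by (simp add: power_le_one)
          then have "t ^ k \<le> fact k" using fact_ge_1 by (rule order_trans)
          then show "t ^ k / fact k \<le> 1" by (simp add: divide_le_eq)
        qed (use t in auto)
        finally show ?thesis .
      qed
      ultimately show ?thesis by linarith
    qed
    then have "(\<Sum>k<m. \<bar>t ^ k * mehler_term x z k\<bar>) \<le> (\<Sum>k<m. \<bar>poly (smult (c k) (hermite k)) z\<bar> * (1 + \<bar>x\<bar>) ^ m)"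
      by (intro sum_mono) auto
    then have "\<bar>\<Sum>k<m. t ^ k * mehler_term x z k\<bar> \<le> (\<Sum>k<m. \<bar>poly (smult (c k) (hermite k)) z\<bar>) * (1 + \<bar>x\<bar>) ^ m"
      unfolding sum_distrib_right by (rule order_trans[OF sum_abs])
    also have "\<dots> \<le> K * exp (z\<^sup>2 / 48) * (1 + \<bar>x\<bar>) ^ m" by (intro mult_right_mono K) auto
    finally show "\<bar>\<Sum>k<m. t ^ k * mehler_term x z k\<bar> \<le> K * exp (z\<^sup>2 / 48) * (1 + \<bar>x\<bar>) ^ m" .
  qed
qed

lemma truncated_normal_equation:
  obtains K where "K \<ge> 0" "\<And>t z. 0 < t \<Longrightarrow> t < 1 \<Longrightarrow>
    \<bar>\<integral>x. (poly (estimator m t) z - x) * (\<Sum>k<m. t ^ k * mehler_term x z k) \<partial>\<nu>\<bar> \<le> K * exp (z\<^sup>2 / 48) * t ^ m"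
    "\<And>t z. integrable \<nu> (\<lambda>x. (poly (estimator m t) z - x) * (\<Sum>k<m. t ^ k * mehler_term x z k))"
proof -
  let ?g = "\<lambda>k. dens_fps herm $ k" and ?e = "\<lambda>j. estimator_fps m $ j"
  obtain K where K: "K \<ge> 0" "\<And>z. (\<Sum>(k, j)\<in>{..<m} \<times> {..<m + 2}. \<bar>poly (?g k * ?e j) z\<bar>) \<le> K * exp (z\<^sup>2 / 48)"
    using sum_poly_le_exp[of "{..<m} \<times> {..<m + 2}" "\<lambda>(k, j). ?g k * ?e j"] by (auto simp: split_beta)
  show ?thesis
  proof (rule that[OF K(1)])
    fix t z :: real
    define p where "p = poly (estimator m t) z"
    have eq: "(\<lambda>x. (p - x) * (\<Sum>k<m. t ^ k * mehler_term x z k)) =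
      (\<lambda>x. \<Sum>k<m. t ^ k * poly (hermite k) z / fact k * (p * poly (hermite k) x - poly ([:0, 1:] * hermite k) x))"
      by (rule ext) (simp add: sum_distrib_left mehler_term_def algebra_simps diff_divide_distrib)
    have int: "integrable \<nu> (\<lambda>x. p * poly (hermite k) x - poly ([:0, 1:] * hermite k) x)" for k
      by (intro Bochner_Integration.integrable_diff integrable_mult_right integrable_poly)
    show "integrable \<nu> (\<lambda>x. (poly (estimator m t) z - x) * (\<Sum>k<m. t ^ k * mehler_term x z k))"
      unfolding p_def[symmetric] eq by (intro Bochner_Integration.integrable_sum integrable_mult_right int)
    assume t: "0 < t" "t < 1"
    have "(\<integral>x. (p - x) * (\<Sum>k<m. t ^ k * mehler_term x z k) \<partial>\<nu>) =
        (\<Sum>k<m. t ^ k * poly (hermite k) z / fact k * (p * herm k - (herm (Suc k) + real k * herm (k - 1))))"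
    proof -
      have "(\<integral>x. p * poly (hermite k) x - poly ([:0, 1:] * hermite k) x \<partial>\<nu>) = p * herm k - (herm (Suc k) + real k * herm (k - 1))" for k
        unfolding integral_X_mult_hermite[symmetric] unfolding herm_def
        by (subst Bochner_Integration.integral_diff) (auto intro!: integrable_poly integrable_mult_right simp del: poly_mult poly_pCons mult_pCons_left)
      then show ?thesis unfolding eq
        by (subst Bochner_Integration.integral_sum) (simp_all only: integrable_mult_right int integral_mult_right_zero)
    qed
    \<comment> \<open>By the formal normal equation the difference compares the full product of the
      two truncated series with its Cauchy product below order m, which is what
      \<open>double_sum_truncation\<close> estimates.\<close>
    also have "\<dots> = p * (\<Sum>k<m. t ^ k * poly (?g k) z) - (\<Sum>k<m. t ^ k * poly ((dens_fps herm * estimator_fps m) $ k) z)"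
    proof -
      have "(\<Sum>k<m. t ^ k * poly ((dens_fps herm * estimator_fps m) $ k) z) =
          (\<Sum>k<m. t ^ k * poly (hermite k) z / fact k * (herm (Suc k) + real k * herm (k - 1)))"
        by (intro sum.cong refl) (simp add: dens_mult_estimator)
      moreover have "p * (\<Sum>k<m. t ^ k * poly (?g k) z) = (\<Sum>k<m. t ^ k * poly (hermite k) z / fact k * (p * herm k))"
        unfolding sum_distrib_left by (intro sum.cong refl) (simp add: dens_fps_def)
      ultimately show ?thesis by (simp add: sum_subtractf right_diff_distrib)
    qed
    also have "p * (\<Sum>k<m. t ^ k * poly (?g k) z) = (\<Sum>k<m. \<Sum>j<m + 2. t ^ (k + j) * poly (?g k * ?e j) z)"
      unfolding p_def poly_estimator
      by (subst mult.commute, subst sum_product) (simp add: power_add mult_ac)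
    also have "(\<Sum>k<m. t ^ k * poly ((dens_fps herm * estimator_fps m) $ k) z) = (\<Sum>n<m. t ^ n * (\<Sum>i\<le>n. poly (?g i * ?e (n - i)) z))"
      by (simp add: fps_mult_nth poly_sum atLeast0AtMost)
    finally have I: "(\<integral>x. (p - x) * (\<Sum>k<m. t ^ k * mehler_term x z k) \<partial>\<nu>) =
      (\<Sum>k<m. \<Sum>j<m + 2. t ^ (k + j) * poly (?g k * ?e j) z) - (\<Sum>n<m. t ^ n * (\<Sum>i\<le>n. poly (?g i * ?e (n - i)) z))" .
    have "\<bar>\<integral>x. (p - x) * (\<Sum>k<m. t ^ k * mehler_term x z k) \<partial>\<nu>\<bar> \<le> t ^ m * (\<Sum>k<m. \<Sum>j<m + 2. \<bar>poly (?g k * ?e j) z\<bar>)"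
      unfolding I by (rule double_sum_truncation) (use t in auto)
    also have "\<dots> \<le> t ^ m * (K * exp (z\<^sup>2 / 48))"
      using K(2)[of z] t by (intro mult_left_mono) (auto simp only: sum.cartesian_product zero_le_power less_imp_le)
    finally show "\<bar>\<integral>x. (poly (estimator m t) z - x) * (\<Sum>k<m. t ^ k * mehler_term x z k) \<partial>\<nu>\<bar> \<le> K * exp (z\<^sup>2 / 48) * t ^ m"
      by (simp add: p_def mult_ac)
  qed
qed

end

section \<open>Distance between the polynomial estimator and the posterior mean\<close>

context standardized
begin

text \<open>Three errors, each of order t^m: replacing the kernel by its truncation on
  \<open>S\<close>, the normal equation of the truncated kernel on the whole line, and the part of
  that kernel off \<open>S\<close>, where 1 \<le> 16 t (1 + |x|) supplies the missing powers of
  t.\<close>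

lemma small_part_bound:
  obtains C where "C \<ge> 0" "\<And>t z. 0 < t \<Longrightarrow> t \<le> 1 / 16 \<Longrightarrow>
    \<bar>\<integral>x. (poly (estimator m t) z - x) * mehler t x z * indicator {x. t * (1 + \<bar>x\<bar>) \<le> 1 / 16} x \<partial>\<nu>\<bar> \<le> C * exp (z\<^sup>2 / 8) * t ^ m"
proof -
  obtain K1 where K1: "K1 \<ge> 0" "\<And>t z. 0 < t \<Longrightarrow> t < 1 \<Longrightarrow> \<bar>poly (estimator m t) z\<bar> + 1 \<le> K1 * exp (z\<^sup>2 / 48)"
    by (rule estimator_le_exp[where m = m]) blast
  obtain K2 where K2: "K2 \<ge> 0" "\<And>t x z. 0 < t \<Longrightarrow> t < 1 \<Longrightarrow>
    \<bar>\<Sum>k<m. t ^ k * mehler_term x z k\<bar> \<le> K2 * exp (z\<^sup>2 / 48) * (1 + \<bar>x\<bar>) ^ m"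
    by (rule mehler_terms_le[where m = m]) blast
  obtain K3 where K3: "K3 \<ge> 0" "\<And>t z. 0 < t \<Longrightarrow> t < 1 \<Longrightarrow>
    \<bar>\<integral>x. (poly (estimator m t) z - x) * (\<Sum>k<m. t ^ k * mehler_term x z k) \<partial>\<nu>\<bar> \<le> K3 * exp (z\<^sup>2 / 48) * t ^ m"
    "\<And>t z. integrable \<nu> (\<lambda>x. (poly (estimator m t) z - x) * (\<Sum>k<m. t ^ k * mehler_term x z k))"
    by (rule truncated_normal_equation[where m = m]) blast
  define M1 where "M1 = (\<integral>x. (1 + \<bar>x\<bar>) ^ (m + 1) \<partial>\<nu>)"
  define M2 where "M2 = (\<integral>x. (1 + \<bar>x\<bar>) ^ (2 * m + 1) \<partial>\<nu>)"
  have M12: "M1 \<ge> 0" "M2 \<ge> 0" unfolding M1_def M2_def by (auto intro!: integral_nonneg_AE)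
  show ?thesis
  proof (rule that[of "K1 * 4 * 8 ^ m * M1 + K3 + K1 * K2 * 16 ^ m * M2"])
    show "0 \<le> K1 * 4 * 8 ^ m * M1 + K3 + K1 * K2 * 16 ^ m * M2" using K1 K2 K3 M12 by simp
    fix t z :: real assume t: "0 < t" "t \<le> 1 / 16"
    then have t1: "t < 1" by simp
    define S where "S = {x::real. t * (1 + \<bar>x\<bar>) \<le> 1 / 16}"
    have [measurable]: "S \<in> sets borel" unfolding S_def by measurable
    define p where "p = poly (estimator m t) z"
    define E where "E = exp (z\<^sup>2 / 48)"
    \<comment> \<open>The exponents add up to 5/48 and 2/48, both below 1/8.\<close>
    have E: "E \<ge> 1" "E * exp (z\<^sup>2 / 12) \<le> exp (z\<^sup>2 / 8)" "E * E \<le> exp (z\<^sup>2 / 8)" "E \<le> exp (z\<^sup>2 / 8)"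
      unfolding E_def by (simp_all add: exp_add[symmetric])
    let ?k = "\<lambda>x. mehler t x z" and ?km = "\<lambda>x. \<Sum>k<m. t ^ k * mehler_term x z k"
    have pb: "\<bar>p - x\<bar> \<le> K1 * E * (1 + \<bar>x\<bar>)" for x
    proof -
      have b: "\<bar>p\<bar> + 1 \<le> K1 * E" using K1(2)[OF t(1) t1, of z] by (simp add: p_def E_def)
      have "\<bar>p - x\<bar> \<le> \<bar>p\<bar> + \<bar>x\<bar>" by linarith
      also have "\<dots> \<le> (\<bar>p\<bar> + 1) * (1 + \<bar>x\<bar>)" by (simp add: algebra_simps)
      also have "\<dots> \<le> K1 * E * (1 + \<bar>x\<bar>)" using b by (intro mult_right_mono) auto
      finally show ?thesis .
    qed
    have i3: "integrable \<nu> (\<lambda>x. (p - x) * ?km x)" unfolding p_def by (rule K3)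
    have km [measurable]: "?km \<in> borel_measurable borel" unfolding mehler_term_def by measurable
    have i1: "integrable \<nu> (\<lambda>x. (p - x) * ?k x * indicator S x)"
    proof -
      have "integrable \<nu> (\<lambda>x. poly [:p, -1:] x * ?k x)" by (rule integrable_times_mehler[OF t(1) t1 integrable_poly])
      then have "integrable \<nu> (\<lambda>x. (p - x) * ?k x)" by simp
      then show ?thesis by (rule Bochner_Integration.integrable_bound) (auto simp: indicator_def)
    qed
    have i3S: "integrable \<nu> (\<lambda>x. (p - x) * ?km x * indicator S x)" and i4: "integrable \<nu> (\<lambda>x. (p - x) * ?km x * indicator (- S) x)"
      by (rule Bochner_Integration.integrable_bound[OF i3]; auto simp: indicator_def)+
    have i2: "integrable \<nu> (\<lambda>x. (p - x) * (?k x - ?km x) * indicator S x)"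
      using Bochner_Integration.integrable_diff[OF i1 i3S] by (simp add: algebra_simps)
    have "(\<integral>x. (p - x) * ?k x * indicator S x \<partial>\<nu>) =
        (\<integral>x. (p - x) * (?k x - ?km x) * indicator S x + (p - x) * ?km x - (p - x) * ?km x * indicator (- S) x \<partial>\<nu>)"
      by (intro Bochner_Integration.integral_cong) (auto simp: indicator_def algebra_simps)
    also have "\<dots> = (\<integral>x. (p - x) * (?k x - ?km x) * indicator S x \<partial>\<nu>) + (\<integral>x. (p - x) * ?km x \<partial>\<nu>)
        - (\<integral>x. (p - x) * ?km x * indicator (- S) x \<partial>\<nu>)"
      using i2 i3 i4 by simp
    finally have split: "(\<integral>x. (p - x) * ?k x * indicator S x \<partial>\<nu>) = \<dots>" .
    have b2: "\<bar>\<integral>x. (p - x) * (?k x - ?km x) * indicator S x \<partial>\<nu>\<bar> \<le> K1 * 4 * 8 ^ m * M1 * exp (z\<^sup>2 / 8) * t ^ m"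
    proof -
      have "\<bar>\<integral>x. (p - x) * (?k x - ?km x) * indicator S x \<partial>\<nu>\<bar> \<le>
          (\<integral>x. (K1 * E * 4 * exp (z\<^sup>2 / 12) * 8 ^ m * t ^ m) * (1 + \<bar>x\<bar>) ^ (m + 1) \<partial>\<nu>)"
      proof (rule integral_abs_le[OF i2])
        show "integrable \<nu> (\<lambda>x. (K1 * E * 4 * exp (z\<^sup>2 / 12) * 8 ^ m * t ^ m) * (1 + \<bar>x\<bar>) ^ (m + 1))"
          by (intro integrable_mult_right integrable_affine_power)
        fix x
        show "\<bar>(p - x) * (?k x - ?km x) * indicator S x\<bar> \<le> (K1 * E * 4 * exp (z\<^sup>2 / 12) * 8 ^ m * t ^ m) * (1 + \<bar>x\<bar>) ^ (m + 1)"
        proof (cases "x \<in> S")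
          case True
          then have "\<bar>?k x - ?km x\<bar> \<le> 4 * exp (z\<^sup>2 / 12) * (8 * t * (1 + \<bar>x\<bar>)) ^ m"
            using t by (intro mehler_expansion) (auto simp: S_def)
          then have "\<bar>p - x\<bar> * \<bar>?k x - ?km x\<bar> \<le> (K1 * E * (1 + \<bar>x\<bar>)) * (4 * exp (z\<^sup>2 / 12) * (8 * t * (1 + \<bar>x\<bar>)) ^ m)"
            using K1(1) E(1) by (intro mult_mono pb) auto
          also have "\<dots> = (K1 * E * 4 * exp (z\<^sup>2 / 12) * 8 ^ m * t ^ m) * (1 + \<bar>x\<bar>) ^ (m + 1)"
            by (simp only: power_mult_distrib power_add power_one_right mult_ac)
          finally show ?thesis using True by (simp only: abs_mult indicator_simps abs_one mult_1_right)
        qed (use K1(1) E(1) t in auto)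
      qed
      also have "\<dots> = (E * exp (z\<^sup>2 / 12)) * (K1 * 4 * 8 ^ m * t ^ m * M1)"
        unfolding M1_def integral_mult_right_zero by (simp only: mult_ac)
      also have "\<dots> \<le> exp (z\<^sup>2 / 8) * (K1 * 4 * 8 ^ m * t ^ m * M1)"
        using E(2) K1(1) M12 t by (intro mult_right_mono) auto
      finally show ?thesis by (simp only: mult_ac)
    qed
    have b3: "\<bar>\<integral>x. (p - x) * ?km x \<partial>\<nu>\<bar> \<le> K3 * exp (z\<^sup>2 / 8) * t ^ m"
    proof -
      have "\<bar>\<integral>x. (p - x) * ?km x \<partial>\<nu>\<bar> \<le> K3 * E * t ^ m" unfolding p_def E_def by (rule K3(2)[OF t(1) t1])
      also have "\<dots> \<le> K3 * exp (z\<^sup>2 / 8) * t ^ m" using E(4) K3(1) t by (intro mult_right_mono mult_left_mono) auto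
      finally show ?thesis .
    qed
    have b4: "\<bar>\<integral>x. (p - x) * ?km x * indicator (- S) x \<partial>\<nu>\<bar> \<le> K1 * K2 * 16 ^ m * M2 * exp (z\<^sup>2 / 8) * t ^ m"
    proof -
      have "\<bar>\<integral>x. (p - x) * ?km x * indicator (- S) x \<partial>\<nu>\<bar> \<le>
          (\<integral>x. (K1 * E * K2 * E * 16 ^ m * t ^ m) * (1 + \<bar>x\<bar>) ^ (2 * m + 1) \<partial>\<nu>)"
      proof (rule integral_abs_le[OF i4])
        show "integrable \<nu> (\<lambda>x. (K1 * E * K2 * E * 16 ^ m * t ^ m) * (1 + \<bar>x\<bar>) ^ (2 * m + 1))"
          by (intro integrable_mult_right integrable_affine_power)
        fix x
        show "\<bar>(p - x) * ?km x * indicator (- S) x\<bar> \<le> (K1 * E * K2 * E * 16 ^ m * t ^ m) * (1 + \<bar>x\<bar>) ^ (2 * m + 1)"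
        proof (cases "x \<in> S")
          case False
          then have "1 \<le> 16 * t * (1 + \<bar>x\<bar>)" by (simp add: S_def)
          then have one: "1 \<le> (16 * t * (1 + \<bar>x\<bar>)) ^ m" by (rule one_le_power)
          have "\<bar>p - x\<bar> * \<bar>?km x\<bar> \<le> (K1 * E * (1 + \<bar>x\<bar>)) * (K2 * E * (1 + \<bar>x\<bar>) ^ m)"
            using K1(1) K2(1) E(1) K2(2)[OF t(1) t1, of x z] by (intro mult_mono pb) (auto simp: E_def)
          also have "\<dots> \<le> (K1 * E * (1 + \<bar>x\<bar>)) * (K2 * E * (1 + \<bar>x\<bar>) ^ m) * (16 * t * (1 + \<bar>x\<bar>)) ^ m"
            using mult_left_mono[OF one, of "(K1 * E * (1 + \<bar>x\<bar>)) * (K2 * E * (1 + \<bar>x\<bar>) ^ m)"] K1(1) K2(1) E(1) by simp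
          also have "\<dots> = (K1 * E * K2 * E * 16 ^ m * t ^ m) * (1 + \<bar>x\<bar>) ^ (2 * m + 1)"
            by (simp only: power_mult_distrib power_add power_one_right mult_2) (simp only: mult_ac)
          finally have "\<bar>p - x\<bar> * \<bar>?km x\<bar> \<le> (K1 * E * K2 * E * 16 ^ m * t ^ m) * (1 + \<bar>x\<bar>) ^ (2 * m + 1)" .
          moreover have "x \<in> - S" using False by simp
          ultimately show ?thesis by (simp only: abs_mult indicator_simps abs_one mult_1_right)
        qed (use K1(1) K2(1) E(1) t in auto)
      qed
      also have "\<dots> = (E * E) * (K1 * K2 * 16 ^ m * t ^ m * M2)"
        unfolding M2_def integral_mult_right_zero by (simp only: mult_ac)
      also have "\<dots> \<le> exp (z\<^sup>2 / 8) * (K1 * K2 * 16 ^ m * t ^ m * M2)"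
        using E(3) K1(1) K2(1) M12 t by (intro mult_right_mono) auto
      finally show ?thesis by (simp only: mult_ac)
    qed
    have "\<bar>\<integral>x. (p - x) * ?k x * indicator S x \<partial>\<nu>\<bar> \<le>
      K1 * 4 * 8 ^ m * M1 * exp (z\<^sup>2 / 8) * t ^ m + K3 * exp (z\<^sup>2 / 8) * t ^ m + K1 * K2 * 16 ^ m * M2 * exp (z\<^sup>2 / 8) * t ^ m"
      unfolding split using b2 b3 b4 by linarith
    then show "\<bar>\<integral>x. (poly (estimator m t) z - x) * mehler t x z * indicator {x. t * (1 + \<bar>x\<bar>) \<le> 1 / 16} x \<partial>\<nu>\<bar>
      \<le> (K1 * 4 * 8 ^ m * M1 + K3 + K1 * K2 * 16 ^ m * M2) * exp (z\<^sup>2 / 8) * t ^ m"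
      unfolding p_def S_def distrib_right .
  qed
qed

lemma integrable_estimator_loss:
  assumes t: "0 < t" "t < 1"
  shows "integrable (joint t) (\<lambda>w. (fst w - poly q (snd w))\<^sup>2)"
proof -
  have "integrable (joint t) (\<lambda>w. poly ([:0, 1:] * [:0, 1:]) (fst w) * poly 1 (snd w)
      - 2 * (poly [:0, 1:] (fst w) * poly q (snd w)) + poly 1 (fst w) * poly (q * q) (snd w))"
    by (intro Bochner_Integration.integrable_add Bochner_Integration.integrable_diff integrable_mult_right integrable_joint_poly[OF t])
  then show ?thesis by (simp add: power2_eq_square algebra_simps)
qed

text \<open>A Markov-type argument: off the set one may insert the factor (16 t (1 + |x|))^(2m)
  \<ge> 1, trading moments for powers of t.\<close>

lemma large_part_bound:
  obtains C where "\<And>t. 0 < t \<Longrightarrow> t \<le> 1 / 16 \<Longrightarrow>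
    (\<integral>w. (fst w - poly (estimator m t) (snd w))\<^sup>2 * indicator (- {x. t * (1 + \<bar>x\<bar>) \<le> 1 / 16}) (fst w) \<partial>joint t) \<le> C * t ^ (2 * m)"
proof -
  obtain K where K: "K \<ge> 0" "\<And>t z. 0 < t \<Longrightarrow> t < 1 \<Longrightarrow> \<bar>poly (estimator m t) z\<bar> + 1 \<le> K * (1 + \<bar>z\<bar>) ^ (m + 1)"
    by (rule estimator_le_affine_power[where m = m]) blast
  \<comment> \<open>Squaring the estimator bound gives (1 + |z|)^(2m + 2) and (1 + |x|)^2; the
    inserted factor adds (1 + |x|)^(2m).\<close>
  define i j where "i = 2 * m + 2" and "j = 2 * m + 2"
  define B where "B = (\<integral>x. (1 + \<bar>x\<bar>) ^ (i + j) \<partial>\<nu>) * (\<integral>n. (1 + \<bar>n\<bar>) ^ j \<partial>std_gaussian)"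
  have B: "B \<ge> 0" unfolding B_def by (intro mult_nonneg_nonneg integral_nonneg_AE) auto
  show ?thesis
  proof (rule that[of "K\<^sup>2 * 16 ^ (2 * m) * B"])
    fix t :: real assume t: "0 < t" "t \<le> 1 / 16"
    then have t1: "t < 1" by simp
    define S where "S = {x::real. t * (1 + \<bar>x\<bar>) \<le> 1 / 16}"
    have [measurable]: "S \<in> sets borel" unfolding S_def by measurable
    let ?w = "\<lambda>w :: real \<times> real. (1 + \<bar>fst w\<bar>) ^ i * (1 + \<bar>snd w\<bar>) ^ j"
    have iw: "integrable (joint t) ?w" by (rule integrable_joint_affine_power[OF t(1) t1])
    have "(\<integral>w. ?w w \<partial>joint t) \<le> B"
    proof -
      have "ennreal (\<integral>w. ?w w \<partial>joint t) = (\<integral>\<^sup>+w. ennreal (?w w) \<partial>joint t)"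
        by (rule nn_integral_eq_integral[OF iw, symmetric]) auto
      also have "\<dots> \<le> ennreal B" unfolding B_def by (rule joint_moment_bound[OF t(1) t1])
      finally show ?thesis using B by simp
    qed
    have "(\<integral>w. (fst w - poly (estimator m t) (snd w))\<^sup>2 * indicator (- S) (fst w) \<partial>joint t) \<le> (\<integral>w. (K\<^sup>2 * 16 ^ (2 * m) * t ^ (2 * m)) * ?w w \<partial>joint t)"
    proof (rule integral_mono)
      show "integrable (joint t) (\<lambda>w. (fst w - poly (estimator m t) (snd w))\<^sup>2 * indicator (- S) (fst w))"
        by (rule Bochner_Integration.integrable_bound[OF integrable_estimator_loss[OF t(1) t1, of "estimator m t"]])
           (auto simp: indicator_def)
      show "integrable (joint t) (\<lambda>w. (K\<^sup>2 * 16 ^ (2 * m) * t ^ (2 * m)) * ?w w)" using iw by (rule integrable_mult_right)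
      fix w :: "real \<times> real"
      obtain x z where w: "w = (x, z)" by (cases w)
      show "(fst w - poly (estimator m t) (snd w))\<^sup>2 * indicator (- S) (fst w) \<le> (K\<^sup>2 * 16 ^ (2 * m) * t ^ (2 * m)) * ?w w"
      proof (cases "x \<in> S")
        case False
        then have "1 \<le> 16 * t * (1 + \<bar>x\<bar>)" by (simp add: S_def)
        then have one: "1 \<le> (16 * t * (1 + \<bar>x\<bar>)) ^ (2 * m)" by (rule one_le_power)
        let ?p = "poly (estimator m t) z"
        have "\<bar>x - ?p\<bar> \<le> \<bar>?p\<bar> + \<bar>x\<bar>" by linarith
        also have "\<dots> \<le> (\<bar>?p\<bar> + 1) * (1 + \<bar>x\<bar>)" by (simp add: algebra_simps)
        also have "\<dots> \<le> K * (1 + \<bar>z\<bar>) ^ (m + 1) * (1 + \<bar>x\<bar>)" using K(2)[OF t(1) t1, of z] by (intro mult_right_mono) auto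
        finally have "\<bar>x - ?p\<bar>\<^sup>2 \<le> (K * (1 + \<bar>z\<bar>) ^ (m + 1) * (1 + \<bar>x\<bar>))\<^sup>2" by (intro power_mono) auto
        then have "(x - ?p)\<^sup>2 \<le> (K * (1 + \<bar>z\<bar>) ^ (m + 1) * (1 + \<bar>x\<bar>))\<^sup>2" by simp
        also have "\<dots> \<le> (K * (1 + \<bar>z\<bar>) ^ (m + 1) * (1 + \<bar>x\<bar>))\<^sup>2 * (16 * t * (1 + \<bar>x\<bar>)) ^ (2 * m)"
          using mult_left_mono[OF one, of "(K * (1 + \<bar>z\<bar>) ^ (m + 1) * (1 + \<bar>x\<bar>))\<^sup>2"] by simp
        also have "\<dots> = (K\<^sup>2 * 16 ^ (2 * m) * t ^ (2 * m)) * ?w w"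
          unfolding w i_def j_def power_mult_distrib power_add power_mult[symmetric] fst_conv snd_conv
          by (simp only: mult_ac mult_1_left mult_1_right)
        finally show ?thesis using False by (simp add: w)
      qed (use K(1) in \<open>auto simp: w\<close>)
    qed
    also have "\<dots> = (K\<^sup>2 * 16 ^ (2 * m) * t ^ (2 * m)) * (\<integral>w. ?w w \<partial>joint t)" by (rule integral_mult_right_zero)
    also have "\<dots> \<le> (K\<^sup>2 * 16 ^ (2 * m) * t ^ (2 * m)) * B"
      using \<open>(\<integral>w. ?w w \<partial>joint t) \<le> B\<close> t by (intro mult_left_mono) auto
    finally show "(\<integral>w. (fst w - poly (estimator m t) (snd w))\<^sup>2 * indicator (- {x. t * (1 + \<bar>x\<bar>) \<le> 1 / 16}) (fst w) \<partial>joint t)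
      \<le> K\<^sup>2 * 16 ^ (2 * m) * B * t ^ (2 * m)" unfolding S_def by (simp only: mult_ac)
  qed
qed

text \<open>Pointwise, the small part contributes a multiple of exp(z^2 / 4) over the marginal,
  hence of exp(3 z^2 / 8), which is Gaussian integrable. The large part is integrated back to an
  expectation under \<open>joint t\<close>.\<close>

lemma estimator_error_bound:
  obtains C where "\<And>t. 0 < t \<Longrightarrow> t \<le> 1 / 16 \<Longrightarrow>
    (\<integral>z. marginal t z * (poly (estimator m t) z - posterior t z)\<^sup>2 \<partial>std_gaussian) \<le> C * t ^ (2 * m)"
proof -
  obtain C1 where C1: "C1 \<ge> 0" "\<And>t z. 0 < t \<Longrightarrow> t \<le> 1 / 16 \<Longrightarrow>
    \<bar>\<integral>x. (poly (estimator m t) z - x) * mehler t x z * indicator {x. t * (1 + \<bar>x\<bar>) \<le> 1 / 16} x \<partial>\<nu>\<bar> \<le> C1 * exp (z\<^sup>2 / 8) * t ^ m"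
    by (rule small_part_bound[where m = m]) blast
  obtain C2 where C2: "\<And>t. 0 < t \<Longrightarrow> t \<le> 1 / 16 \<Longrightarrow>
    (\<integral>w. (fst w - poly (estimator m t) (snd w))\<^sup>2 * indicator (- {x. t * (1 + \<bar>x\<bar>) \<le> 1 / 16}) (fst w) \<partial>joint t) \<le> C2 * t ^ (2 * m)"
    by (rule large_part_bound[where m = m]) blast
  define J where "J = (\<integral>z. exp (3 * z\<^sup>2 / 8) \<partial>std_gaussian)"
  show ?thesis
  proof (rule that[of "4 * C1\<^sup>2 * J + 2 * C2"])
    fix t :: real assume t: "0 < t" "t \<le> 1 / 16"
    then have t1: "t < 1" by simp
    define S where "S = {x::real. t * (1 + \<bar>x\<bar>) \<le> 1 / 16}"
    have [measurable]: "S \<in> sets borel" unfolding S_def by measurable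
    let ?p = "\<lambda>z. poly (estimator m t) z"
    define V where "V z = (\<integral>x. (x - ?p z)\<^sup>2 * indicator (- S) x * mehler t x z \<partial>\<nu>)" for z
    have iV': "integrable (joint t) (\<lambda>w. (fst w - ?p (snd w))\<^sup>2 * indicator (- S) (fst w))"
      by (rule Bochner_Integration.integrable_bound[OF integrable_estimator_loss[OF t(1) t1, of "estimator m t"]])
         (auto simp: indicator_def)
    have iV: "integrable std_gaussian V" and eV: "(\<integral>z. V z \<partial>std_gaussian) \<le> C2 * t ^ (2 * m)"
      using integral_joint[OF _ t(1) t1 iV'] C2[OF t] unfolding V_def S_def[symmetric] by simp_all
    have "(\<integral>z. marginal t z * (?p z - posterior t z)\<^sup>2 \<partial>std_gaussian) \<le>
        (\<integral>z. 4 * C1\<^sup>2 * t ^ (2 * m) * exp (3 * z\<^sup>2 / 8) + 2 * V z \<partial>std_gaussian)"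
    proof (rule integral_mono)
      show "integrable std_gaussian (\<lambda>z. marginal t z * (?p z - posterior t z)\<^sup>2)"
        by (rule risk_decomposition(2)[OF t(1) t1 _ integrable_estimator_loss[OF t(1) t1]]) measurable
      show "integrable std_gaussian (\<lambda>z. 4 * C1\<^sup>2 * t ^ (2 * m) * exp (3 * z\<^sup>2 / 8) + 2 * V z)"
        using iV integrable_std_gaussian_exp by (intro Bochner_Integration.integrable_add integrable_mult_right)
      fix z
      define a where "a = (\<integral>x. (?p z - x) * mehler t x z * indicator S x \<partial>\<nu>)"
      have "\<bar>a\<bar> \<le> C1 * exp (z\<^sup>2 / 8) * t ^ m" unfolding a_def S_def by (rule C1(2)[OF t])
      then have "\<bar>a\<bar>\<^sup>2 \<le> (C1 * exp (z\<^sup>2 / 8) * t ^ m)\<^sup>2" by (intro power_mono) auto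
      then have a2: "a\<^sup>2 \<le> C1\<^sup>2 * exp (z\<^sup>2 / 4) * t ^ (2 * m)"
        by (simp add: power_mult_distrib power_mult[symmetric] exp_of_nat_mult[symmetric] mult.commute)
      have "a\<^sup>2 / marginal t z \<le> (C1\<^sup>2 * exp (z\<^sup>2 / 4) * t ^ (2 * m)) / (exp (- (z\<^sup>2 / 8)) / 2)"
        using marginal_ge[OF t, of z] by (intro frac_le a2) auto
      also have "\<dots> = 2 * C1\<^sup>2 * t ^ (2 * m) * (exp (z\<^sup>2 / 4) * exp (z\<^sup>2 / 8))"
        by (simp add: exp_minus field_simps)
      also have "exp (z\<^sup>2 / 4) * exp (z\<^sup>2 / 8) = exp (3 * z\<^sup>2 / 8)" by (simp add: exp_add[symmetric])
      finally have "2 * a\<^sup>2 / marginal t z \<le> 4 * C1\<^sup>2 * t ^ (2 * m) * exp (3 * z\<^sup>2 / 8)" by simp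
      then show "marginal t z * (?p z - posterior t z)\<^sup>2 \<le> 4 * C1\<^sup>2 * t ^ (2 * m) * exp (3 * z\<^sup>2 / 8) + 2 * V z"
        using posterior_error_split[OF t(1) t1, of S z "?p z"] unfolding a_def V_def by simp
    qed
    also have "\<dots> = 4 * C1\<^sup>2 * t ^ (2 * m) * J + 2 * (\<integral>z. V z \<partial>std_gaussian)"
      unfolding J_def using iV integrable_std_gaussian_exp by simp
    also have "\<dots> \<le> 4 * C1\<^sup>2 * t ^ (2 * m) * J + 2 * (C2 * t ^ (2 * m))" using eV by simp
    finally show "(\<integral>z. marginal t z * (?p z - posterior t z)\<^sup>2 \<partial>std_gaussian) \<le> (4 * C1\<^sup>2 * J + 2 * C2) * t ^ (2 * m)"
      by (simp add: algebra_simps)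
  qed
qed

lemma risk_expansion:
  obtains C where "\<And>t. 0 < t \<Longrightarrow> t \<le> 1 / 16 \<Longrightarrow>
    \<bar>risk t - ((1 - t\<^sup>2) - (1 - t\<^sup>2)\<^sup>2 * (\<Sum>n<2 * m. t ^ n * info_coeff herm n))\<bar> \<le> C * t ^ (2 * m)"
proof -
  obtain C1 where C1: "\<And>t. 0 < t \<Longrightarrow> t < 1 \<Longrightarrow>
    \<bar>(\<integral>w. (fst w - poly (estimator m t) (snd w))\<^sup>2 \<partial>joint t) - ((1 - t\<^sup>2) - (1 - t\<^sup>2)\<^sup>2 * (\<Sum>n<2 * m. t ^ n * info_coeff herm n))\<bar> \<le> C1 * t ^ (2 * m)"
    by (rule estimator_risk_expansion[where m = m]) blast
  obtain C2 where C2: "\<And>t. 0 < t \<Longrightarrow> t \<le> 1 / 16 \<Longrightarrow>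
    (\<integral>z. marginal t z * (poly (estimator m t) z - posterior t z)\<^sup>2 \<partial>std_gaussian) \<le> C2 * t ^ (2 * m)"
    by (rule estimator_error_bound[where m = m]) blast
  show ?thesis
  proof (rule that[of "C1 + C2"])
    fix t :: real assume t: "0 < t" "t \<le> 1 / 16"
    then have t1: "t < 1" by simp
    have dec: "risk t = (\<integral>w. (fst w - poly (estimator m t) (snd w))\<^sup>2 \<partial>joint t)
        - (\<integral>z. marginal t z * (poly (estimator m t) z - posterior t z)\<^sup>2 \<partial>std_gaussian)"
      by (rule risk_decomposition(1)[OF t(1) t1 _ integrable_estimator_loss[OF t(1) t1]]) measurable
    have "0 \<le> (\<integral>z. marginal t z * (poly (estimator m t) z - posterior t z)\<^sup>2 \<partial>std_gaussian)"
      using marginal_pos[OF t(1) t1] by (intro integral_nonneg_AE AE_I2) (simp add: less_imp_le)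
    then show "\<bar>risk t - ((1 - t\<^sup>2) - (1 - t\<^sup>2)\<^sup>2 * (\<Sum>n<2 * m. t ^ n * info_coeff herm n))\<bar> \<le> (C1 + C2) * t ^ (2 * m)"
      unfolding dec distrib_right using C1[OF t(1) t1] C2[OF t] by linarith
  qed
qed

end

section \<open>Identification of the distribution\<close>

lemma hermite_generating_ode:
  "fps_deriv (egf (\<lambda>k. poly (hermite k) x)) = (fps_const x - fps_X) * egf (\<lambda>k. poly (hermite k) x)"
proof (rule fps_ext)
  fix n
  show "fps_deriv (egf (\<lambda>k. poly (hermite k) x)) $ n = ((fps_const x - fps_X) * egf (\<lambda>k. poly (hermite k) x)) $ n"
  proof (cases n)
    case (Suc j)
    have "fact n = real n * fact j" by (simp add: Suc)
    then show ?thesis unfolding fps_deriv_egf left_diff_distrib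
      by (simp add: Suc egf_def hermite.simps(3) diff_divide_distrib del: fact_Suc of_nat_Suc)
  qed (simp add: fps_deriv_egf egf_def left_diff_distrib)
qed

text \<open>The factor free of \<open>x\<close> is the series of exp(- t^2 / 2); it enters only
  through its differential equation.\<close>

lemma hermite_generating_function:
  "egf (\<lambda>k. poly (hermite k) x) = fps_exp x * egf (\<lambda>k. poly (hermite k) 0)"
proof -
  let ?F = "egf (\<lambda>k. poly (hermite k) x)" and ?G = "fps_exp x * egf (\<lambda>k. poly (hermite k) 0)"
  have "fps_deriv ?G = (fps_const x - fps_X) * ?G"
    using hermite_generating_ode[of 0] by (simp add: algebra_simps)
  then have "1 * fps_deriv (?F - ?G) = (fps_const x - fps_X) * (?F - ?G)"
    using hermite_generating_ode[of x] by (simp add: algebra_simps)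
  then have "?F - ?G = 0" by (rule fps_linear_ode_unique[rotated]) (simp_all add: egf_def)
  then show ?thesis by simp
qed

lemma hermite_moments_egf:
  assumes "\<And>p. integrable \<nu> (\<lambda>x::real. x ^ p)"
  shows "egf (\<lambda>k. \<integral>x. poly (hermite k) x \<partial>\<nu>) = egf (\<lambda>k. \<integral>x. x ^ k \<partial>\<nu>) * egf (\<lambda>k. poly (hermite k) 0)"
proof (rule fps_ext)
  fix n
  have "poly (hermite n) x / fact n = (\<Sum>i=0..n. x ^ i * (poly (hermite (n - i)) 0 / (fact i * fact (n - i))))" for x
    using arg_cong[OF hermite_generating_function[of x], of "\<lambda>F. F $ n"]
    by (simp add: fps_mult_nth egf_def mult_ac)
  then have "(\<integral>x. poly (hermite n) x / fact n \<partial>\<nu>) = (\<integral>x. (\<Sum>i=0..n. x ^ i * (poly (hermite (n - i)) 0 / (fact i * fact (n - i)))) \<partial>\<nu>)"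
    by simp
  also have "\<dots> = (\<Sum>i=0..n. (\<integral>x. x ^ i \<partial>\<nu>) * (poly (hermite (n - i)) 0 / (fact i * fact (n - i))))"
    using assms by (subst Bochner_Integration.integral_sum) (auto simp: integral_mult_left_zero)
  finally show "egf (\<lambda>k. \<integral>x. poly (hermite k) x \<partial>\<nu>) $ n = (egf (\<lambda>k. \<integral>x. x ^ k \<partial>\<nu>) * egf (\<lambda>k. poly (hermite k) 0)) $ n"
    unfolding fps_mult_nth by (simp add: egf_def mult_ac)
qed

text \<open>The logarithmic derivative of a product: the moment series contributes the cumulants,
  and the Hermite factor exp(- t^2 / 2) contributes - t.\<close>

lemma top_layer_quot_eq_cumulants:
  fixes h m K :: "nat \<Rightarrow> real"
  assumes h: "h 0 = 1" and egf: "egf h = egf m * egf (\<lambda>k. poly (hermite k) 0)"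
    and rec: "\<And>n. (\<Sum>k\<le>n. real (n choose k) * (m (n - k) * K (Suc k))) = m (Suc n)"
  shows "top_layer (quot_fps h) = egf (\<lambda>k. K (Suc k)) - fps_X"
proof -
  let ?C = "egf (\<lambda>k. K (Suc k))" and ?E = "egf (\<lambda>k. poly (hermite k) 0)"
  have mC: "egf m * ?C = fps_deriv (egf m)"
  proof (rule fps_ext)
    fix n
    have "(egf m * ?C) $ n = (\<Sum>i\<le>n. m (n - i) / fact (n - i) * (K (Suc i) / fact i))"
      by (subst mult.commute, subst fps_mult_nth) (simp add: egf_def atLeast0AtMost mult_ac)
    also have "\<dots> = (\<Sum>i\<le>n. real (n choose i) * (m (n - i) * K (Suc i)) / fact n)"
      by (intro sum.cong refl) (simp add: binomial_fact field_simps)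
    also have "\<dots> = m (Suc n) / fact n" by (simp add: rec sum_divide_distrib[symmetric])
    finally show "(egf m * ?C) $ n = fps_deriv (egf m) $ n" by (simp add: fps_deriv_egf) (simp add: egf_def)
  qed
  have E': "fps_deriv ?E = - (fps_X * ?E)" using hermite_generating_ode[of 0] by simp
  have "egf h * top_layer (quot_fps h) = fps_deriv (egf h)" by (rule top_layer_quot_fps[of h, OF h])
  also have "\<dots> = egf h * (?C - fps_X)"
    unfolding egf by (simp add: E' mC[symmetric] algebra_simps)
  finally have "egf h * top_layer (quot_fps h) = egf h * (?C - fps_X)" .
  moreover have "egf h $ 0 = 1" by (simp add: egf_def h)
  then have "egf h \<noteq> 0" by auto
  ultimately show ?thesis by simp
qed

text \<open>Once the lower coefficients vanish, divide by t^j and let t tend to 0 from the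
  right.\<close>

lemma polynomial_vanishing_coeffs:
  fixes a :: "nat \<Rightarrow> real"
  assumes "\<epsilon> > 0" and bound: "\<And>t. 0 < t \<Longrightarrow> t \<le> \<epsilon> \<Longrightarrow> \<bar>\<Sum>j<N. t ^ j * a j\<bar> \<le> C * t ^ N" and "j < N"
  shows "a j = 0"
  using \<open>j < N\<close>
proof (induction j rule: less_induct)
  case (less j)
  define f where "f t = (\<Sum>i=j..<N. t ^ (i - j) * a i)" for t :: real
  have eq: "(\<Sum>i<N. t ^ i * a i) = t ^ j * f t" for t
  proof -
    have "(\<Sum>i<N. t ^ i * a i) = (\<Sum>i=j..<N. t ^ i * a i)"
      by (rule sum.mono_neutral_right) (use less in \<open>auto simp: not_le\<close>)
    also have "\<dots> = t ^ j * f t" unfolding f_def sum_distrib_left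
      by (intro sum.cong refl) (simp add: mult.assoc[symmetric] power_add[symmetric])
    finally show ?thesis .
  qed
  have "(f \<longlongrightarrow> f 0) (at_right 0)" unfolding f_def by (intro tendsto_intros)
  moreover have "f 0 = a j"
  proof -
    have "f 0 = (\<Sum>i=j..<N. if i = j then a j else 0)" unfolding f_def by (intro sum.cong) auto
    then show ?thesis using less.prems by simp
  qed
  moreover have "((\<lambda>t. C * t ^ (N - j)) \<longlongrightarrow> 0) (at_right 0)"
    using less.prems by (auto intro!: tendsto_eq_intros)
  moreover have "eventually (\<lambda>t. norm (f t) \<le> norm (C * t ^ (N - j)) * 1) (at_right 0)"
  proof -
    have "eventually (\<lambda>t. t \<in> {0<..<\<epsilon>}) (at_right (0::real))" using \<open>\<epsilon> > 0\<close> by (rule eventually_at_right_real)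
    then show ?thesis
    proof eventually_elim
      case (elim t)
      then have "t ^ j * \<bar>f t\<bar> \<le> t ^ j * (C * t ^ (N - j))"
        using bound[of t] less.prems by (simp add: eq abs_mult mult.left_commute power_add[symmetric])
      then have "\<bar>f t\<bar> \<le> C * t ^ (N - j)" using elim by simp
      then show ?case by simp
    qed
  qed
  ultimately show ?case
    using tendsto_0_le tendsto_unique trivial_limit_at_right_real by metis
qed

context standardized
begin

lemma risk_tendsto_1: "(risk \<longlongrightarrow> 1) (at_right 0)"
proof -
  obtain C where C: "\<And>t. 0 < t \<Longrightarrow> t \<le> 1 / 16 \<Longrightarrow>
    \<bar>risk t - ((1 - t\<^sup>2) - (1 - t\<^sup>2)\<^sup>2 * (\<Sum>n<2 * 1. t ^ n * info_coeff herm n))\<bar> \<le> C * t ^ (2 * 1)"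
    by (rule risk_expansion[where m = 1]) blast
  define g where "g t = (1 - t\<^sup>2) - (1 - t\<^sup>2)\<^sup>2 * (\<Sum>n<2 * 1. t ^ n * info_coeff herm n)" for t :: real
  have "info_coeff herm 0 = 0" using herm_1 by (simp add: info_coeff_def num_fps_def)
  then have "g 0 = 1" by (simp add: g_def numeral_2_eq_2)
  moreover have "(g \<longlongrightarrow> g 0) (at_right 0)" unfolding g_def by (intro tendsto_intros)
  ultimately have g: "(g \<longlongrightarrow> 1) (at_right 0)" by simp
  have "((\<lambda>t. C * t ^ (2 * 1)) \<longlongrightarrow> 0) (at_right (0::real))" by (auto intro!: tendsto_eq_intros)
  moreover have "eventually (\<lambda>t. norm (risk t - g t) \<le> norm (C * t ^ (2 * 1)) * 1) (at_right 0)"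
  proof -
    have "eventually (\<lambda>t. t \<in> {0<..<1 / 16}) (at_right (0::real))" by (rule eventually_at_right_real) simp
    then show ?thesis
    proof eventually_elim
      case (elim t)
      then have "\<bar>risk t - g t\<bar> \<le> C * t ^ (2 * 1)" unfolding g_def by (intro C) auto
      then show ?case by simp
    qed
  qed
  ultimately have "((\<lambda>t. risk t - g t) \<longlongrightarrow> 0) (at_right 0)" by (rule tendsto_0_le)
  from tendsto_add[OF this g] show ?thesis by simp
qed

lemma integral_poly_eq_herm:
  assumes "degree p \<le> N"
  shows "(\<integral>x. poly p x \<partial>\<nu>) = (\<Sum>k\<le>N. gauss (p * hermite k) / fact k * herm k)"
proof -
  have "(\<integral>x. poly p x \<partial>\<nu>) = (\<integral>x. (\<Sum>k\<le>N. gauss (p * hermite k) / fact k * poly (hermite k) x) \<partial>\<nu>)"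
  proof -
    have "poly p x = (\<Sum>k\<le>N. gauss (p * hermite k) / fact k * poly (hermite k) x)" for x
      by (subst hermite_expansion[OF assms]) (simp add: poly_sum)
    then show ?thesis by (simp only:)
  qed
  also have "\<dots> = (\<Sum>k\<le>N. gauss (p * hermite k) / fact k * herm k)"
    unfolding herm_def
    by (subst Bochner_Integration.integral_sum) (simp_all only: integrable_mult_right integrable_poly integral_mult_right_zero)
  finally show ?thesis .
qed

end

section \<open>Standardising both variables by the same variance\<close>

lemma integral_law_scale:
  assumes "X \<in> borel_measurable M" and [measurable]: "f \<in> borel_measurable borel"
  shows "(\<integral>x. f x \<partial>law M (\<lambda>\<omega>. X \<omega> / \<sigma>)) = (\<integral>x. f (x / \<sigma>) \<partial>law M X :: real)"
  unfolding law_scale[OF assms(1)] by (rule integral_distr) (auto simp: law_def)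

lemma standardized_law:
  assumes M: "prob_space M" and X: "X \<in> borel_measurable M" and mom: "has_all_moments M X"
    and mean: "(\<integral>x. x \<partial>law M X) = 0" and var: "(\<integral>x. x\<^sup>2 \<partial>law M X) = \<sigma>\<^sup>2" and \<sigma>: "\<sigma> > 0"
  shows "standardized (law M (\<lambda>\<omega>. X \<omega> / \<sigma>))"
proof -
  have X': "(\<lambda>\<omega>. X \<omega> / \<sigma>) \<in> borel_measurable M" using X by simp
  interpret real_distribution "law M (\<lambda>\<omega>. X \<omega> / \<sigma>)" by (rule real_distribution_law[OF M X'])
  have "has_all_moments M (\<lambda>\<omega>. X \<omega> / \<sigma>)"
    using mom by (simp add: has_all_moments_def abs_divide power_divide)
  note m = has_all_moments_law[OF X' this]
  show ?thesis
  proof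
    show "integrable (law M (\<lambda>\<omega>. X \<omega> / \<sigma>)) (\<lambda>x. \<bar>x\<bar> ^ p)" for p by (rule m)
    show "(\<integral>x. x \<partial>law M (\<lambda>\<omega>. X \<omega> / \<sigma>)) = 0" using mean by (simp add: integral_law_scale[OF X])
    show "(\<integral>x. x\<^sup>2 \<partial>law M (\<lambda>\<omega>. X \<omega> / \<sigma>)) = 1" using var \<sigma> by (simp add: integral_law_scale[OF X] power_divide)
  qed
qed

text \<open>Reads the variance off the mmse at vanishing signal strength, so that one
  \<open>\<sigma>\<close> can serve both variables.\<close>

lemma mmse_tendsto_variance:
  assumes M: "prob_space M" and X: "X \<in> borel_measurable M" and mom: "has_all_moments M X"
    and mean: "(\<integral>x. x \<partial>law M X) = 0" and var: "(\<integral>x. x\<^sup>2 \<partial>law M X) = \<sigma>\<^sup>2" and \<sigma>: "\<sigma> \<ge> 0"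
  shows "(mmse M X \<longlongrightarrow> \<sigma>\<^sup>2) (at_right 0)"
proof (cases "\<sigma> = 0")
  case True
  interpret real_distribution "law M X" by (rule real_distribution_law) fact+
  have "AE x in law M X. x\<^sup>2 = 0"
    using var True has_all_moments_law(2)[OF X mom, of 2]
    by (subst integral_nonneg_eq_0_iff_AE[symmetric]) auto
  then have "AE x in law M X. x = 0" by simp
  then have "mmse M X s = 0" for s by (rule mmse_AE_zero[OF M X])
  then have "mmse M X = (\<lambda>_. 0)" by auto
  then show ?thesis using True by simp
next
  case False
  then have \<sigma>: "\<sigma> > 0" using \<sigma> by simp
  let ?\<nu> = "law M (\<lambda>\<omega>. X \<omega> / \<sigma>)"
  have st: "standardized ?\<nu>" by (rule standardized_law) fact+
  then interpret N: standardized ?\<nu> .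
  \<comment> \<open>The inverse of s = t^2 / (\<sigma>^2 (1 - t^2)).\<close>
  define T where "T s = sqrt (s * \<sigma>\<^sup>2 / (1 + s * \<sigma>\<^sup>2))" for s
  have T: "0 < T s" "T s < 1" "mmse M X s = \<sigma>\<^sup>2 * N.risk (T s)" if s: "s > 0" for s
  proof -
    define v where "v = s * \<sigma>\<^sup>2"
    have v: "v > 0" using s \<sigma> by (simp add: v_def)
    have T2: "(T s)\<^sup>2 = v / (1 + v)" using v by (simp add: T_def v_def)
    show T0: "0 < T s" using v by (simp add: T_def v_def)
    have "(T s)\<^sup>2 < 1" using v unfolding T2 by simp
    then show T1: "T s < 1" using T0 by (simp add: power_less_one_iff abs_square_less_1)
    have "(T s)\<^sup>2 / (\<sigma>\<^sup>2 * (1 - (T s)\<^sup>2)) = s"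
    proof -
      have "1 - v / (1 + v) = 1 / (1 + v)" using v by (simp add: field_simps)
      then show ?thesis unfolding T2 using v \<sigma> by (simp add: v_def)
    qed
    then show "mmse M X s = \<sigma>\<^sup>2 * N.risk (T s)" using mmse_eq_risk[OF M X mom st \<sigma> T0 T1] by simp
  qed
  have "(T \<longlongrightarrow> 0) (at_right 0)" unfolding T_def by (auto intro!: tendsto_eq_intros)
  moreover have "eventually (\<lambda>s. s > 0) (at_right (0::real))" by (simp add: eventually_at_filter)
  then have "eventually (\<lambda>s. T s \<in> {0<..} \<and> T s \<noteq> 0) (at_right 0)"
  proof eventually_elim
    case (elim s)
    then show ?case using T(1)[of s] by simp
  qed
  ultimately have "filterlim T (at_right 0) (at_right 0)" by (simp add: filterlim_at)
  then have "((\<lambda>s. \<sigma>\<^sup>2 * N.risk (T s)) \<longlongrightarrow> \<sigma>\<^sup>2 * 1) (at_right 0)"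
    by (intro tendsto_intros filterlim_compose[OF N.risk_tendsto_1])
  moreover have "eventually (\<lambda>s. \<sigma>\<^sup>2 * N.risk (T s) = mmse M X s) (at_right 0)"
    using \<open>eventually (\<lambda>s. s > 0) (at_right (0::real))\<close> by eventually_elim (use T in auto)
  ultimately show ?thesis by (simp add: tendsto_cong)
qed

lemma info_coeff_eq_if_risk_eq:
  assumes "standardized \<nu>" "standardized \<nu>'"
    and eq: "\<And>t. 0 < t \<Longrightarrow> t < 1 \<Longrightarrow> standardized.risk \<nu> t = standardized.risk \<nu>' t"
  shows "info_coeff (standardized.herm \<nu>') n = info_coeff (standardized.herm \<nu>) n"
proof -
  interpret A: standardized \<nu> by fact
  interpret B: standardized \<nu>' by fact
  define m where "m = Suc n"
  obtain C where C: "\<And>t. 0 < t \<Longrightarrow> t \<le> 1 / 16 \<Longrightarrow>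
    \<bar>A.risk t - ((1 - t\<^sup>2) - (1 - t\<^sup>2)\<^sup>2 * (\<Sum>n<2 * m. t ^ n * info_coeff A.herm n))\<bar> \<le> C * t ^ (2 * m)"
    by (rule A.risk_expansion[where m = m]) blast
  obtain C' where C': "\<And>t. 0 < t \<Longrightarrow> t \<le> 1 / 16 \<Longrightarrow>
    \<bar>B.risk t - ((1 - t\<^sup>2) - (1 - t\<^sup>2)\<^sup>2 * (\<Sum>n<2 * m. t ^ n * info_coeff B.herm n))\<bar> \<le> C' * t ^ (2 * m)"
    by (rule B.risk_expansion[where m = m]) blast
  define a where "a n = info_coeff B.herm n - info_coeff A.herm n" for n
  have "\<bar>\<Sum>n<2 * m. t ^ n * a n\<bar> \<le> (2 * (C + C')) * t ^ (2 * m)" if t: "0 < t" "t \<le> 1 / 16" for t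
  proof -
    define s where "s = (\<Sum>n<2 * m. t ^ n * a n)"
    have "t\<^sup>2 \<le> (1 / 16)\<^sup>2" using t by (intro power_mono) auto
    then have "(255 / 256)\<^sup>2 \<le> (1 - t\<^sup>2)\<^sup>2" by (intro power_mono) (auto simp: power2_eq_square)
    \<comment> \<open>Dividing by (1 - t^2)^2 thus costs at most a factor 2.\<close>
    then have half: "1 / 2 \<le> (1 - t\<^sup>2)\<^sup>2" by (simp add: power2_eq_square)
    have "s = (\<Sum>n<2 * m. t ^ n * info_coeff B.herm n) - (\<Sum>n<2 * m. t ^ n * info_coeff A.herm n)"
      by (simp add: s_def a_def right_diff_distrib sum_subtractf)
    then have "(1 - t\<^sup>2)\<^sup>2 * s = (1 - t\<^sup>2)\<^sup>2 * (\<Sum>n<2 * m. t ^ n * info_coeff B.herm n) - (1 - t\<^sup>2)\<^sup>2 * (\<Sum>n<2 * m. t ^ n * info_coeff A.herm n)"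
      by (simp add: right_diff_distrib)
    then have "\<bar>(1 - t\<^sup>2)\<^sup>2 * s\<bar> \<le> C * t ^ (2 * m) + C' * t ^ (2 * m)"
      using C[OF t] C'[OF t] eq[of t] t by linarith
    moreover have "1 / 2 * \<bar>s\<bar> \<le> \<bar>(1 - t\<^sup>2)\<^sup>2 * s\<bar>"
      unfolding abs_mult using half by (intro mult_right_mono) auto
    ultimately have "1 / 2 * \<bar>s\<bar> \<le> C * t ^ (2 * m) + C' * t ^ (2 * m)" by (rule order_trans[rotated])
    moreover have "1 / 2 * a \<le> b \<Longrightarrow> a \<le> 2 * b" for a b :: real by linarith
    ultimately have "\<bar>s\<bar> \<le> 2 * (C * t ^ (2 * m) + C' * t ^ (2 * m))" by blast
    then show ?thesis by (simp add: s_def algebra_simps)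
  qed
  then have "a n = 0"
    by (intro polynomial_vanishing_coeffs[where \<epsilon> = "1 / 16" and N = "2 * m" and C = "2 * (C + C')"]) (auto simp: m_def)
  then show ?thesis by (simp add: a_def)
qed

lemma integral_law_symmetric:
  assumes X: "X \<in> borel_measurable M" and sym: "law M X = law M (\<lambda>\<omega>. - X \<omega>)" and [measurable]: "f \<in> borel_measurable borel"
  shows "(\<integral>x. f x \<partial>law M X) = (\<integral>x. f (- x) \<partial>law M X :: real)"
proof -
  have "(\<integral>x. f x \<partial>law M X) = (\<integral>x. f x \<partial>law M (\<lambda>\<omega>. - X \<omega>))" by (rule arg_cong[OF sym])
  also have "\<dots> = (\<integral>\<omega>. f (- X \<omega>) \<partial>M)" unfolding law_def using X by (subst integral_distr) auto
  also have "\<dots> = (\<integral>x. f (- x) \<partial>law M X)" unfolding law_def using X by (subst integral_distr) auto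
  finally show ?thesis .
qed

theorem theorem2p8:
  fixes M :: "'a measure" and X :: "'a \<Rightarrow> real"
    and M' :: "'b measure" and Y :: "'b \<Rightarrow> real"
  assumes "prob_space M" and "X \<in> borel_measurable M"
    and "prob_space M'" and "Y \<in> borel_measurable M'"
    and "SMD M X"
    and "\<forall>n::nat. n \<ge> 1 \<longrightarrow> cumulant M X (2 * n) \<in> \<real> \<and> Re (cumulant M X (2 * n)) > 0"
    and "has_all_moments M' Y"
    and "(\<integral>\<omega>. Y \<omega> \<partial>M') = 0"
    and "\<forall>s::real. s > 0 \<longrightarrow> mmse M X s = mmse M' Y s"
  shows "law M X = law M' Y"
proof -
  note M = assms(1) and X = assms(2) and M' = assms(3) and Y = assms(4) and momY = assms(7)
  have sym: "law M X = law M (\<lambda>\<omega>. - X \<omega>)" and momX: "has_all_moments M X"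
    and det: "\<And>\<nu> :: real measure. prob_space \<nu> \<Longrightarrow> sets \<nu> = sets borel \<Longrightarrow>
      (\<And>p. p \<ge> 1 \<Longrightarrow> integrable \<nu> (\<lambda>y. y ^ p) \<and> (\<integral>y. y ^ p \<partial>\<nu>) = (\<integral>\<omega>. X \<omega> ^ p \<partial>M)) \<Longrightarrow> \<nu> = law M X"
    using assms(5) unfolding SMD_def by blast+
  interpret LX: real_distribution "law M X" by (rule real_distribution_law) fact+
  interpret LY: real_distribution "law M' Y" by (rule real_distribution_law) fact+
  define m where "m k = (\<integral>x. x ^ k \<partial>law M X)" for k
  define K where "K k = Re (cumulant M X k)" for k
  have rec: "(\<Sum>k\<le>n. real (n choose k) * (m (n - k) * K (Suc k))) = m (Suc n)" for n
    unfolding m_def K_def by (rule moment_cumulant_recursion[OF M X momX])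
  have Kpos: "K k > 0" if "even k" "k \<ge> 2" for k
    using assms(6) that unfolding K_def by (auto elim!: evenE)
  have m0: "m 0 = 1" using LX.prob_space by (simp add: m_def)
  have m1: "m 1 = 0" using integral_law_symmetric[OF X sym, of "\<lambda>x. x"] by (simp add: m_def)
  have "K 1 = 0" using rec[of 0] m0 m1 by simp
  then have "m 2 = K 2" using rec[of 1] m0 m1 by (simp add: numeral_2_eq_2)
  \<comment> \<open>Positivity of the second cumulant makes \<open>X\<close> nondegenerate, so that
    it can be scaled to unit variance.\<close>
  then have m2: "m 2 > 0" using Kpos[of 2] by simp
  define \<sigma> where "\<sigma> = sqrt (m 2)"
  have \<sigma>: "\<sigma> > 0" and \<sigma>2: "\<sigma>\<^sup>2 = m 2" using m2 by (simp_all add: \<sigma>_def)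
  have meanX: "(\<integral>x. x \<partial>law M X) = 0" and varX: "(\<integral>x. x\<^sup>2 \<partial>law M X) = \<sigma>\<^sup>2"
    using m1 \<sigma>2 by (simp_all add: m_def)
  have meanY: "(\<integral>x. x \<partial>law M' Y) = 0" using assms(8) Y unfolding law_def by (subst integral_distr) auto
  have varY: "(\<integral>x. x\<^sup>2 \<partial>law M' Y) = \<sigma>\<^sup>2"
  proof -
    \<comment> \<open>\<open>w = 0\<close> is not yet excluded, which is why the limit lemma admits
      a vanishing standard deviation.\<close>
    define w where "w = (\<integral>x. x\<^sup>2 \<partial>law M' Y)"
    have "w \<ge> 0" unfolding w_def by (intro integral_nonneg_AE) auto
    then have "(mmse M' Y \<longlongrightarrow> (sqrt w)\<^sup>2) (at_right 0)"
      by (intro mmse_tendsto_variance[OF M' Y momY meanY]) (auto simp: w_def)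
    moreover have "eventually (\<lambda>s. s > 0) (at_right (0::real))" by (simp add: eventually_at_filter)
    then have "eventually (\<lambda>s. mmse M' Y s = mmse M X s) (at_right 0)" by eventually_elim (use assms(9) in auto)
    ultimately have "(mmse M X \<longlongrightarrow> (sqrt w)\<^sup>2) (at_right 0)" by (simp add: tendsto_cong)
    moreover have "(mmse M X \<longlongrightarrow> \<sigma>\<^sup>2) (at_right 0)"
      using \<sigma> by (intro mmse_tendsto_variance[OF M X momX meanX varX]) auto
    ultimately have "(sqrt w)\<^sup>2 = \<sigma>\<^sup>2" by (rule tendsto_unique[OF trivial_limit_at_right_real])
    then show ?thesis using \<open>w \<ge> 0\<close> by (simp add: w_def)
  qed
  let ?\<nu> = "law M (\<lambda>\<omega>. X \<omega> / \<sigma>)" and ?\<nu>' = "law M' (\<lambda>\<omega>. Y \<omega> / \<sigma>)"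
  have st: "standardized ?\<nu>" by (rule standardized_law[OF M X momX meanX varX \<sigma>])
  have st': "standardized ?\<nu>'" by (rule standardized_law[OF M' Y momY meanY varY \<sigma>])
  interpret A: standardized ?\<nu> by (rule st)
  interpret B: standardized ?\<nu>' by (rule st')
  have "A.risk t = B.risk t" if t: "0 < t" "t < 1" for t
  proof -
    have "t\<^sup>2 / (\<sigma>\<^sup>2 * (1 - t\<^sup>2)) > 0" using t \<sigma> by (simp add: power_less_one_iff)
    then have "\<sigma>\<^sup>2 * A.risk t = \<sigma>\<^sup>2 * B.risk t"
      using assms(9) mmse_eq_risk[OF M X momX st \<sigma> t] mmse_eq_risk[OF M' Y momY st' \<sigma> t] by metis
    then show ?thesis using \<sigma> by simp
  qed
  then have coeffs: "info_coeff B.herm n = info_coeff A.herm n" for n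
    by (rule info_coeff_eq_if_risk_eq[OF st st'])
  \<comment> \<open>Scaling by \<open>\<sigma>\<close> divides moments and cumulants of order k by
    \<sigma>^k, and the recursion is homogeneous under this.\<close>
  have top: "top_layer (quot_fps A.herm) = egf (\<lambda>k. K (Suc k) / \<sigma> ^ Suc k) - fps_X"
  proof (rule top_layer_quot_eq_cumulants[where h = A.herm and m = "\<lambda>k. m k / \<sigma> ^ k" and K = "\<lambda>k. K k / \<sigma> ^ k"])
    show "A.herm 0 = 1" by (rule A.herm_0)
    have "(\<integral>x. x ^ k \<partial>?\<nu>) = m k / \<sigma> ^ k" for k
      unfolding m_def by (simp add: integral_law_scale[OF X] power_divide)
    then show "egf A.herm = egf (\<lambda>k. m k / \<sigma> ^ k) * egf (\<lambda>k. poly (hermite k) 0)"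
      using hermite_moments_egf[OF A.integrable_power] unfolding A.herm_def by simp
    fix n
    have "(\<Sum>k\<le>n. real (n choose k) * (m (n - k) / \<sigma> ^ (n - k) * (K (Suc k) / \<sigma> ^ Suc k))) =
        (\<Sum>k\<le>n. real (n choose k) * (m (n - k) * K (Suc k)) / \<sigma> ^ Suc n)"
    proof (intro sum.cong refl)
      fix k assume "k \<in> {..n}"
      then have eq: "\<sigma> ^ Suc n = \<sigma> ^ (n - k) * \<sigma> ^ Suc k" by (simp add: power_add[symmetric])
      show "real (n choose k) * (m (n - k) / \<sigma> ^ (n - k) * (K (Suc k) / \<sigma> ^ Suc k)) =
        real (n choose k) * (m (n - k) * K (Suc k)) / \<sigma> ^ Suc n"
        unfolding eq by (simp only: times_divide_eq_left times_divide_eq_right divide_divide_eq_left)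
    qed
    then show "(\<Sum>k\<le>n. real (n choose k) * (m (n - k) / \<sigma> ^ (n - k) * (K (Suc k) / \<sigma> ^ Suc k))) = m (Suc n) / \<sigma> ^ Suc n"
      by (simp only: sum_divide_distrib[symmetric] rec)
  qed
  have "B.herm = A.herm"
  proof (rule info_coeff_determines)
    show "A.herm k = 0" if "odd k" for k
    proof -
      have "A.herm k = (\<integral>x. poly (hermite k) (x / \<sigma>) \<partial>law M X)"
        unfolding A.herm_def by (rule integral_law_scale[OF X]) measurable
      also have "\<dots> = (\<integral>x. poly (hermite k) (- x / \<sigma>) \<partial>law M X)"
        by (rule integral_law_symmetric[OF X sym]) measurable
      also have "\<dots> = - (\<integral>x. poly (hermite k) (x / \<sigma>) \<partial>law M X)"
        using that by (simp add: poly_hermite_minus)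
      also have "\<dots> = - A.herm k"
        unfolding A.herm_def by (subst integral_law_scale[OF X]) auto
      finally show ?thesis by simp
    qed
    show "top_layer (quot_fps A.herm) $ (n - 1) > 0" if "even n" "n \<ge> 4" for n
    proof -
      \<comment> \<open>The correction \<open>- fps_X\<close> only affects coefficient 1, so from n
        = 4 on the coefficient is a positive multiple of the cumulant.\<close>
      have "Suc (n - 1) = n" "n - 1 \<noteq> 1" using that by auto
      then show ?thesis unfolding top using Kpos[of n] that \<sigma> by (simp add: egf_def)
    qed
  qed (use coeffs A.herm_0 A.herm_1 A.herm_2 B.herm_0 B.herm_1 B.herm_2 in auto)
  then have mom_eq: "(\<integral>x. x ^ p \<partial>law M' Y) = (\<integral>x. x ^ p \<partial>law M X)" for p
  proof -
    assume eq: "B.herm = A.herm"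
    \<comment> \<open>The monomial is a combination of Hermite polynomials of index at most p, so
      equal Hermite moments give equal moments; the common scaling is then undone.\<close>
    have "(\<integral>x. poly (monom 1 p) x \<partial>?\<nu>') = (\<integral>x. poly (monom 1 p) x \<partial>?\<nu>)"
      using A.integral_poly_eq_herm[of "monom 1 p" p] B.integral_poly_eq_herm[of "monom 1 p" p] eq
      by (simp add: degree_monom_le)
    then show ?thesis
      using \<sigma> by (simp add: poly_monom integral_law_scale[OF X] integral_law_scale[OF Y] power_divide)
  qed
  have "law M' Y = law M X"
  proof (rule det)
    show "prob_space (law M' Y)" by (rule LY.prob_space_axioms)
    show "sets (law M' Y) = sets borel" by simp
    show "integrable (law M' Y) (\<lambda>y. y ^ p) \<and> (\<integral>y. y ^ p \<partial>law M' Y) = (\<integral>\<omega>. X \<omega> ^ p \<partial>M)" for p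
    proof
      show "integrable (law M' Y) (\<lambda>y. y ^ p)" by (rule has_all_moments_law[OF Y momY])
      have "(\<integral>x. x ^ p \<partial>law M X) = (\<integral>\<omega>. X \<omega> ^ p \<partial>M)" unfolding law_def using X by (subst integral_distr) auto
      then show "(\<integral>y. y ^ p \<partial>law M' Y) = (\<integral>\<omega>. X \<omega> ^ p \<partial>M)" by (simp add: mom_eq)
    qed
  qed
  then show ?thesis ..
qed

end
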